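(* Let $\tilde F^-_m := F^-_{T_m}$. (a) If $d \ge 2$, then as $m \to \infty$, \[ \mathbb{P}\big(\tilde F^-_m \le (d!\,m)^{1/d} - 3\ln\ln m\big) \to 0, \] and for every real sequence $c_m \to \infty$, \[ \mathbb{P}\big(\tilde F^-_m \ge (d!\,m)^{1/d} + c_m\big) \to 0; \] consequently $\dfrac{\tilde F^-_m - (d!\,m)^{1/d}}{\ln m} \to 0$ in probability. (b) If $d \ge 5$, then $\dfrac{\tilde F^-_m - (d!\,m)^{1/d}}{\ln m} \to 0$ almost surely.
   Context: Fix an integer $d \ge 2$. Let $X^{(1)}, X^{(2)}, \dots$ be i.i.d. random vectors in $\mathbb{R}^d$ with independent Exponential$(1)$ coordinates. For $x,y \in \mathbb{R}^d$ write $x \prec y$ if $x_j<y_j$ for all $j$, $x \le y$ if $x_j \le y_j$ for all $j$, and $x_+ := \sum_j x_j$. The record-setting region at time $n$ is $\mathrm{RS}_n := \{x \in \mathbb{R}^d : 0 \le x,\ x \not\prec X^{(i)} \text{ for all } 1 \le i \le n\}$, with frontier $F_n$ (its topological boundary relative to $[0,\infty)^d$), and $F_n^- := \min\{x_+ : x \in F_n\}$. $X^{(k)}$ is a (Pareto) record if $X^{(k)} \not\prec X^{(i)}$ for all $1 \le i < k$, and $T_m$ is the index at which the $m$th record is set. *)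

theory Defs
  imports "HOL-Probability.Probability"
begin

text \<open>Vectors in R^d are represented by the type real^'d, d = CARD('d).
  Random vectors X i (i = 1, 2, ...) live on a probability space M.\<close>

definition sprec :: "real^'d \<Rightarrow> real^'d \<Rightarrow> bool" (infix \<open>\<prec>\<^sub>P\<close> 50) where
  "x \<prec>\<^sub>P y \<longleftrightarrow> (\<forall>j. x $ j < y $ j)"

definition orthant :: "(real^'d) set" where
  "orthant = {x. \<forall>j. 0 \<le> x $ j}"

definition RS :: "(nat \<Rightarrow> 'a \<Rightarrow> real^'d) \<Rightarrow> nat \<Rightarrow> 'a \<Rightarrow> (real^'d) set" where
  "RS X n \<omega> = {x \<in> orthant. \<forall>i\<in>{1..n}. \<not> (x \<prec>\<^sub>P X i \<omega>)}"

definition frontierRS :: "(nat \<Rightarrow> 'a \<Rightarrow> real^'d) \<Rightarrow> nat \<Rightarrow> 'a \<Rightarrow> (real^'d) set" where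
  "frontierRS X n \<omega> = (top_of_set orthant) frontier_of (RS X n \<omega>)"

definition Fminus :: "(nat \<Rightarrow> 'a \<Rightarrow> real^'d) \<Rightarrow> nat \<Rightarrow> 'a \<Rightarrow> real" where
  "Fminus X n \<omega> = Inf ((\<lambda>x. \<Sum>j\<in>UNIV. x $ j) ` frontierRS X n \<omega>)"

definition is_record :: "(nat \<Rightarrow> 'a \<Rightarrow> real^'d) \<Rightarrow> nat \<Rightarrow> 'a \<Rightarrow> bool" where
  "is_record X k \<omega> \<longleftrightarrow> 1 \<le> k \<and> (\<forall>i\<in>{1..<k}. \<not> (X k \<omega> \<prec>\<^sub>P X i \<omega>))"

definition record_time :: "(nat \<Rightarrow> 'a \<Rightarrow> real^'d) \<Rightarrow> nat \<Rightarrow> 'a \<Rightarrow> nat" where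
  "record_time X m \<omega> =
     (LEAST k. is_record X k \<omega> \<and> card {i\<in>{1..k}. is_record X i \<omega>} = m)"

definition Ftilde :: "(nat \<Rightarrow> 'a \<Rightarrow> real^'d) \<Rightarrow> nat \<Rightarrow> 'a \<Rightarrow> real" where
  "Ftilde X m \<omega> = Fminus X (record_time X m \<omega>) \<omega>"

end

theory Submission
  imports Defs "HOL-Real_Asymp.Real_Asymp"
begin

text \<open>Let R be the number of records among the first n observations. Its mean is
  (ln n)^d / d! up to O((ln n)^(d-1)), and its variance is O((ln n)^d), so by Chebyshev the
  logarithm of the m-th record time is (d! m)^(1/d) up to a bounded random error. At a
  deterministic time n the frontier minimum is close to ln n: a union bound over an integer grid
  shows that all points of coordinate sum slightly below ln n are dominated, while a given point
  of coordinate sum slightly above ln n is unlikely to be dominated. For the almost sure statement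
  one asks that K+1 well separated points be dominated, which happens with probability about
  (n e^(-b))^(K+1) at height b; this makes the error probabilities summable along the checkpoints
  m = k^d / d!, and monotonicity of the frontier minimum in m fills the gaps, since (d! m)^(1/d)
  grows by a bounded amount between consecutive checkpoints.\<close>

section \<open>Geometry of the record-setting region\<close>

text \<open>The m-th record time depends on the same observations as the frontier, but no
  conditional law is computed. Since \<open>Fminus\<close> grows with time,
  \<open>Ftilde X m\<close> is compared with \<open>Fminus X n\<close> for a deterministic n
  slightly below or above exp((d! m)^(1/d)), on the event that fewer than m, respectively at least
  m, records occur up to n. With L = ln n, shifting L by delta shifts the main term L^d/d! by at
  least delta L^(d-1)/d!, while the variance is O(L^d), so the time comparison fails with
  probability O(L^(2-d)/delta^2). For d = 2 this is small only for large delta, which suffices in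
  probability; for d >= 4 it is O(k^(-2)) when L is of order k. The delicate part is the variance:
  two record indicators are correlated through the observations that may dominate both values x and
  y. Fixing x and y, summing over both indices first and using decay in the l1 distance reduces the
  total covariance to the same integral that bounds the mean. A single dominated test point at
  height s + 3 delta with delta = eps ln k would only give k^(-eps); K+1 points raise this to
  k^(-eps(K+1)).\<close>

definition coord_sum :: "real^'d \<Rightarrow> real" where
  "coord_sum x = (\<Sum>j\<in>UNIV. x $ j)"

lemma coord_sum_mono: "(\<And>j. x $ j \<le> y $ j) \<Longrightarrow> coord_sum x \<le> coord_sum y"
  unfolding coord_sum_def by (intro sum_mono)

lemma continuous_on_coord_sum [continuous_intros]: "continuous_on S coord_sum"
  unfolding coord_sum_def by (intro continuous_intros)

lemma borel_measurable_coord_sum [measurable]: "coord_sum \<in> borel_measurable borel"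
  by (intro borel_measurable_continuous_onI continuous_on_coord_sum)

lemma sprec_trans_le: "(\<And>j. x $ j \<le> y $ j) \<Longrightarrow> y \<prec>\<^sub>P z \<Longrightarrow> x \<prec>\<^sub>P z"
  unfolding sprec_def by (meson le_less_trans)

text \<open>Domination passes to smaller points, so its failure passes to larger ones. This is what
  allows rounding a point of \<open>RS\<close> up to rational or integer coordinates.\<close>

lemma RS_upclosed:
  assumes "x \<in> RS X n \<omega>" "\<And>j. x $ j \<le> y $ j"
  shows "y \<in> RS X n \<omega>"
  using assms sprec_trans_le[OF assms(2)] unfolding RS_def orthant_def
  by (auto intro: order_trans)

lemma RS_antimono: "n \<le> n' \<Longrightarrow> RS X n' \<omega> \<subseteq> RS X n \<omega>"
  unfolding RS_def by auto

lemma closed_orthant: "closed (orthant :: (real^'d) set)"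
  unfolding orthant_def by (intro closed_Collect_all closed_Collect_le continuous_intros)

lemma closed_RS: "closed (RS X n \<omega> :: (real^'d) set)"
proof -
  have eq: "RS X n \<omega> = orthant \<inter> (\<Inter>i\<in>{1..n}. \<Union>j. {x. X i \<omega> $ j \<le> x $ j})"
    unfolding RS_def sprec_def by (auto simp: not_less)
  show ?thesis
    unfolding eq
    by (intro closed_Int closed_orthant closed_INT ballI closed_UN finite_class.finite_UNIV
        closed_Collect_le continuous_intros)
qed

lemma RS_nonempty: "RS X n \<omega> \<noteq> ({} :: (real^'d) set)"
proof -
  define x :: "real^'d" where "x = (\<chi> j. \<Sum>i\<in>{1..n}. \<bar>X i \<omega> $ j\<bar>)"
  have "X i \<omega> $ j \<le> x $ j" if "i \<in> {1..n}" for i j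
  proof -
    have "\<bar>X i \<omega> $ j\<bar> \<le> x $ j"
      unfolding x_def vec_lambda_beta
      using that by (intro member_le_sum[where f="\<lambda>i. \<bar>X i \<omega> $ j\<bar>"]) auto
    then show ?thesis by linarith
  qed
  moreover have "0 \<le> x $ j" for j
    unfolding x_def by (auto intro: sum_nonneg)
  ultimately have "x \<in> RS X n \<omega>"
    unfolding RS_def sprec_def orthant_def by (auto simp: not_less)
  then show ?thesis by blast
qed

lemma coord_sum_RS_bdd_below: "bdd_below (coord_sum ` RS X n \<omega>)"
  by (rule bdd_belowI[of _ 0]) (auto simp: RS_def orthant_def coord_sum_def intro: sum_nonneg)

text \<open>Minimise the coordinate sum over the compact part of \<open>RS\<close> below x. The
  minimiser is not the origin, and shrinking it towards the origin stays in the orthant and lowers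
  the sum. An interior point would contradict minimality, so the minimiser lies on the
  frontier.\<close>

lemma frontierRS_below:
  fixes X :: "nat \<Rightarrow> 'a \<Rightarrow> real^'d"
  assumes pos: "i \<in> {1..n}" "0 \<prec>\<^sub>P X i \<omega>" and x: "x \<in> RS X n \<omega>"
  shows "\<exists>y\<in>frontierRS X n \<omega>. coord_sum y \<le> coord_sum x"
proof -
  define S where "S = RS X n \<omega> \<inter> {y. \<forall>j. y $ j \<le> x $ j}"
  have sub: "S \<subseteq> cbox 0 x"
    unfolding S_def RS_def orthant_def by (auto simp: mem_box_cart)
  have "closed S"
    unfolding S_def by (intro closed_Int closed_RS closed_Collect_all closed_Collect_le continuous_intros)
  then have "compact S"
    using sub bounded_subset[OF bounded_cbox] compact_eq_bounded_closed by blast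
  moreover have "x \<in> S" using x unfolding S_def by auto
  ultimately obtain y where y: "y \<in> S" and ymin: "\<And>z. z \<in> S \<Longrightarrow> coord_sum y \<le> coord_sum z"
    using continuous_attains_inf[of S coord_sum] continuous_on_coord_sum by blast
  have yRS: "y \<in> RS X n \<omega>" and y0: "\<And>j. 0 \<le> y $ j" and yx: "\<And>j. y $ j \<le> x $ j"
    using y unfolding S_def RS_def orthant_def by auto
  \<comment> \<open>The strictly positive observation excludes the origin from \<open>RS\<close>;
    without a positive sum, shrinking would gain nothing.\<close>
  have ysum: "coord_sum y > 0"
  proof (rule ccontr)
    assume "\<not> coord_sum y > 0"
    moreover have "coord_sum y \<ge> 0" unfolding coord_sum_def using y0 by (intro sum_nonneg) auto
    ultimately have "coord_sum y = 0" by linarith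
    then have "y $ j = 0" for j
      using y0 unfolding coord_sum_def by (subst (asm) sum_nonneg_eq_0_iff) auto
    then have "y = 0" by (simp add: vec_eq_iff)
    then show False using yRS pos unfolding RS_def by auto
  qed
  have "y \<notin> (top_of_set orthant) interior_of (RS X n \<omega>)"
  proof
    assume "y \<in> (top_of_set orthant) interior_of (RS X n \<omega>)"
    then obtain U where U: "open U" "y \<in> U" "orthant \<inter> U \<subseteq> RS X n \<omega>"
      by (auto simp: interior_of_def openin_open)
    \<comment> \<open>Scaling by 1 - t with small t > 0 stays inside the relative neighbourhood U of
      y.\<close>
    have "((\<lambda>t. (1 - t) *\<^sub>R y) \<longlongrightarrow> (1 - 0) *\<^sub>R y) (at_right (0::real))"
      by (intro tendsto_intros)
    then have "eventually (\<lambda>t. (1 - t) *\<^sub>R y \<in> U) (at_right (0::real))"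
      using U by (auto dest: topological_tendstoD)
    moreover have "eventually (\<lambda>t. t \<in> {0<..<1}) (at_right (0::real))"
      by (rule eventually_at_right_real) simp
    ultimately have "eventually (\<lambda>t. (1 - t) *\<^sub>R y \<in> U \<and> t \<in> {0<..<1}) (at_right (0::real))"
      by eventually_elim auto
    then obtain t where t: "(1 - t) *\<^sub>R y \<in> U" "0 < t" "t < 1"
      using eventually_happens[of _ "at_right (0::real)"] by (auto simp: trivial_limit_at_right_real)
    define z where "z = (1 - t) *\<^sub>R y"
    have zy: "z $ j \<le> y $ j" for j
      unfolding z_def using t y0[of j] by (simp add: mult_left_le_one_le)
    have "z \<in> orthant" using y0 t unfolding z_def orthant_def by simp
    then have "z \<in> RS X n \<omega>" using U t unfolding z_def by auto
    then have "z \<in> S" unfolding S_def using zy yx by (auto intro: order_trans)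
    then have "coord_sum y \<le> coord_sum z" by (rule ymin)
    also have "\<dots> = (1 - t) * coord_sum y" unfolding z_def coord_sum_def by (simp add: sum_distrib_left)
    finally have "t * coord_sum y \<le> 0" by (simp add: algebra_simps)
    then show False using t ysum by (simp add: mult_le_0_iff)
  qed
  moreover have "y \<in> (top_of_set orthant) closure_of (RS X n \<omega>)"
    using yRS by (intro closure_of_subset[THEN subsetD]) (auto simp: RS_def)
  ultimately have "y \<in> frontierRS X n \<omega>"
    unfolding frontierRS_def frontier_of_def by auto
  moreover have "coord_sum y \<le> coord_sum x" using yx by (rule coord_sum_mono)
  ultimately show ?thesis by blast
qed

lemma frontierRS_subset: "frontierRS X n \<omega> \<subseteq> RS X n \<omega>"
proof -
  have "closedin (top_of_set orthant) (RS X n \<omega>)"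
    by (rule closed_subset) (auto simp: closed_RS, auto simp: RS_def)
  then show ?thesis
    unfolding frontierRS_def by (rule frontier_of_subset_closedin)
qed

text \<open>The frontier disappears here: only the sums over \<open>RS\<close> matter. With a strict
  inequality an infimum needs no attainment. Later facts about \<open>Fminus\<close> rest on this
  equivalence and on \<open>Fminus_no_positive\<close>.\<close>

lemma Fminus_less_iff:
  fixes X :: "nat \<Rightarrow> 'a \<Rightarrow> real^'d"
  assumes pos: "i \<in> {1..n}" "0 \<prec>\<^sub>P X i \<omega>"
  shows "Fminus X n \<omega> < b \<longleftrightarrow> (\<exists>x\<in>RS X n \<omega>. coord_sum x < b)"
proof -
  obtain x where "x \<in> RS X n \<omega>" using RS_nonempty[of X n \<omega>] by blast
  then obtain y where "y \<in> frontierRS X n \<omega>" using frontierRS_below[of i n X \<omega>, OF pos] by blast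
  moreover have "bdd_below (coord_sum ` frontierRS X n \<omega>)"
    using coord_sum_RS_bdd_below frontierRS_subset by (meson bdd_below_mono image_mono)
  ultimately have "Fminus X n \<omega> < b \<longleftrightarrow> (\<exists>x\<in>frontierRS X n \<omega>. coord_sum x < b)"
    unfolding Fminus_def coord_sum_def[symmetric]
    by (subst cInf_less_iff) auto
  also have "\<dots> \<longleftrightarrow> (\<exists>x\<in>RS X n \<omega>. coord_sum x < b)"
    using frontierRS_below[of i n X \<omega>, OF pos] frontierRS_subset[of X n \<omega>] by (meson le_less_trans subsetD)
  finally show ?thesis .
qed

text \<open>Here the frontier is empty and Fminus takes the junk value Inf of the empty set. This can
  only happen on a null set, but measurability is claimed without completing the measure.\<close>

lemma Fminus_no_positive:
  fixes X :: "nat \<Rightarrow> 'a \<Rightarrow> real^'d"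
  assumes "\<And>i. i \<in> {1..n} \<Longrightarrow> \<not> 0 \<prec>\<^sub>P X i \<omega>"
  shows "Fminus X n \<omega> = Inf {}"
proof -
  have "\<not> x \<prec>\<^sub>P X i \<omega>" if "x \<in> orthant" "i \<in> {1..n}" for x i
    using sprec_trans_le[of 0 x "X i \<omega>"] assms that unfolding orthant_def by auto
  then have "RS X n \<omega> = orthant"
    unfolding RS_def by auto
  then have "frontierRS X n \<omega> = {}"
    unfolding frontierRS_def by (metis frontier_of_topspace topspace_euclidean_subtopology)
  then show ?thesis unfolding Fminus_def by simp
qed

lemma Fminus_mono:
  fixes X :: "nat \<Rightarrow> 'a \<Rightarrow> real^'d"
  assumes pos: "\<And>i. 1 \<le> i \<Longrightarrow> 0 \<prec>\<^sub>P X i \<omega>" and "1 \<le> n" "n \<le> n'"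
  shows "Fminus X n \<omega> \<le> Fminus X n' \<omega>"
proof (rule ccontr)
  assume "\<not> ?thesis"
  then have "Fminus X n' \<omega> < Fminus X n \<omega>" by simp
  moreover have p: "1 \<in> {1..n}" "1 \<in> {1..n'}" "0 \<prec>\<^sub>P X 1 \<omega>" using assms by auto
  ultimately obtain x where "x \<in> RS X n' \<omega>" "coord_sum x < Fminus X n \<omega>"
    using Fminus_less_iff[of 1 n' X \<omega>] by blast
  then have "Fminus X n \<omega> < Fminus X n \<omega>"
    using Fminus_less_iff[of 1 n X \<omega>] p RS_antimono[OF \<open>n \<le> n'\<close>, of X \<omega>] by blast
  then show False by simp
qed

text \<open>Since \<open>RS\<close> is closed upwards and the inequality is strict, the slack can be
  spent on rounding up to rationals. The uncountable existential becomes countable, hence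
  measurable.\<close>

lemma RS_rational_point:
  fixes X :: "nat \<Rightarrow> 'a \<Rightarrow> real^'d"
  shows "(\<exists>x\<in>RS X n \<omega>. coord_sum x < b) \<longleftrightarrow>
    (\<exists>q :: rat^'d. (\<chi> j. real_of_rat (q $ j)) \<in> RS X n \<omega> \<and> coord_sum (\<chi> j. real_of_rat (q $ j)) < b)"
    (is "?L \<longleftrightarrow> ?R")
proof
  assume ?L
  then obtain x where x: "x \<in> RS X n \<omega>" "coord_sum x < b" by blast
  \<comment> \<open>Raising each of the d coordinates by at most e uses up only half of the
    slack.\<close>
  define e where "e = (b - coord_sum x) / (2 * real CARD('d))"
  have e: "e > 0" using x by (simp add: e_def)
  have "\<exists>q. x $ j < real_of_rat q \<and> real_of_rat q < x $ j + e" for j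
    using of_rat_dense[of "x $ j" "x $ j + e"] e by auto
  then obtain q where q: "\<And>j. x $ j < real_of_rat (q j)" "\<And>j. real_of_rat (q j) < x $ j + e"
    by metis
  define r where "r = (\<chi> j. q j)"
  have "(\<chi> j. real_of_rat (r $ j)) \<in> RS X n \<omega>"
    by (rule RS_upclosed[OF x(1)]) (use q(1) in \<open>auto simp: r_def intro: less_imp_le\<close>)
  moreover have "coord_sum (\<chi> j. real_of_rat (r $ j)) \<le> (\<Sum>j\<in>UNIV. x $ j + e)"
    unfolding coord_sum_def by (intro sum_mono) (use q(2) in \<open>auto simp: r_def intro: less_imp_le\<close>)
  moreover have "\<dots> = coord_sum x + real CARD('d) * e"
    by (simp add: sum.distrib coord_sum_def)
  moreover have "real CARD('d) * e = (b - coord_sum x) / 2"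
    by (simp add: e_def field_simps)
  ultimately have "(\<chi> j. real_of_rat (r $ j)) \<in> RS X n \<omega> \<and> coord_sum (\<chi> j. real_of_rat (r $ j)) < b"
    using x(2) by (auto simp: field_simps)
  then show ?R by blast
qed auto

section \<open>Counting records and locating the m-th record time\<close>

definition num_records :: "(nat \<Rightarrow> 'a \<Rightarrow> real^'d) \<Rightarrow> nat \<Rightarrow> 'a \<Rightarrow> nat" where
  "num_records X n \<omega> = card {i\<in>{1..n}. is_record X i \<omega>}"

lemma num_records_0 [simp]: "num_records X 0 \<omega> = 0"
  by (simp add: num_records_def)

lemma num_records_Suc:
  "num_records X (Suc n) \<omega> = num_records X n \<omega> + (if is_record X (Suc n) \<omega> then 1 else 0)"
proof -
  have "{i\<in>{1..Suc n}. is_record X i \<omega>} = {i\<in>{1..n}. is_record X i \<omega>} \<union>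
      (if is_record X (Suc n) \<omega> then {Suc n} else {})"
    by (auto simp: le_Suc_eq)
  then show ?thesis
    unfolding num_records_def by (auto simp: card_insert_if)
qed

lemma num_records_mono: "n \<le> n' \<Longrightarrow> num_records X n \<omega> \<le> num_records X n' \<omega>"
  by (rule lift_Suc_mono_le[of "\<lambda>n. num_records X n \<omega>"]) (auto simp: num_records_Suc)

lemma num_records_eq_sum:
  "real (num_records X n \<omega>) = (\<Sum>k=1..n. indicator {\<omega>. is_record X k \<omega>} \<omega>)"
  by (induction n) (auto simp: num_records_Suc)

text \<open>A discrete intermediate value argument: the count starts at 0 and grows by at most one,
  so it reaches m exactly at a record.\<close>

lemma record_time_exists:
  assumes "1 \<le> m" "m \<le> num_records X n \<omega>"
  shows "\<exists>k\<le>n. is_record X k \<omega> \<and> num_records X k \<omega> = m"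
  using assms
proof (induction n)
  case (Suc n)
  show ?case
  proof (cases "m \<le> num_records X n \<omega>")
    case True
    then show ?thesis using Suc by (meson le_SucI)
  next
    case False
    then have "is_record X (Suc n) \<omega>" "num_records X (Suc n) \<omega> = m"
      using Suc.prems by (auto simp: num_records_Suc split: if_splits)
    then show ?thesis by blast
  qed
qed simp

text \<open>The assumption that m records occur by time n makes the \<open>LEAST\<close> genuine.
  Together with \<open>record_time_greater\<close> this is the duality between record times and
  record counts.\<close>

lemma record_time_works:
  assumes "1 \<le> m" "m \<le> num_records X n \<omega>"
  shows "record_time X m \<omega> \<le> n" "is_record X (record_time X m \<omega>) \<omega>"
    "num_records X (record_time X m \<omega>) \<omega> = m" "1 \<le> record_time X m \<omega>"
proof -
  obtain k where k: "k \<le> n" "is_record X k \<omega> \<and> num_records X k \<omega> = m"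
    using record_time_exists[OF assms] by blast
  have eq: "record_time X m \<omega> = (LEAST k. is_record X k \<omega> \<and> num_records X k \<omega> = m)"
    by (simp add: record_time_def num_records_def)
  show "record_time X m \<omega> \<le> n"
    unfolding eq using Least_le[of "\<lambda>k. is_record X k \<omega> \<and> num_records X k \<omega> = m", OF k(2)] k(1) by simp
  have "is_record X (record_time X m \<omega>) \<omega> \<and> num_records X (record_time X m \<omega>) \<omega> = m"
    unfolding eq by (rule LeastI[of "\<lambda>k. is_record X k \<omega> \<and> num_records X k \<omega> = m", OF k(2)])
  then show "is_record X (record_time X m \<omega>) \<omega>"
    "num_records X (record_time X m \<omega>) \<omega> = m" "1 \<le> record_time X m \<omega>"
    by (auto simp: is_record_def)
qed

text \<open>The extra index n' only certifies that an m-th record exists; otherwise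
  \<open>record_time\<close> could be any default value.\<close>

lemma record_time_greater:
  assumes "1 \<le> m" "num_records X n \<omega> < m" "m \<le> num_records X n' \<omega>"
  shows "n < record_time X m \<omega>"
proof (rule ccontr)
  assume "\<not> ?thesis"
  then have "num_records X (record_time X m \<omega>) \<omega> \<le> num_records X n \<omega>"
    by (intro num_records_mono) simp
  then show False using record_time_works[OF assms(1,3)] assms(2) by simp
qed

lemma record_time_mono:
  assumes "1 \<le> m" "m \<le> m'" "m' \<le> num_records X n \<omega>"
  shows "record_time X m \<omega> \<le> record_time X m' \<omega>"
proof -
  \<comment> \<open>At the time of record m' the count is m' >= m, so that time serves as the
    horizon for record m.\<close>
  note A = record_time_works[of m' X n \<omega>] record_time_works[of m X "record_time X m' \<omega>" \<omega>]
  then show ?thesis using assms by simp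
qed

lemma Ftilde_mono:
  fixes X :: "nat \<Rightarrow> 'a \<Rightarrow> real^'d"
  assumes "\<And>i. 1 \<le> i \<Longrightarrow> 0 \<prec>\<^sub>P X i \<omega>" "1 \<le> m" "m \<le> m'" "m' \<le> num_records X n \<omega>"
  shows "Ftilde X m \<omega> \<le> Ftilde X m' \<omega>"
  unfolding Ftilde_def
proof (rule Fminus_mono)
  show "1 \<le> record_time X m \<omega>" using assms by (meson order_trans record_time_works(4))
qed (use assms record_time_mono[of m m' X n \<omega>] in auto)

section \<open>Measurability of records, record times and frontier minima\<close>

lemma pred_sprec [measurable (raw)]:
  fixes f g :: "'a \<Rightarrow> real^'d"
  assumes "f \<in> borel_measurable M" "g \<in> borel_measurable M"
  shows "Measurable.pred M (\<lambda>\<omega>. f \<omega> \<prec>\<^sub>P g \<omega>)"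
proof -
  have [measurable]: "(\<lambda>\<omega>. f \<omega> $ j) \<in> borel_measurable M" "(\<lambda>\<omega>. g \<omega> $ j) \<in> borel_measurable M" for j
    using assms by (auto intro!: measurable_compose[OF _ borel_measurable_nth])
  show ?thesis
    unfolding sprec_def by measurable
qed

context
  fixes M :: "'a measure" and X :: "nat \<Rightarrow> 'a \<Rightarrow> real^'d"
  assumes X_meas: "\<And>i. 1 \<le> i \<Longrightarrow> X i \<in> borel_measurable M"
begin

lemma pred_is_record: "Measurable.pred M (is_record X k)"
proof (cases "k = 0")
  case False
  have "Measurable.pred M (\<lambda>\<omega>. \<not> (X k \<omega> \<prec>\<^sub>P X i \<omega>))" if "i \<in> {1..<k}" for i
    using pred_sprec[of "X k" M "X i"] X_meas[of k] X_meas[of i] that False by auto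
  then have "Measurable.pred M (\<lambda>\<omega>. \<forall>i\<in>{1..<k}. \<not> (X k \<omega> \<prec>\<^sub>P X i \<omega>))"
    by (intro pred_intros_finite) auto
  then show ?thesis
    using False by (simp add: is_record_def[abs_def])
qed (simp add: is_record_def[abs_def])

lemma measurable_num_records: "num_records X n \<in> measurable M (count_space UNIV)"
proof (induction n)
  case (Suc n)
  have eq: "num_records X (Suc n) =
      (\<lambda>\<omega>. if is_record X (Suc n) \<omega> then Suc (num_records X n \<omega>) else num_records X n \<omega>)"
    by (simp add: fun_eq_iff num_records_Suc)
  have "(\<lambda>\<omega>. Suc (num_records X n \<omega>)) \<in> measurable M (count_space UNIV)"
    by (rule measurable_compose[OF Suc]) simp
  then show ?case
    unfolding eq using pred_is_record Suc by (intro measurable_If) (simp_all add: pred_def)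
next
  case 0
  have "num_records X 0 = (\<lambda>\<omega>. 0)" by (simp add: fun_eq_iff)
  then show ?case by simp
qed

lemma measurable_record_time: "record_time X m \<in> measurable M (count_space UNIV)"
proof -
  note [measurable] = measurable_num_records pred_is_record
  show ?thesis
    unfolding record_time_def[abs_def] num_records_def[symmetric] by measurable
qed

lemma pred_mem_RS: "Measurable.pred M (\<lambda>\<omega>. x \<in> RS X n \<omega>)"
proof -
  have "Measurable.pred M (\<lambda>\<omega>. \<not> (x \<prec>\<^sub>P X i \<omega>))" if "i \<in> {1..n}" for i
    using pred_sprec[of "\<lambda>_. x" M "X i"] X_meas[of i] that by auto
  then have "Measurable.pred M (\<lambda>\<omega>. \<forall>i\<in>{1..n}. \<not> (x \<prec>\<^sub>P X i \<omega>))"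
    by (intro pred_intros_finite) auto
  then show ?thesis
    by (cases "x \<in> orthant") (auto simp: RS_def)
qed

lemma pred_RS_less: "Measurable.pred M (\<lambda>\<omega>. \<exists>x\<in>RS X n \<omega>. coord_sum x < b)"
proof -
  note [measurable] = pred_mem_RS
  show ?thesis
    unfolding RS_rational_point by measurable
qed

lemma measurable_Fminus: "Fminus X n \<in> borel_measurable M"
  unfolding borel_measurable_iff_less
proof
  fix b
  \<comment> \<open>\<open>Fminus_less_iff\<close> needs a positive observation among the first n.
    Off this event \<open>Fminus\<close> is the constant \<open>Inf {}\<close>.\<close>
  define P where "P \<omega> \<longleftrightarrow> (\<exists>i\<in>{1..n}. 0 \<prec>\<^sub>P X i \<omega>)" for \<omega>
  have "Measurable.pred M (\<lambda>\<omega>. 0 \<prec>\<^sub>P X i \<omega>)" if "i \<in> {1..n}" for i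
    using pred_sprec[of "\<lambda>_. 0" M "X i"] X_meas[of i] that by auto
  then have [measurable]: "Measurable.pred M P"
    unfolding P_def by (intro pred_intros_finite) auto
  note [measurable] = pred_RS_less
  have "Fminus X n \<omega> < b \<longleftrightarrow> (if P \<omega> then (\<exists>x\<in>RS X n \<omega>. coord_sum x < b) else Inf {} < b)" for \<omega>
    using Fminus_less_iff[of _ n X \<omega> b] Fminus_no_positive[of n X \<omega>] unfolding P_def by auto
  then show "{\<omega> \<in> space M. Fminus X n \<omega> < b} \<in> sets M"
    by simp
qed

text \<open>A sequence of measurable functions evaluated at a measurable random index is measurable
  because the index takes countably many values.\<close>

lemma measurable_Ftilde: "Ftilde X m \<in> borel_measurable M"
  unfolding Ftilde_def[abs_def]
  by (rule measurable_compose_countable[OF measurable_Fminus measurable_record_time])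

end

section \<open>The law of the observations\<close>

lemma borel_measurable_vec_lambda [measurable (raw)]:
  fixes f :: "'d::finite \<Rightarrow> 'a \<Rightarrow> real"
  assumes [measurable]: "\<And>j. f j \<in> borel_measurable M"
  shows "(\<lambda>x. \<chi> j. f j x) \<in> borel_measurable M"
  by (rule borel_measurable_euclidean_space[THEN iffD2])
    (auto simp: Basis_vec_def inner_axis)

text \<open>The product of exponential laws lives on functions and is transported to
  \<open>real^'d\<close>; integrals of coordinate products therefore factorise.\<close>

definition exp_law :: "(real^'d) measure" where
  "exp_law = distr (\<Pi>\<^sub>M j\<in>UNIV. density lborel (\<lambda>t. ennreal (exponential_density 1 t))) borel (\<lambda>f. \<chi> j. f j)"

lemma vec_lambda_measurable_PiM:
  "(\<lambda>f. \<chi> j. f j) \<in> measurable (\<Pi>\<^sub>M j\<in>(UNIV::'d::finite set). density lborel (\<lambda>t. ennreal (exponential_density 1 t)))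
     (borel :: (real^'d) measure)"
proof (rule borel_measurable_vec_lambda)
  fix j :: 'd
  have "(\<lambda>f. f j) \<in> measurable (\<Pi>\<^sub>M j\<in>(UNIV::'d set). density lborel (\<lambda>t. ennreal (exponential_density 1 t)))
     (density lborel (\<lambda>t. ennreal (exponential_density 1 t)))"
    by (rule measurable_component_singleton) simp
  then show "(\<lambda>f. f j) \<in> borel_measurable (\<Pi>\<^sub>M j\<in>(UNIV::'d set). density lborel (\<lambda>t. ennreal (exponential_density 1 t)))"
    by simp
qed

lemma sets_exp_law [simp, measurable_cong]: "sets exp_law = sets borel"
  by (simp add: exp_law_def)

lemma space_exp_law [simp]: "space exp_law = UNIV"
  by (simp add: exp_law_def)

lemma prob_space_exp_law: "prob_space (exp_law :: (real^'d) measure)"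
  unfolding exp_law_def
  by (intro prob_space.prob_space_distr prob_space_PiM vec_lambda_measurable_PiM prob_space_exponential_density) simp

lemma nn_integral_exp_law_prod:
  fixes f :: "'d::finite \<Rightarrow> real \<Rightarrow> ennreal"
  assumes [measurable]: "\<And>j. f j \<in> borel_measurable borel"
  shows "(\<integral>\<^sup>+x. (\<Prod>j\<in>UNIV. f j (x $ j)) \<partial>exp_law) =
    (\<Prod>j\<in>UNIV. \<integral>\<^sup>+t. ennreal (exponential_density 1 t) * f j t \<partial>lborel)"
proof -
  interpret product_sigma_finite "\<lambda>j::'d. density lborel (\<lambda>t. ennreal (exponential_density 1 t))"
    unfolding product_sigma_finite_def
    by (intro allI prob_space_imp_sigma_finite prob_space_exponential_density) simp
  have "(\<integral>\<^sup>+x. (\<Prod>j\<in>UNIV. f j (x $ j)) \<partial>exp_law) =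
    (\<integral>\<^sup>+g. (\<Prod>j\<in>UNIV. f j (g j)) \<partial>(\<Pi>\<^sub>M j\<in>UNIV. density lborel (\<lambda>t. ennreal (exponential_density 1 t))))"
    unfolding exp_law_def
    by (subst nn_integral_distr[OF vec_lambda_measurable_PiM]) auto
  also have "\<dots> = (\<Prod>j\<in>UNIV. \<integral>\<^sup>+t. f j t \<partial>density lborel (\<lambda>t. ennreal (exponential_density 1 t)))"
    by (rule product_nn_integral_prod) auto
  also have "\<dots> = (\<Prod>j\<in>UNIV. \<integral>\<^sup>+t. ennreal (exponential_density 1 t) * f j t \<partial>lborel)"
    by (intro prod.cong refl nn_integral_density) auto
  finally show ?thesis .
qed

text \<open>Conditioning on U by Fubini: under independence the joint law is a product, so U can be
  frozen at the value U(w') and the remaining probability averaged over w'.\<close>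

lemma (in prob_space) indep_var_freeze:
  assumes ind: "indep_var S U T V" and [measurable]: "Measurable.pred (S \<Otimes>\<^sub>M T) Q"
  shows "emeasure M {\<omega>\<in>space M. Q (U \<omega>, V \<omega>)} =
    (\<integral>\<^sup>+\<omega>'. emeasure M {\<omega>\<in>space M. Q (U \<omega>', V \<omega>)} \<partial>M)"
proof -
  have [measurable]: "U \<in> measurable M S" "V \<in> measurable M T"
    using ind unfolding indep_var_distribution_eq by auto
  have eq: "distr M S U \<Otimes>\<^sub>M distr M T V = distr M (S \<Otimes>\<^sub>M T) (\<lambda>x. (U x, V x))"
    using ind unfolding indep_var_distribution_eq by auto
  interpret V: prob_space "distr M T V" by (rule prob_space_distr) simp
  have Q: "{p \<in> space (S \<Otimes>\<^sub>M T). Q p} \<in> sets (S \<Otimes>\<^sub>M T)" by simp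
  have "emeasure M {\<omega>\<in>space M. Q (U \<omega>, V \<omega>)} =
      emeasure (distr M (S \<Otimes>\<^sub>M T) (\<lambda>x. (U x, V x))) {p \<in> space (S \<Otimes>\<^sub>M T). Q p}"
    by (subst emeasure_distr[OF _ Q])
      (auto intro!: arg_cong[where f="emeasure M"] measurable_space[of _ M]
        simp: space_pair_measure dest: measurable_space[OF \<open>U \<in> measurable M S\<close>] measurable_space[OF \<open>V \<in> measurable M T\<close>])
  also have "\<dots> = (\<integral>\<^sup>+u. emeasure (distr M T V) (Pair u -` {p \<in> space (S \<Otimes>\<^sub>M T). Q p}) \<partial>distr M S U)"
    unfolding eq[symmetric] using Q by (intro V.emeasure_pair_measure_alt) simp
  also have "\<dots> = (\<integral>\<^sup>+\<omega>'. emeasure (distr M T V) (Pair (U \<omega>') -` {p \<in> space (S \<Otimes>\<^sub>M T). Q p}) \<partial>M)"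
  proof -
    have "{p \<in> space (S \<Otimes>\<^sub>M T). Q p} \<in> sets (S \<Otimes>\<^sub>M distr M T V)" using Q by simp
    then have "(\<lambda>u. emeasure (distr M T V) (Pair u -` {p \<in> space (S \<Otimes>\<^sub>M T). Q p})) \<in> borel_measurable S"
      by (rule V.measurable_emeasure_Pair)
    then show ?thesis by (subst nn_integral_distr) simp_all
  qed
  also have "\<dots> = (\<integral>\<^sup>+\<omega>'. emeasure M {\<omega>\<in>space M. Q (U \<omega>', V \<omega>)} \<partial>M)"
  proof (rule nn_integral_cong)
    fix \<omega>' assume "\<omega>' \<in> space M"
    then have *: "U \<omega>' \<in> space S" by (rule measurable_space[OF \<open>U \<in> measurable M S\<close>])
    have "Pair (U \<omega>') -` {p \<in> space (S \<Otimes>\<^sub>M T). Q p} \<in> sets T"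
      using sets_Pair1[OF Q] by simp
    then show "emeasure (distr M T V) (Pair (U \<omega>') -` {p \<in> space (S \<Otimes>\<^sub>M T). Q p}) =
        emeasure M {\<omega>\<in>space M. Q (U \<omega>', V \<omega>)}"
      using * measurable_space[OF \<open>V \<in> measurable M T\<close>]
      by (subst emeasure_distr) (auto intro!: arg_cong[where f="emeasure M"] simp: space_pair_measure)
  qed
  finally show ?thesis .
qed

section \<open>The observations as independent vectors with law \<open>exp_law\<close>\<close>

locale exp_vectors = prob_space M for M :: "'a measure" +
  fixes X :: "nat \<Rightarrow> 'a \<Rightarrow> real^'d"
  assumes indep_coords: "indep_vars (\<lambda>_. borel) (\<lambda>(i, j) \<omega>. X i \<omega> $ j) ({1..} \<times> UNIV)"
    and exp_coords: "\<And>i j. i \<ge> 1 \<Longrightarrow> distributed M lborel (\<lambda>\<omega>. X i \<omega> $ j) (exponential_density 1)"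
begin

lemma X_measurable: "i \<ge> 1 \<Longrightarrow> X i \<in> borel_measurable M"
proof -
  assume "i \<ge> 1"
  then have "(\<lambda>\<omega>. X i \<omega> $ j) \<in> borel_measurable M" for j
    using distributed_measurable[OF exp_coords] by simp
  then have "(\<lambda>\<omega>. \<chi> j. X i \<omega> $ j) \<in> borel_measurable M"
    by (intro borel_measurable_vec_lambda) auto
  then show ?thesis by simp
qed

text \<open>The doubly indexed coordinate family is grouped into disjoint blocks, one for each
  observation; functions of disjoint blocks stay independent.\<close>

lemma indep_X: "indep_vars (\<lambda>_. borel) X {1..}"
proof -
  have "indep_vars (\<lambda>i. PiM ({i} \<times> UNIV) (\<lambda>_. borel))
      (\<lambda>i \<omega>. restrict (\<lambda>p. (case p of (i, j) \<Rightarrow> \<lambda>\<omega>. X i \<omega> $ j) \<omega>) ({i} \<times> (UNIV :: 'd set))) {1..}"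
    by (rule indep_vars_restrict[OF indep_coords]) (auto simp: disjoint_family_on_def)
  then have "indep_vars (\<lambda>_. borel) (\<lambda>i \<omega>. (\<lambda>f. \<chi> j. f (i, j))
      (restrict (\<lambda>p. (case p of (i, j) \<Rightarrow> \<lambda>\<omega>. X i \<omega> $ j) \<omega>) ({i} \<times> (UNIV :: 'd set)))) {1..}"
    by (rule indep_vars_compose2)
      (intro borel_measurable_vec_lambda measurable_component_singleton, simp)
  then show ?thesis
    by (rule indep_vars_cong[THEN iffD1, rotated -1]) (auto simp: fun_eq_iff vec_eq_iff)
qed

lemma indep_X_coords:
  assumes "i \<ge> 1"
  shows "indep_vars (\<lambda>_. borel) (\<lambda>j \<omega>. X i \<omega> $ j) UNIV"
proof -
  have "indep_vars (\<lambda>j. PiM {(i, j)} (\<lambda>_. borel))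
      (\<lambda>j \<omega>. restrict (\<lambda>p. (case p of (i, j) \<Rightarrow> \<lambda>\<omega>. X i \<omega> $ j) \<omega>) {(i, j)}) UNIV"
    by (rule indep_vars_restrict[OF indep_coords]) (use assms in \<open>auto simp: disjoint_family_on_def\<close>)
  then have "indep_vars (\<lambda>_. borel) (\<lambda>j \<omega>. (\<lambda>f. f (i, j))
      (restrict (\<lambda>p. (case p of (i, j) \<Rightarrow> \<lambda>\<omega>. X i \<omega> $ j) \<omega>) {(i, j)})) UNIV"
    by (rule indep_vars_compose2) (rule measurable_component_singleton, simp)
  then show ?thesis
    by (rule indep_vars_cong[THEN iffD1, rotated -1]) (auto simp: fun_eq_iff)
qed

lemma distr_X:
  assumes i: "i \<ge> 1"
  shows "distr M borel (X i) = exp_law"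
proof -
  note [measurable] = X_measurable[OF i]
  have eq1: "distr M borel (\<lambda>\<omega>. X i \<omega> $ j) = density lborel (\<lambda>t. ennreal (exponential_density 1 t))" for j
    using distributed_distr_eq_density[OF exp_coords[OF i, of j]]
    by (metis distr_cong sets_lborel)
  have m: "(\<lambda>\<omega>. X i \<omega> $ j) \<in> borel_measurable M" for j
    using distributed_measurable[OF exp_coords[OF i]] by simp
  have m2: "(\<lambda>\<omega>. \<lambda>j\<in>UNIV. X i \<omega> $ j) \<in> measurable M (\<Pi>\<^sub>M j\<in>(UNIV::'d set). borel)"
    by (rule measurable_restrict) (rule m)
  have "distr M (\<Pi>\<^sub>M j\<in>(UNIV::'d set). borel) (\<lambda>\<omega>. \<lambda>j\<in>UNIV. X i \<omega> $ j) =
      (\<Pi>\<^sub>M j\<in>UNIV. distr M borel (\<lambda>\<omega>. X i \<omega> $ j))"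
    by (rule indep_vars_iff_distr_eq_PiM[THEN iffD1]) (use m indep_X_coords[OF i] in auto)
  then have eq2: "distr M (\<Pi>\<^sub>M j\<in>(UNIV::'d set). borel) (\<lambda>\<omega>. \<lambda>j\<in>UNIV. X i \<omega> $ j) =
      (\<Pi>\<^sub>M j\<in>UNIV. density lborel (\<lambda>t. ennreal (exponential_density 1 t)))"
    by (simp add: eq1)
  have "exp_law = distr (distr M (\<Pi>\<^sub>M j\<in>(UNIV::'d set). borel) (\<lambda>\<omega>. \<lambda>j\<in>UNIV. X i \<omega> $ j)) borel (\<lambda>f. \<chi> j. f j)"
    unfolding exp_law_def eq2 ..
  also have "\<dots> = distr M borel ((\<lambda>f. \<chi> j. f j) \<circ> (\<lambda>\<omega>. \<lambda>j\<in>UNIV. X i \<omega> $ j))"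
    by (rule distr_distr[OF _ m2]) (intro borel_measurable_vec_lambda measurable_component_singleton, simp)
  also have "\<dots> = distr M borel (X i)"
    by (intro distr_cong) (auto simp: vec_eq_iff)
  finally show ?thesis ..
qed

lemma AE_positive: "AE \<omega> in M. \<forall>i\<ge>1. 0 \<prec>\<^sub>P X i \<omega>"
proof -
  have "AE \<omega> in M. 0 < X i \<omega> $ j" if "i \<ge> 1" for i j
  proof -
    have "\<P>(\<omega> in M. 0 < X i \<omega> $ j) = exp (- 0 * 1)"
      using exp_coords[OF that] by (rule exponential_distributedD_gt) auto
    then have "\<P>(\<omega> in M. 0 < X i \<omega> $ j) = 1" by simp
    from AE_prob_1[OF this] show ?thesis by eventually_elim simp
  qed
  then have "AE \<omega> in M. \<forall>j. 0 < X i \<omega> $ j" if "i \<ge> 1" for i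
    using that by (simp add: AE_all_countable)
  then have "AE \<omega> in M. i \<ge> 1 \<longrightarrow> (\<forall>j. 0 < X i \<omega> $ j)" for i
    by (cases "i \<ge> 1") simp_all
  then show ?thesis
    by (simp add: sprec_def AE_all_countable)
qed

text \<open>The orthant matters: the tail e^(-t) of an exponential variable is valid only for t >=
  0. The product of the coordinate tails depends on x only through its coordinate sum.\<close>

lemma prob_sprec:
  assumes "i \<ge> 1" "x \<in> orthant"
  shows "prob {\<omega>\<in>space M. x \<prec>\<^sub>P X i \<omega>} = exp (- coord_sum x)"
proof -
  have "prob (\<Inter>j\<in>UNIV. (\<lambda>\<omega>. X i \<omega> $ j) -` {x $ j<..} \<inter> space M) =
      (\<Prod>j\<in>UNIV. prob ((\<lambda>\<omega>. X i \<omega> $ j) -` {x $ j<..} \<inter> space M))"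
    by (rule indep_varsD_finite[OF indep_X_coords[OF assms(1)]]) auto
  also have "(\<Inter>j\<in>UNIV. (\<lambda>\<omega>. X i \<omega> $ j) -` {x $ j<..} \<inter> space M) = {\<omega>\<in>space M. x \<prec>\<^sub>P X i \<omega>}"
    by (auto simp: sprec_def)
  also have "(\<Prod>j\<in>UNIV. prob ((\<lambda>\<omega>. X i \<omega> $ j) -` {x $ j<..} \<inter> space M)) = (\<Prod>j\<in>UNIV. exp (- (x $ j)))"
  proof (rule prod.cong)
    fix j
    have "\<P>(\<omega> in M. x $ j < X i \<omega> $ j) = exp (- (x $ j) * 1)"
      using exp_coords[OF assms(1)] by (rule exponential_distributedD_gt) (use assms(2) in \<open>auto simp: orthant_def\<close>)
    moreover have "(\<lambda>\<omega>. X i \<omega> $ j) -` {x $ j<..} \<inter> space M = {\<omega>\<in>space M. x $ j < X i \<omega> $ j}" by auto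
    ultimately show "prob ((\<lambda>\<omega>. X i \<omega> $ j) -` {x $ j<..} \<inter> space M) = exp (- (x $ j))" by simp
  qed simp
  also have "\<dots> = exp (- coord_sum x)"
    by (simp add: exp_sum[symmetric] coord_sum_def sum_negf)
  finally show ?thesis .
qed

lemma measure_exp_law:
  assumes "i \<ge> 1" "D \<in> sets borel"
  shows "measure exp_law D = prob {\<omega>\<in>space M. X i \<omega> \<in> D}"
  using assms X_measurable[OF assms(1)] unfolding distr_X[OF assms(1), symmetric]
  by (subst measure_distr) (auto intro!: arg_cong[where f=prob])

lemma measure_exp_law_sprec:
  fixes x :: "real^'d"
  assumes "x \<in> orthant"
  shows "measure exp_law {z. x \<prec>\<^sub>P z} = exp (- coord_sum x)"
  using measure_exp_law[of 1 "{z. x \<prec>\<^sub>P z}"] prob_sprec[of 1 x] assms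
  by (simp add: pred_def[symmetric])

lemma AE_exp_law_positive: "AE x in exp_law. 0 \<prec>\<^sub>P (x :: real^'d)"
proof -
  have "AE \<omega> in M. 0 \<prec>\<^sub>P X 1 \<omega>" using AE_positive by eventually_elim auto
  then show ?thesis
    unfolding distr_X[of 1, symmetric, OF order.refl]
    using X_measurable[of 1] by (subst AE_distr_iff) (auto simp: pred_def[symmetric])
qed

lemma prob_all_in:
  assumes "finite B" "B \<subseteq> {1..}" "\<And>i. i \<in> B \<Longrightarrow> D i \<in> sets borel"
  shows "prob {\<omega>\<in>space M. \<forall>i\<in>B. X i \<omega> \<in> D i} = (\<Prod>i\<in>B. measure exp_law (D i))"
proof (cases "B = {}")
  case False
  have "prob (\<Inter>i\<in>B. X i -` D i \<inter> space M) = (\<Prod>i\<in>B. prob (X i -` D i \<inter> space M))"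
    by (rule indep_varsD[OF indep_X]) (use assms False in auto)
  moreover have "(\<Inter>i\<in>B. X i -` D i \<inter> space M) = {\<omega>\<in>space M. \<forall>i\<in>B. X i \<omega> \<in> D i}"
    using False by auto
  moreover have "prob (X i -` D i \<inter> space M) = measure exp_law (D i)" if "i \<in> B" for i
    using measure_exp_law[of i "D i"] assms that by (auto simp: vimage_def Int_def conj_commute)
  ultimately show ?thesis by simp
qed (simp add: prob_space)

text \<open>The shape index of \<open>erlang_density\<close> is one less than the number of
  exponential summands.\<close>

lemma distributed_coord_sum:
  assumes "i \<ge> 1"
  shows "distributed M lborel (\<lambda>\<omega>. coord_sum (X i \<omega>)) (erlang_density (CARD('d) - 1) 1)"
  unfolding coord_sum_def
  by (rule exponential_distributed_sum) (use assms exp_coords indep_X_coords in auto)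

text \<open>Integrands depending only on the coordinate sum reduce to a one-dimensional Erlang
  integral; both mean estimates are computed this way.\<close>

lemma nn_integral_exp_law_coord_sum:
  assumes [measurable]: "g \<in> borel_measurable borel"
  shows "(\<integral>\<^sup>+x. g (coord_sum (x :: real^'d)) \<partial>exp_law) =
    (\<integral>\<^sup>+s. ennreal (erlang_density (CARD('d) - 1) 1 s) * g s \<partial>lborel)"
proof -
  have [measurable]: "X (Suc 0) \<in> borel_measurable M" by (rule X_measurable) simp
  have "(\<integral>\<^sup>+x. g (coord_sum (x :: real^'d)) \<partial>exp_law) = (\<integral>\<^sup>+\<omega>. g (coord_sum (X 1 \<omega>)) \<partial>M)"
    unfolding distr_X[of 1, symmetric, OF order.refl]
    by (subst nn_integral_distr) auto
  also have "\<dots> = (\<integral>\<^sup>+s. ennreal (erlang_density (CARD('d) - 1) 1 s) * g s \<partial>lborel)"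
    by (rule distributed_nn_integral[symmetric, OF distributed_coord_sum]) auto
  finally show ?thesis .
qed

end

section \<open>Probabilities of records\<close>

text \<open>Defined through the law instead of as exp(-\<open>coord_sum x\<close>), so that it is
  meaningful for all x; the two agree on the orthant, which carries the whole law.\<close>

definition dom_prob :: "real^'d \<Rightarrow> real" where
  "dom_prob x = measure exp_law {z. x \<prec>\<^sub>P z}"

definition dom_prob2 :: "real^'d \<Rightarrow> real^'d \<Rightarrow> real" where
  "dom_prob2 x y = measure exp_law {z. x \<prec>\<^sub>P z \<and> y \<prec>\<^sub>P z}"

lemma sets_sprec [measurable]:
  "{z. x \<prec>\<^sub>P z} \<in> sets (borel :: (real^'d) measure)"
  "{z. x \<prec>\<^sub>P z \<and> y \<prec>\<^sub>P z} \<in> sets (borel :: (real^'d) measure)"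
  "{z. \<not> x \<prec>\<^sub>P z} \<in> sets (borel :: (real^'d) measure)"
  "{z. \<not> x \<prec>\<^sub>P z \<and> \<not> y \<prec>\<^sub>P z} \<in> sets (borel :: (real^'d) measure)"
proof -
  have [measurable]: "Measurable.pred (borel :: (real^'d) measure) (\<lambda>z. x \<prec>\<^sub>P z)" for x :: "real^'d"
    by (intro pred_sprec measurable_const measurable_ident_sets refl; simp)
  have "{z \<in> space borel. x \<prec>\<^sub>P z} \<in> sets (borel :: (real^'d) measure)"
    "{z \<in> space borel. x \<prec>\<^sub>P z \<and> y \<prec>\<^sub>P z} \<in> sets (borel :: (real^'d) measure)"
    "{z \<in> space borel. \<not> x \<prec>\<^sub>P z} \<in> sets (borel :: (real^'d) measure)"
    "{z \<in> space borel. \<not> x \<prec>\<^sub>P z \<and> \<not> y \<prec>\<^sub>P z} \<in> sets (borel :: (real^'d) measure)"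
    by measurable
  then show "{z. x \<prec>\<^sub>P z} \<in> sets (borel :: (real^'d) measure)"
    "{z. x \<prec>\<^sub>P z \<and> y \<prec>\<^sub>P z} \<in> sets (borel :: (real^'d) measure)"
    "{z. \<not> x \<prec>\<^sub>P z} \<in> sets (borel :: (real^'d) measure)"
    "{z. \<not> x \<prec>\<^sub>P z \<and> \<not> y \<prec>\<^sub>P z} \<in> sets (borel :: (real^'d) measure)"
    by simp_all
qed

lemma dom_prob_bounds [simp]: "0 \<le> dom_prob x" "dom_prob x \<le> 1"
  using prob_space.prob_le_1[OF prob_space_exp_law]
  by (auto simp: dom_prob_def)

lemma dom_prob2_bounds [simp]:
  "0 \<le> dom_prob2 x y" "dom_prob2 x y \<le> dom_prob x" "dom_prob2 x y \<le> dom_prob y"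
proof -
  interpret E: prob_space "exp_law :: (real^'d) measure" by (rule prob_space_exp_law)
  show "0 \<le> dom_prob2 x y" "dom_prob2 x y \<le> dom_prob x" "dom_prob2 x y \<le> dom_prob y"
    unfolding dom_prob2_def dom_prob_def
    by (auto intro!: E.finite_measure_mono)
qed

lemma measure_not_dom:
  "measure exp_law {z. \<not> x \<prec>\<^sub>P z} = 1 - dom_prob x"
  "measure exp_law {z. \<not> x \<prec>\<^sub>P z \<and> \<not> y \<prec>\<^sub>P z} = 1 - dom_prob x - dom_prob y + dom_prob2 x y"
proof -
  interpret E: prob_space "exp_law :: (real^'d) measure" by (rule prob_space_exp_law)
  have "measure exp_law (space exp_law - {z. x \<prec>\<^sub>P z}) = 1 - dom_prob x"
    unfolding dom_prob_def by (rule E.prob_compl) simp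
  also have "space exp_law - {z. x \<prec>\<^sub>P z} = {z. \<not> x \<prec>\<^sub>P z}" by auto
  finally show "measure exp_law {z. \<not> x \<prec>\<^sub>P z} = 1 - dom_prob x" .
  have "measure exp_law (space exp_law - ({z. x \<prec>\<^sub>P z} \<union> {z. y \<prec>\<^sub>P z})) =
      1 - measure exp_law ({z. x \<prec>\<^sub>P z} \<union> {z. y \<prec>\<^sub>P z})"
    by (rule E.prob_compl) simp
  also have "measure exp_law ({z. x \<prec>\<^sub>P z} \<union> {z. y \<prec>\<^sub>P z}) =
      dom_prob x + dom_prob y - measure exp_law ({z. x \<prec>\<^sub>P z} \<inter> {z. y \<prec>\<^sub>P z})"
    unfolding dom_prob_def by (subst measure_Un3) (auto simp: fmeasurable_def less_top[symmetric])
  also have "{z. x \<prec>\<^sub>P z} \<inter> {z. y \<prec>\<^sub>P z} = {z. x \<prec>\<^sub>P z \<and> y \<prec>\<^sub>P z}" by auto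
  also have "space exp_law - ({z. x \<prec>\<^sub>P z} \<union> {z. y \<prec>\<^sub>P z}) = {z. \<not> x \<prec>\<^sub>P z \<and> \<not> y \<prec>\<^sub>P z}" by auto
  finally show "measure exp_law {z. \<not> x \<prec>\<^sub>P z \<and> \<not> y \<prec>\<^sub>P z} = 1 - dom_prob x - dom_prob y + dom_prob2 x y"
    by (simp add: dom_prob2_def)
qed

text \<open>The value is the measure of a section of a measurable set in the product space, so
  Fubini gives measurability in x.\<close>

lemma measurable_dom_prob [measurable]: "dom_prob \<in> borel_measurable (borel :: (real^'d) measure)"
proof -
  interpret E: prob_space "exp_law :: (real^'d) measure" by (rule prob_space_exp_law)
  have "{p \<in> space (borel \<Otimes>\<^sub>M exp_law). fst p \<prec>\<^sub>P snd p} \<in> sets ((borel :: (real^'d) measure) \<Otimes>\<^sub>M exp_law)"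
    by measurable
  then have "(\<lambda>x. measure exp_law (Pair x -` {p \<in> space (borel \<Otimes>\<^sub>M exp_law). fst p \<prec>\<^sub>P snd p})) \<in> borel_measurable (borel :: (real^'d) measure)"
    unfolding measure_def by (intro borel_measurable_enn2real E.measurable_emeasure_Pair)
  then show ?thesis
    by (simp add: dom_prob_def[abs_def] space_pair_measure vimage_def)
qed

lemma measurable_dom_prob2 [measurable (raw)]:
  assumes [measurable]: "f \<in> borel_measurable M" "g \<in> borel_measurable M"
  shows "(\<lambda>x. dom_prob2 (f x :: real^'d) (g x)) \<in> borel_measurable M"
proof -
  interpret E: prob_space "exp_law :: (real^'d) measure" by (rule prob_space_exp_law)
  have "{p \<in> space (M \<Otimes>\<^sub>M exp_law). f (fst p) \<prec>\<^sub>P snd p \<and> g (fst p) \<prec>\<^sub>P snd p} \<in> sets (M \<Otimes>\<^sub>M exp_law)"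
    by measurable
  then have "(\<lambda>x. measure exp_law (Pair x -` {p \<in> space (M \<Otimes>\<^sub>M exp_law). f (fst p) \<prec>\<^sub>P snd p \<and> g (fst p) \<prec>\<^sub>P snd p})) \<in> borel_measurable M"
    unfolding measure_def by (intro borel_measurable_enn2real E.measurable_emeasure_Pair)
  moreover have "measure exp_law (Pair x -` {p \<in> space (M \<Otimes>\<^sub>M exp_law). f (fst p) \<prec>\<^sub>P snd p \<and> g (fst p) \<prec>\<^sub>P snd p}) = dom_prob2 (f x) (g x)"
    if "x \<in> space M" for x
    using that by (auto simp: dom_prob2_def space_pair_measure vimage_def)
  ultimately show ?thesis
    by (rule measurable_cong[THEN iffD1, rotated]) auto
qed

context exp_vectors
begin

abbreviation pair_law :: "((real^'d) \<times> (real^'d)) measure" where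
  "pair_law \<equiv> exp_law \<Otimes>\<^sub>M exp_law"

lemma pair_prob_space_exp_law: "pair_prob_space (exp_law :: (real^'d) measure) (exp_law :: (real^'d) measure)"
  by (intro pair_prob_space.intro pair_sigma_finite.intro prob_space_imp_sigma_finite prob_space_exp_law)

text \<open>Freeze the k-th observation at x: the k-1 earlier ones must independently avoid
  dominating x.\<close>

lemma prob_record:
  assumes k: "k \<ge> 1"
  shows "prob {\<omega>\<in>space M. is_record X k \<omega>} = (\<integral>x. (1 - dom_prob (x :: real^'d)) ^ (k - 1) \<partial>exp_law)"
proof -
  interpret E: prob_space "exp_law :: (real^'d) measure" by (rule prob_space_exp_law)
  let ?S = "PiM {k} (\<lambda>_. borel) :: (nat \<Rightarrow> real^'d) measure" and ?T = "PiM {1..<k} (\<lambda>_. borel) :: (nat \<Rightarrow> real^'d) measure"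
  let ?U = "\<lambda>\<omega>. restrict (\<lambda>i. X i \<omega>) {k}" and ?V = "\<lambda>\<omega>. restrict (\<lambda>i. X i \<omega>) {1..<k}"
  define Q where "Q p \<longleftrightarrow> (\<forall>i\<in>{1..<k}. \<not> (fst p k \<prec>\<^sub>P snd p i))" for p :: "(nat \<Rightarrow> real^'d) \<times> (nat \<Rightarrow> real^'d)"
  have ind: "indep_var ?S ?U ?T ?V"
    by (rule indep_var_restrict[OF indep_X]) (use k in auto)
  have "Measurable.pred (?S \<Otimes>\<^sub>M ?T) (\<lambda>p. \<not> (fst p k \<prec>\<^sub>P snd p i))" if "i \<in> {1..<k}" for i
  proof -
    have [measurable]: "(\<lambda>p. fst p k) \<in> borel_measurable (?S \<Otimes>\<^sub>M ?T)" "(\<lambda>p. snd p i) \<in> borel_measurable (?S \<Otimes>\<^sub>M ?T)"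
      using that by (auto intro!: measurable_compose[OF measurable_fst measurable_component_singleton]
         measurable_compose[OF measurable_snd measurable_component_singleton])
    show ?thesis by measurable
  qed
  then have Q: "Measurable.pred (?S \<Otimes>\<^sub>M ?T) Q"
    unfolding Q_def by (intro pred_intros_finite) auto
  have [measurable]: "X k \<in> borel_measurable M" using k by (rule X_measurable)
  have "emeasure M {\<omega>\<in>space M. is_record X k \<omega>} = emeasure M {\<omega>\<in>space M. Q (?U \<omega>, ?V \<omega>)}"
    using k by (intro arg_cong[where f="emeasure M"]) (auto simp: Q_def is_record_def)
  also have "\<dots> = (\<integral>\<^sup>+\<omega>'. emeasure M {\<omega>\<in>space M. Q (?U \<omega>', ?V \<omega>)} \<partial>M)"
    by (rule indep_var_freeze[OF ind Q])
  also have "\<dots> = (\<integral>\<^sup>+\<omega>'. ennreal ((1 - dom_prob (X k \<omega>')) ^ (k - 1)) \<partial>M)"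
  proof (rule nn_integral_cong)
    fix \<omega>' assume "\<omega>' \<in> space M"
    have "{\<omega>\<in>space M. Q (?U \<omega>', ?V \<omega>)} = {\<omega>\<in>space M. \<forall>i\<in>{1..<k}. X i \<omega> \<in> {z. \<not> X k \<omega>' \<prec>\<^sub>P z}}"
      by (auto simp: Q_def)
    then have "prob {\<omega>\<in>space M. Q (?U \<omega>', ?V \<omega>)} = (\<Prod>i\<in>{1..<k}. measure exp_law {z. \<not> X k \<omega>' \<prec>\<^sub>P z})"
      by (simp only:) (rule prob_all_in, auto)
    then show "emeasure M {\<omega>\<in>space M. Q (?U \<omega>', ?V \<omega>)} = ennreal ((1 - dom_prob (X k \<omega>')) ^ (k - 1))"
      by (simp add: emeasure_eq_measure measure_not_dom)
  qed
  also have "\<dots> = (\<integral>\<^sup>+x. ennreal ((1 - dom_prob (x :: real^'d)) ^ (k - 1)) \<partial>exp_law)"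
    unfolding distr_X[OF k, symmetric] by (subst nn_integral_distr) auto
  also have "\<dots> = ennreal (\<integral>x. (1 - dom_prob (x :: real^'d)) ^ (k - 1) \<partial>exp_law)"
    by (intro nn_integral_eq_integral E.integrable_const_bound[where B=1])
      (auto simp: power_le_one intro!: AE_I2)
  finally show ?thesis
    by (simp add: emeasure_eq_measure integral_nonneg_AE)
qed

text \<open>By inclusion and exclusion, the chance that a fresh observation dominates neither point;
  the polynomial form is what the algebra of the covariance bound uses.\<close>

definition pair_avoid :: "(real^'d) \<times> (real^'d) \<Rightarrow> real" where
  "pair_avoid p = 1 - dom_prob (fst p) - dom_prob (snd p) + dom_prob2 (fst p) (snd p)"

lemma pair_avoid_bounds [simp]: "0 \<le> pair_avoid p" "pair_avoid p \<le> 1"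
proof -
  have "pair_avoid p = measure exp_law {z. \<not> fst p \<prec>\<^sub>P z \<and> \<not> snd p \<prec>\<^sub>P z}"
    unfolding pair_avoid_def measure_not_dom ..
  then show "0 \<le> pair_avoid p" "pair_avoid p \<le> 1"
    using prob_space.prob_le_1[OF prob_space_exp_law] by auto
qed

lemma measurable_pair_avoid [measurable]: "pair_avoid \<in> borel_measurable pair_law"
  unfolding pair_avoid_def[abs_def] by measurable

text \<open>Freeze both observations at x and y. The j-1 observations before j must avoid both
  points, the k-1-j strictly between need only avoid y, and observation j itself must not dominate
  y, which is the zero case.\<close>

lemma prob_two_records:
  assumes jk: "1 \<le> j" "j < k"
  shows "prob {\<omega>\<in>space M. is_record X j \<omega> \<and> is_record X k \<omega>} =
    (\<integral>p. (if snd p \<prec>\<^sub>P fst p then 0 else pair_avoid p ^ (j - 1) * (1 - dom_prob (snd p)) ^ (k - 1 - j)) \<partial>pair_law)"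
proof -
  interpret E: pair_prob_space "exp_law :: (real^'d) measure" "exp_law :: (real^'d) measure"
    by (rule pair_prob_space_exp_law)
  define B where "B = {1..<k} - {j}"
  let ?S = "PiM {j, k} (\<lambda>_. borel) :: (nat \<Rightarrow> real^'d) measure" and ?T = "PiM B (\<lambda>_. borel) :: (nat \<Rightarrow> real^'d) measure"
  let ?U = "\<lambda>\<omega>. restrict (\<lambda>i. X i \<omega>) {j, k}" and ?V = "\<lambda>\<omega>. restrict (\<lambda>i. X i \<omega>) B"
  define Q where "Q p \<longleftrightarrow> \<not> (fst p k \<prec>\<^sub>P fst p j) \<and>
    (\<forall>i\<in>B. \<not> (fst p k \<prec>\<^sub>P snd p i) \<and> (i < j \<longrightarrow> \<not> (fst p j \<prec>\<^sub>P snd p i)))"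
    for p :: "(nat \<Rightarrow> real^'d) \<times> (nat \<Rightarrow> real^'d)"
  define f where "f p = (if snd p \<prec>\<^sub>P fst p then 0 else pair_avoid p ^ (j - 1) * (1 - dom_prob (snd p)) ^ (k - 1 - j))" for p
  have ind: "indep_var ?S ?U ?T ?V"
    by (rule indep_var_restrict[OF indep_X]) (use jk in \<open>auto simp: B_def\<close>)
  have [measurable]: "(\<lambda>p. fst p k) \<in> borel_measurable (?S \<Otimes>\<^sub>M ?T)" "(\<lambda>p. fst p j) \<in> borel_measurable (?S \<Otimes>\<^sub>M ?T)"
    by (auto intro!: measurable_compose[OF measurable_fst measurable_component_singleton])
  have "Measurable.pred (?S \<Otimes>\<^sub>M ?T) (\<lambda>p. \<not> (fst p k \<prec>\<^sub>P snd p i) \<and> (i < j \<longrightarrow> \<not> (fst p j \<prec>\<^sub>P snd p i)))" if "i \<in> B" for i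
  proof -
    have [measurable]: "(\<lambda>p. snd p i) \<in> borel_measurable (?S \<Otimes>\<^sub>M ?T)"
      using that by (auto intro!: measurable_compose[OF measurable_snd measurable_component_singleton])
    show ?thesis by measurable
  qed
  then have "Measurable.pred (?S \<Otimes>\<^sub>M ?T) (\<lambda>p. \<forall>i\<in>B. \<not> (fst p k \<prec>\<^sub>P snd p i) \<and> (i < j \<longrightarrow> \<not> (fst p j \<prec>\<^sub>P snd p i)))"
    by (intro pred_intros_finite) (auto simp: B_def)
  then have Q: "Measurable.pred (?S \<Otimes>\<^sub>M ?T) Q"
    unfolding Q_def by measurable
  have [measurable]: "X j \<in> borel_measurable M" "X k \<in> borel_measurable M" using jk by (auto intro: X_measurable)
  have fm [measurable]: "f \<in> borel_measurable pair_law"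
    unfolding f_def by measurable
  have rec: "is_record X j \<omega> \<and> is_record X k \<omega> \<longleftrightarrow> Q (?U \<omega>, ?V \<omega>)" for \<omega>
    using jk unfolding Q_def is_record_def B_def by auto
  have "emeasure M {\<omega>\<in>space M. is_record X j \<omega> \<and> is_record X k \<omega>} = emeasure M {\<omega>\<in>space M. Q (?U \<omega>, ?V \<omega>)}"
    unfolding rec ..
  also have "\<dots> = (\<integral>\<^sup>+\<omega>'. emeasure M {\<omega>\<in>space M. Q (?U \<omega>', ?V \<omega>)} \<partial>M)"
    by (rule indep_var_freeze[OF ind Q])
  also have "\<dots> = (\<integral>\<^sup>+\<omega>'. ennreal (f (X j \<omega>', X k \<omega>')) \<partial>M)"
  proof (rule nn_integral_cong)
    fix \<omega>' assume "\<omega>' \<in> space M"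
    let ?x = "X j \<omega>'" and ?y = "X k \<omega>'"
    show "emeasure M {\<omega>\<in>space M. Q (?U \<omega>', ?V \<omega>)} = ennreal (f (?x, ?y))"
    proof (cases "?y \<prec>\<^sub>P ?x")
      case True
      then have "{\<omega>\<in>space M. Q (?U \<omega>', ?V \<omega>)} = {}" by (auto simp: Q_def)
      then show ?thesis using True by (simp only: emeasure_empty) (simp add: f_def)
    next
      case False
      define D where "D i = (if i < j then {z. \<not> ?x \<prec>\<^sub>P z \<and> \<not> ?y \<prec>\<^sub>P z} else {z. \<not> ?y \<prec>\<^sub>P z})" for i
      have "{\<omega>\<in>space M. Q (?U \<omega>', ?V \<omega>)} = {\<omega>\<in>space M. \<forall>i\<in>B. X i \<omega> \<in> D i}"
        using False by (auto simp: Q_def D_def)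
      moreover have "prob {\<omega>\<in>space M. \<forall>i\<in>B. X i \<omega> \<in> D i} = (\<Prod>i\<in>B. measure exp_law (D i))"
        by (rule prob_all_in) (auto simp: B_def D_def)
      moreover have "B = {1..<j} \<union> {j<..<k}" using jk by (auto simp: B_def)
      then have "(\<Prod>i\<in>B. measure exp_law (D i)) =
          (\<Prod>i\<in>{1..<j}. measure exp_law (D i)) * (\<Prod>i\<in>{j<..<k}. measure exp_law (D i))"
        by (simp only:) (rule prod.union_disjoint, auto)
      moreover have "(\<Prod>i\<in>{1..<j}. measure exp_law (D i)) = pair_avoid (?x, ?y) ^ (j - 1)"
        by (simp add: D_def measure_not_dom pair_avoid_def)
      moreover have "(\<Prod>i\<in>{j<..<k}. measure exp_law (D i)) = (1 - dom_prob ?y) ^ (k - 1 - j)"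
        by (simp add: D_def measure_not_dom)
      ultimately show ?thesis using False
        by (simp add: emeasure_eq_measure f_def)
    qed
  qed
  also have "\<dots> = (\<integral>\<^sup>+p. ennreal (f p) \<partial>distr M (borel \<Otimes>\<^sub>M borel) (\<lambda>\<omega>. (X j \<omega>, X k \<omega>)))"
    by (subst nn_integral_distr) (auto simp: cong: measurable_cong_sets)
  also have "distr M (borel \<Otimes>\<^sub>M borel) (\<lambda>\<omega>. (X j \<omega>, X k \<omega>)) = pair_law"
  proof -
    have "indep_var borel (X j) borel (X k)"
    proof -
      have ind: "indep_var (PiM {j} (\<lambda>_. borel)) (\<lambda>\<omega>. restrict (\<lambda>i. X i \<omega>) {j})
          (PiM {k} (\<lambda>_. borel)) (\<lambda>\<omega>. restrict (\<lambda>i. X i \<omega>) {k})"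
        by (rule indep_var_restrict[OF indep_X]) (use jk in auto)
      have "indep_var borel ((\<lambda>f. f j) \<circ> (\<lambda>\<omega>. restrict (\<lambda>i. X i \<omega>) {j}))
          borel ((\<lambda>f. f k) \<circ> (\<lambda>\<omega>. restrict (\<lambda>i. X i \<omega>) {k}))"
        by (rule indep_var_compose[OF ind]) (auto intro!: measurable_component_singleton)
      then show ?thesis by (simp add: comp_def)
    qed
    then show ?thesis
      using jk by (simp add: indep_var_distribution_eq distr_X)
  qed
  also have "(\<integral>\<^sup>+p. ennreal (f p) \<partial>pair_law) = ennreal (\<integral>p. f p \<partial>pair_law)"
    by (intro nn_integral_eq_integral E.integrable_const_bound[where B=1])
      (auto simp: f_def power_le_one intro!: AE_I2 mult_le_one)
  finally show ?thesis
    unfolding f_def[symmetric]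
    by (simp add: emeasure_eq_measure integral_nonneg_AE f_def)
qed

end

section \<open>Covariance of record indicators\<close>

text \<open>A discrete mean value estimate, by A^(p+1) - B^(p+1) = A (A^p - B^p) + (A - B) B^p. The
  sign of A - B is left open; for A <= B the left side is at most 0.\<close>

lemma power_diff_bound:
  fixes A B r c :: real
  assumes "0 \<le> B" "A \<le> r" "B \<le> r" "A - B \<le> c" "0 \<le> c" "0 \<le> A"
  shows "A ^ p - B ^ p \<le> real p * r ^ (p - 1) * c"
proof (cases "A \<le> B")
  case True
  then have "A ^ p \<le> B ^ p" using assms by (intro power_mono) auto
  moreover have "0 \<le> real p * r ^ (p - 1) * c" using assms by simp
  ultimately show ?thesis by linarith
next
  case False
  show ?thesis
  proof (induction p)
    case (Suc p)
    have "A ^ Suc p - B ^ Suc p = A * (A ^ p - B ^ p) + (A - B) * B ^ p"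
      by (simp add: algebra_simps)
    also have "\<dots> \<le> r * (real p * r ^ (p - 1) * c) + c * r ^ p"
    proof (rule add_mono)
      have "A ^ p - B ^ p \<ge> 0" using False assms by (simp add: power_mono)
      then show "A * (A ^ p - B ^ p) \<le> r * (real p * r ^ (p - 1) * c)"
        using Suc assms by (intro mult_mono) auto
      show "(A - B) * B ^ p \<le> c * r ^ p"
        using assms False by (intro mult_mono power_mono) auto
    qed
    also have "r * (real p * r ^ (p - 1) * c) = real p * r ^ p * c"
      by (cases p) simp_all
    finally show ?case by (simp add: algebra_simps)
  qed simp
qed

lemma sum_power_le_inverse:
  fixes r :: real
  assumes "0 \<le> r" "r < 1"
  shows "(\<Sum>i<n. r ^ i) \<le> 1 / (1 - r)"
proof -
  have "(\<Sum>i<n. r ^ i) = (1 - r ^ n) / (1 - r)"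
    using assms by (simp add: sum_gp_strict)
  then show ?thesis using assms by (simp add: divide_right_mono)
qed

text \<open>This is the differentiated geometric series: multiplying by 1 - r leaves a plain
  geometric sum minus a nonnegative boundary term.\<close>

lemma sum_power_weighted_le_inverse:
  fixes r :: real
  assumes "0 \<le> r" "r < 1"
  shows "(\<Sum>p<n. real p * r ^ (p - 1)) \<le> 1 / (1 - r)\<^sup>2"
proof -
  have "(1 - r) * (\<Sum>p<n. real p * r ^ (p - 1)) \<le> (\<Sum>i<n. r ^ i)"
  proof -
    have *: "(1 - r) * (\<Sum>p<Suc m. real p * r ^ (p - 1)) + real (Suc m) * r ^ m = (\<Sum>i<Suc m. r ^ i)" for m
    proof (induction m)
      case (Suc m)
      let ?S = "\<Sum>p<Suc m. real p * r ^ (p - 1)"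
      have "(1 - r) * (?S + real (Suc m) * r ^ m) + real (Suc (Suc m)) * (r * r ^ m) =
          ((1 - r) * ?S + real (Suc m) * r ^ m) + r * r ^ m"
        unfolding of_nat_Suc by algebra
      then show ?case unfolding Suc.IH by simp
    qed simp
    show ?thesis
    proof (cases n)
      case (Suc m)
      have "0 \<le> real (Suc m) * r ^ m" using assms by simp
      then show ?thesis using *[of m] unfolding Suc by linarith
    qed simp
  qed
  also have "\<dots> \<le> 1 / (1 - r)" by (rule sum_power_le_inverse) fact+
  finally have "(1 - r) * (\<Sum>p<n. real p * r ^ (p - 1)) \<le> 1 / (1 - r)" .
  then have "(\<Sum>p<n. real p * r ^ (p - 1)) \<le> 1 / (1 - r) / (1 - r)"
    using assms by (simp add: pos_le_divide_eq mult.commute)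
  then show ?thesis by (simp add: power2_eq_square)
qed

text \<open>The map (k, j) to (j - 1, k - 1 - j) sends the triangle injectively into a square;
  nonnegative terms allow enlarging to the square, where the sum factorises.\<close>

lemma triangle_sum_le:
  fixes g f :: "nat \<Rightarrow> real"
  assumes "\<And>i. 0 \<le> g i" "\<And>i. 0 \<le> f i"
  shows "(\<Sum>k=1..n. \<Sum>j\<in>{1..<k}. g (j - 1) * f (k - 1 - j)) \<le> (\<Sum>p<n. g p) * (\<Sum>i<n. f i)"
proof -
  have "(\<Sum>k=1..n. \<Sum>j\<in>{1..<k}. g (j - 1) * f (k - 1 - j)) =
      (\<Sum>(k, j)\<in>Sigma {1..n} (\<lambda>k. {1..<k}). g (j - 1) * f (k - 1 - j))"
    by (rule sum.Sigma) auto
  also have "\<dots> = (\<Sum>q\<in>(\<lambda>(k, j). (j - 1, k - 1 - j)) ` Sigma {1..n} (\<lambda>k. {1..<k}). g (fst q) * f (snd q))"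
    by (subst sum.reindex) (auto simp: inj_on_def split: prod.splits intro!: sum.cong)
  also have "\<dots> \<le> (\<Sum>q\<in>{..<n} \<times> {..<n}. g (fst q) * f (snd q))"
    by (rule sum_mono2) (auto simp: assms)
  also have "\<dots> = (\<Sum>p<n. g p) * (\<Sum>i<n. f i)"
    by (simp add: sum_product sum.cartesian_product case_prod_beta)
  finally show ?thesis .
qed

text \<open>Here a and b stand for the two domination probabilities and c for the joint one. The
  bases of the compared powers differ by c - ab <= c. The first bound counts terms and suits n
  max(a,b) < 1; the second sums geometric series and suits n max(a,b) >= 1.\<close>

lemma covariance_kernel_bound:
  fixes a b c :: real and n :: nat
  assumes "0 < a" "a \<le> 1" "0 < b" "b \<le> 1" "0 \<le> c" "c \<le> a" "c \<le> b" "0 \<le> 1 - a - b + c"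
  defines "h \<equiv> (\<Sum>k=1..n. \<Sum>j\<in>{1..<k}. ((1 - a - b + c) ^ (j - 1) - ((1 - a) * (1 - b)) ^ (j - 1)) * (1 - b) ^ (k - 1 - j))"
  shows "h \<le> real n ^ 3 * c" "h \<le> c / (b * (max a b)\<^sup>2)"
proof -
  \<comment> \<open>Both bases are at most 1 - max(a,b): the joint one because c <= min(a,b), the
    product because each factor is at most 1.\<close>
  define r where "r = 1 - max a b"
  have r: "0 \<le> r" "r < 1" using assms by (auto simp: r_def)
  have "h \<le> (\<Sum>k=1..n. \<Sum>j\<in>{1..<k}. (real (j - 1) * r ^ (j - 1 - 1) * c) * (1 - b) ^ (k - 1 - j))"
    unfolding h_def
  proof (intro sum_mono mult_right_mono power_diff_bound)
    have "(1 - a) * (1 - b) \<le> 1 - a" "(1 - a) * (1 - b) \<le> 1 - b"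
      using assms by (auto intro: mult_left_le mult_left_le_one_le)
    then show "(1 - a) * (1 - b) \<le> r" by (simp add: r_def)
    have "a * b \<ge> 0" using assms by simp
    then show "1 - a - b + c - (1 - a) * (1 - b) \<le> c" by (simp add: algebra_simps)
  qed (use assms in \<open>auto simp: r_def\<close>)
  also have "\<dots> \<le> (\<Sum>p<n. real p * r ^ (p - 1) * c) * (\<Sum>i<n. (1 - b) ^ i)"
    by (rule triangle_sum_le) (use assms r in auto)
  also have "\<dots> = (\<Sum>p<n. real p * r ^ (p - 1)) * c * (\<Sum>i<n. (1 - b) ^ i)"
    by (simp add: sum_distrib_right)
  finally have h: "h \<le> (\<Sum>p<n. real p * r ^ (p - 1)) * c * (\<Sum>i<n. (1 - b) ^ i)" .
  have S0: "0 \<le> (\<Sum>p<n. real p * r ^ (p - 1))" "0 \<le> (\<Sum>i<n. (1 - b) ^ i)"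
    using r assms by (auto intro!: sum_nonneg)
  have "(\<Sum>p<n. real p * r ^ (p - 1)) \<le> (\<Sum>p<n. real n * 1)"
    by (intro sum_mono mult_mono power_le_one) (use r in auto)
  moreover have "(\<Sum>i<n. (1 - b) ^ i) \<le> (\<Sum>i<n. 1)"
    by (intro sum_mono power_le_one) (use assms in auto)
  ultimately have "(\<Sum>p<n. real p * r ^ (p - 1)) * c * (\<Sum>i<n. (1 - b) ^ i) \<le> (real n * real n) * c * real n"
    using S0 assms by (intro mult_mono) auto
  then show "h \<le> real n ^ 3 * c" using h by (simp add: power3_eq_cube mult_ac)
  have "(\<Sum>p<n. real p * r ^ (p - 1)) * c * (\<Sum>i<n. (1 - b) ^ i) \<le> (1 / (1 - r)\<^sup>2) * c * (1 / (1 - (1 - b)))"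
    using S0 assms r by (intro mult_mono sum_power_le_inverse sum_power_weighted_le_inverse) auto
  then show "h \<le> c / (b * (max a b)\<^sup>2)" using h by (simp add: r_def mult_ac)
qed

context exp_vectors
begin

text \<open>What \<open>pair_avoid\<close> would be if dominating x and dominating y were
  independent events; its powers come from the product of the two record probabilities.\<close>

definition indep_avoid :: "(real^'d) \<times> (real^'d) \<Rightarrow> real" where
  "indep_avoid p = (1 - dom_prob (fst p)) * (1 - dom_prob (snd p))"

lemma indep_avoid_bounds [simp]: "0 \<le> indep_avoid p" "indep_avoid p \<le> 1"
  by (auto simp: indep_avoid_def intro!: mult_le_one)

lemma measurable_indep_avoid [measurable]: "indep_avoid \<in> borel_measurable pair_law"
  unfolding indep_avoid_def[abs_def] by measurable

lemma integrable_pair_law: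
  fixes f :: "(real^'d) \<times> (real^'d) \<Rightarrow> real"
  assumes "f \<in> borel_measurable pair_law" "\<And>p. 0 \<le> f p" "\<And>p. f p \<le> 1"
  shows "integrable pair_law f"
proof -
  interpret E: pair_prob_space "exp_law :: (real^'d) measure" "exp_law :: (real^'d) measure"
    by (rule pair_prob_space_exp_law)
  show ?thesis
    using assms by (intro E.integrable_const_bound[where B=1]) (auto intro!: AE_I2)
qed

text \<open>Conditionally on the values x, y of the j-th and k-th observation, both are records with
  probability a product of powers, unless y is dominated by x. Integrating out x, the loss from
  that exception outweighs the gain from observation j being exempt from the other avoidance
  conditions of y, so only the difference of the powers remains.\<close>

lemma covariance_records_le:
  assumes jk: "1 \<le> j" "j < k"
  shows "prob {\<omega>\<in>space M. is_record X j \<omega> \<and> is_record X k \<omega>}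
      - prob {\<omega>\<in>space M. is_record X j \<omega>} * prob {\<omega>\<in>space M. is_record X k \<omega>}
    \<le> (\<integral>p. (pair_avoid p ^ (j - 1) - indep_avoid p ^ (j - 1)) * (1 - dom_prob (snd p)) ^ (k - 1 - j) \<partial>pair_law)"
proof -
  interpret E1: prob_space "exp_law :: (real^'d) measure" by (rule prob_space_exp_law)
  interpret E: pair_prob_space "exp_law :: (real^'d) measure" "exp_law :: (real^'d) measure"
    by (rule pair_prob_space_exp_law)
  define q where "q = k - 1 - j"
  \<comment> \<open>The extra 1 is observation j itself, which in the unconditional record
    probability of k also has to avoid y.\<close>
  have k1: "k - 1 = (j - 1) + q + 1" using jk by (simp add: q_def)
  let ?b = "\<lambda>p :: (real^'d) \<times> (real^'d). dom_prob (snd p)"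
  define fA where "fA p = pair_avoid p ^ (j - 1) * (1 - ?b p) ^ q" for p :: "(real^'d) \<times> (real^'d)"
  define fB where "fB p = indep_avoid p ^ (j - 1) * (1 - ?b p) ^ q" for p :: "(real^'d) \<times> (real^'d)"
  define fD where "fD p = (if snd p \<prec>\<^sub>P fst p then (1 - ?b p) ^ (j - 1 + q) else 0)" for p :: "(real^'d) \<times> (real^'d)"
  define fE where "fE p = ?b p * (1 - ?b p) ^ (j - 1 + q)" for p :: "(real^'d) \<times> (real^'d)"
  define fF where "fF p = (1 - dom_prob (fst p)) ^ (j - 1) * (1 - ?b p) ^ (k - 1)" for p :: "(real^'d) \<times> (real^'d)"
  have [measurable]: "fA \<in> borel_measurable pair_law" "fB \<in> borel_measurable pair_law"
    "fD \<in> borel_measurable pair_law" "fE \<in> borel_measurable pair_law" "fF \<in> borel_measurable pair_law"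
    unfolding fA_def[abs_def] fB_def[abs_def] fD_def[abs_def] fE_def[abs_def] fF_def[abs_def] by measurable
  have int: "integrable pair_law fA" "integrable pair_law fB"
    "integrable pair_law fD" "integrable pair_law fE" "integrable pair_law fF"
    by (rule integrable_pair_law; auto simp: fA_def fB_def fD_def fE_def fF_def power_le_one intro!: mult_le_one)+
  have "prob {\<omega>\<in>space M. is_record X j \<omega> \<and> is_record X k \<omega>} = (\<integral>p. fA p - fD p \<partial>pair_law)"
    unfolding prob_two_records[OF jk]
  proof (rule Bochner_Integration.integral_cong)
    fix p :: "(real^'d) \<times> (real^'d)"
    \<comment> \<open>If y is dominated by x, whatever dominates x also dominates y, so avoiding
      both is avoiding y. This turns the zero case into the subtracted term
      \<open>fD\<close>.\<close>
    have "dom_prob2 (fst p) (snd p) = dom_prob (fst p)" if "snd p \<prec>\<^sub>P fst p"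
      using that unfolding dom_prob2_def dom_prob_def
      by (intro arg_cong[where f="measure exp_law"]) (auto simp: sprec_def intro: less_trans)
    then have "pair_avoid p = 1 - ?b p" if "snd p \<prec>\<^sub>P fst p"
      using that by (simp add: pair_avoid_def)
    then show "(if snd p \<prec>\<^sub>P fst p then 0 else pair_avoid p ^ (j - 1) * (1 - ?b p) ^ (k - 1 - j)) = fA p - fD p"
      by (simp add: fA_def fD_def q_def power_add)
  qed simp
  also have "\<dots> = (\<integral>p. fA p \<partial>pair_law) - (\<integral>p. fD p \<partial>pair_law)"
    using int by simp
  finally have P2: "prob {\<omega>\<in>space M. is_record X j \<omega> \<and> is_record X k \<omega>} =
      (\<integral>p. fA p \<partial>pair_law) - (\<integral>p. fD p \<partial>pair_law)" .
  have "(\<integral>p. fF p \<partial>pair_law) = (\<integral>x. \<integral>y. fF (x, y) \<partial>exp_law \<partial>exp_law)"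
    using int by (subst E.integral_fst'[symmetric]) auto
  also have "\<dots> = (\<integral>x. (1 - dom_prob (x :: real^'d)) ^ (j - 1) \<partial>exp_law) * (\<integral>y. (1 - dom_prob (y :: real^'d)) ^ (k - 1) \<partial>exp_law)"
    by (simp add: fF_def)
  finally have P1: "prob {\<omega>\<in>space M. is_record X j \<omega>} * prob {\<omega>\<in>space M. is_record X k \<omega>} = (\<integral>p. fF p \<partial>pair_law)"
    using jk by (simp add: prob_record)
  \<comment> \<open>The exemption of observation j gains 1 - (1 - b) = b times the remaining powers,
    at most \<open>fE\<close>. Integrating \<open>fD\<close> over x gives the same b times (1 -
    b)^(j - 1 + q), so the loss covers the gain.\<close>
  have "(\<integral>p. fB p - fF p \<partial>pair_law) \<le> (\<integral>p. fE p \<partial>pair_law)"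
  proof (rule integral_mono)
    fix p :: "(real^'d) \<times> (real^'d)"
    have "fB p - fF p = (1 - dom_prob (fst p)) ^ (j - 1) * fE p"
      unfolding fB_def fF_def fE_def k1 indep_avoid_def power_mult_distrib power_add power_one_right
      by algebra
    also have "\<dots> \<le> 1 * fE p"
      by (intro mult_right_mono power_le_one) (auto simp: fE_def)
    finally show "fB p - fF p \<le> fE p" by simp
  qed (use int in auto)
  also have "(\<integral>p. fE p \<partial>pair_law) = (\<integral>y. \<integral>x. fE (x, y) \<partial>exp_law \<partial>exp_law)"
    using int by (subst E.integral_snd) auto
  also have "\<dots> = (\<integral>y. \<integral>x. fD (x, y) \<partial>exp_law \<partial>exp_law)"
  proof (rule Bochner_Integration.integral_cong)
    fix y :: "real^'d"
    have "(\<integral>x. fD (x, y) \<partial>exp_law) = (\<integral>x. indicator {x. y \<prec>\<^sub>P x} x * (1 - dom_prob y) ^ (j - 1 + q) \<partial>exp_law)"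
      by (intro Bochner_Integration.integral_cong) (auto simp: fD_def)
    also have "\<dots> = dom_prob y * (1 - dom_prob y) ^ (j - 1 + q)"
      by (simp add: dom_prob_def)
    finally show "(\<integral>x. fE (x, y) \<partial>exp_law) = (\<integral>x. fD (x, y) \<partial>exp_law)"
      by (simp add: fE_def E1.prob_space[simplified])
  qed simp
  also have "\<dots> = (\<integral>p. fD p \<partial>pair_law)"
    using int by (subst E.integral_snd) auto
  finally have "(\<integral>p. fB p \<partial>pair_law) - (\<integral>p. fF p \<partial>pair_law) \<le> (\<integral>p. fD p \<partial>pair_law)"
    using int by simp
  then have "prob {\<omega>\<in>space M. is_record X j \<omega> \<and> is_record X k \<omega>}
      - prob {\<omega>\<in>space M. is_record X j \<omega>} * prob {\<omega>\<in>space M. is_record X k \<omega>}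
      \<le> (\<integral>p. fA p \<partial>pair_law) - (\<integral>p. fB p \<partial>pair_law)"
    unfolding P1 P2 by linarith
  also have "\<dots> = (\<integral>p. fA p - fB p \<partial>pair_law)" using int by simp
  finally show ?thesis
    by (simp add: fA_def fB_def q_def left_diff_distrib)
qed

section \<open>The variance of the record count as a sum of covariances\<close>

lemma sum_square_symmetric:
  fixes F :: "nat \<Rightarrow> nat \<Rightarrow> real"
  assumes "\<And>j k. F j k = F k j"
  shows "(\<Sum>j=1..n. \<Sum>k=1..n. F j k) = (\<Sum>k=1..n. F k k) + 2 * (\<Sum>k=1..n. \<Sum>j\<in>{1..<k}. F j k)"
proof (induction n)
  case (Suc n)
  have "(\<Sum>j=1..Suc n. \<Sum>k=1..Suc n. F j k) =
      (\<Sum>j=1..n. \<Sum>k=1..n. F j k) + (\<Sum>j=1..n. F j (Suc n)) + (\<Sum>k=1..n. F (Suc n) k) + F (Suc n) (Suc n)"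
    by (simp add: sum.distrib)
  also have "(\<Sum>k=1..n. F (Suc n) k) = (\<Sum>j=1..n. F j (Suc n))"
    using assms by simp
  finally show ?case
    using Suc by (simp add: atLeastLessThanSuc_atLeastAtMost)
qed simp

lemma real_num_records:
  assumes "\<omega> \<in> space M"
  shows "real (num_records X n \<omega>) = (\<Sum>k=1..n. indicator {\<omega>\<in>space M. is_record X k \<omega>} \<omega>)"
  using assms unfolding num_records_eq_sum by (intro sum.cong) (auto simp: indicator_def)

lemma sets_is_record [measurable]: "{\<omega>\<in>space M. is_record X k \<omega>} \<in> sets M"
  using pred_is_record[of X M k] X_measurable by (simp add: pred_def)

lemma integrable_indicator_event: "A \<in> sets M \<Longrightarrow> integrable M (indicator A :: 'a \<Rightarrow> real)"
  by (simp add: less_top[symmetric])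

lemma expectation_num_records:
  "expectation (\<lambda>\<omega>. real (num_records X n \<omega>)) = (\<Sum>k=1..n. prob {\<omega>\<in>space M. is_record X k \<omega>})"
proof -
  have "expectation (\<lambda>\<omega>. real (num_records X n \<omega>)) =
      expectation (\<lambda>\<omega>. \<Sum>k=1..n. indicator {\<omega>\<in>space M. is_record X k \<omega>} \<omega>)"
    by (intro Bochner_Integration.integral_cong) (simp_all add: real_num_records)
  also have "\<dots> = (\<Sum>k=1..n. expectation (indicator {\<omega>\<in>space M. is_record X k \<omega>}))"
    by (intro Bochner_Integration.integral_sum integrable_indicator_event) simp
  also have "\<dots> = (\<Sum>k=1..n. prob {\<omega>\<in>space M. is_record X k \<omega>})"
    by (intro sum.cong) simp_all
  finally show ?thesis .
qed

lemma random_variable_num_records [measurable]: "(\<lambda>\<omega>. real (num_records X n \<omega>)) \<in> borel_measurable M"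
  using measurable_compose[OF measurable_num_records[of X M n], of real borel] X_measurable by simp

lemma integrable_num_records:
  "integrable M (\<lambda>\<omega>. real (num_records X n \<omega>))"
  "integrable M (\<lambda>\<omega>. (real (num_records X n \<omega>))\<^sup>2)"
proof -
  have le: "num_records X n \<omega> \<le> n" for \<omega>
    unfolding num_records_def by (rule order_trans[OF card_mono[of "{1..n}"]]) auto
  show "integrable M (\<lambda>\<omega>. real (num_records X n \<omega>))"
    by (rule integrable_const_bound[where B="real n"]) (auto simp: le)
  show "integrable M (\<lambda>\<omega>. (real (num_records X n \<omega>))\<^sup>2)"
    by (rule integrable_const_bound[where B="(real n)\<^sup>2"]) (auto simp: le power_mono)
qed

text \<open>All covariance integrands are summed at a fixed pair of points before integrating, so
  that \<open>covariance_kernel_bound\<close> applies pointwise.\<close>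

definition cov_kernel :: "nat \<Rightarrow> (real^'d) \<times> (real^'d) \<Rightarrow> real" where
  "cov_kernel n p = (\<Sum>k=1..n. \<Sum>j\<in>{1..<k}.
     (pair_avoid p ^ (j - 1) - indep_avoid p ^ (j - 1)) * (1 - dom_prob (snd p)) ^ (k - 1 - j))"

lemma measurable_cov_kernel [measurable]: "cov_kernel n \<in> borel_measurable pair_law"
  unfolding cov_kernel_def[abs_def] by measurable

text \<open>The diagonal terms p - p^2 are at most p and add up to the mean; the off-diagonal
  covariances are bounded by \<open>covariance_records_le\<close>.\<close>

lemma variance_num_records_le:
  "variance (\<lambda>\<omega>. real (num_records X n \<omega>)) \<le>
    expectation (\<lambda>\<omega>. real (num_records X n \<omega>)) + 2 * (\<integral>p. cov_kernel n p \<partial>pair_law)"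
proof -
  let ?R = "\<lambda>k. {\<omega>\<in>space M. is_record X k \<omega>}"
  define F where "F j k = prob (?R j \<inter> ?R k) - prob (?R j) * prob (?R k)" for j k
  define g where "g j k p = (pair_avoid p ^ (j - 1) - indep_avoid p ^ (j - 1)) * (1 - dom_prob (snd p)) ^ (k - 1 - j)"
    for j k p
  have "expectation (\<lambda>\<omega>. (real (num_records X n \<omega>))\<^sup>2) =
      expectation (\<lambda>\<omega>. \<Sum>j=1..n. \<Sum>k=1..n. indicator (?R j \<inter> ?R k) \<omega>)"
    by (intro Bochner_Integration.integral_cong)
      (simp_all add: real_num_records power2_eq_square sum_product indicator_inter_arith)
  also have "\<dots> = (\<Sum>j=1..n. expectation (\<lambda>\<omega>. \<Sum>k=1..n. indicator (?R j \<inter> ?R k) \<omega>))"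
    by (intro Bochner_Integration.integral_sum Bochner_Integration.integrable_sum integrable_indicator_event sets.Int sets_is_record)
  also have "\<dots> = (\<Sum>j=1..n. \<Sum>k=1..n. expectation (indicator (?R j \<inter> ?R k)))"
    by (intro sum.cong refl Bochner_Integration.integral_sum integrable_indicator_event sets.Int sets_is_record)
  also have "\<dots> = (\<Sum>j=1..n. \<Sum>k=1..n. prob (?R j \<inter> ?R k))"
    by (intro sum.cong refl) (simp add: sets.Int)
  finally have E2: "expectation (\<lambda>\<omega>. (real (num_records X n \<omega>))\<^sup>2) = (\<Sum>j=1..n. \<Sum>k=1..n. prob (?R j \<inter> ?R k))" .
  have "variance (\<lambda>\<omega>. real (num_records X n \<omega>)) =
      expectation (\<lambda>\<omega>. (real (num_records X n \<omega>))\<^sup>2) - (expectation (\<lambda>\<omega>. real (num_records X n \<omega>)))\<^sup>2"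
    by (rule variance_eq) (rule integrable_num_records)+
  also have "\<dots> = (\<Sum>j=1..n. \<Sum>k=1..n. F j k)"
    unfolding E2 unfolding expectation_num_records F_def sum_subtractf power2_eq_square sum_product ..
  finally have "variance (\<lambda>\<omega>. real (num_records X n \<omega>)) = (\<Sum>j=1..n. \<Sum>k=1..n. F j k)" .
  also have "\<dots> = (\<Sum>k=1..n. F k k) + 2 * (\<Sum>k=1..n. \<Sum>j\<in>{1..<k}. F j k)"
    by (rule sum_square_symmetric) (simp add: F_def Int_commute mult.commute)
  also have "(\<Sum>k=1..n. F k k) \<le> (\<Sum>k=1..n. prob (?R k))"
    by (intro sum_mono) (simp add: F_def)
  also have "(\<Sum>k=1..n. \<Sum>j\<in>{1..<k}. F j k) \<le> (\<Sum>k=1..n. \<Sum>j\<in>{1..<k}. \<integral>p. g j k p \<partial>pair_law)"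
  proof (intro sum_mono)
    fix k j assume "k \<in> {1..n}" "j \<in> {1..<k}"
    moreover have "?R j \<inter> ?R k = {\<omega>\<in>space M. is_record X j \<omega> \<and> is_record X k \<omega>}" by auto
    ultimately show "F j k \<le> (\<integral>p. g j k p \<partial>pair_law)"
      using covariance_records_le[of j k] by (simp add: F_def g_def)
  qed
  also have "(\<Sum>k=1..n. \<Sum>j\<in>{1..<k}. \<integral>p. g j k p \<partial>pair_law) = (\<integral>p. cov_kernel n p \<partial>pair_law)"
  proof -
    have int: "integrable pair_law (g j k)" for j k
      unfolding g_def left_diff_distrib
      by (intro Bochner_Integration.integrable_diff integrable_pair_law) (auto simp: power_le_one intro!: mult_le_one)
    have "(\<integral>p. cov_kernel n p \<partial>pair_law) = (\<integral>p. (\<Sum>k=1..n. \<Sum>j\<in>{1..<k}. g j k p) \<partial>pair_law)"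
      by (simp add: cov_kernel_def g_def)
    also have "\<dots> = (\<Sum>k=1..n. \<integral>p. (\<Sum>j\<in>{1..<k}. g j k p) \<partial>pair_law)"
      by (intro Bochner_Integration.integral_sum Bochner_Integration.integrable_sum int)
    also have "\<dots> = (\<Sum>k=1..n. \<Sum>j\<in>{1..<k}. \<integral>p. g j k p \<partial>pair_law)"
      by (intro sum.cong refl Bochner_Integration.integral_sum int)
    finally show ?thesis ..
  qed
  finally show ?thesis by (simp add: expectation_num_records)
qed

end

section \<open>Moments of the number of records\<close>

text \<open>Twice the exponential density of rate 1/2, shifted to x and also reflected there, covers
  the integrand; each half contributes 2.\<close>

lemma nn_integral_exp_abs_le:
  fixes x :: real
  shows "(\<integral>\<^sup>+t. ennreal (exp (- \<bar>t - x\<bar> / 2)) \<partial>lborel) \<le> 4"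
proof -
  let ?f = "\<lambda>t::real. ennreal (exponential_density (1/2) t)"
  have one: "(\<integral>\<^sup>+t. ?f t \<partial>lborel) = 1"
  proof -
    have "emeasure (density lborel ?f) UNIV = 1"
      using prob_space.emeasure_space_1[OF prob_space_exponential_density[of "1/2"]] by simp
    then show ?thesis by (simp add: emeasure_density)
  qed
  have r: "(\<integral>\<^sup>+t. ?f (t - x) \<partial>lborel) = 1"
    using one by (subst (asm) nn_integral_real_affine[where c=1 and t="-x"]) (simp_all add: add.commute[of "-x"])
  have l: "(\<integral>\<^sup>+t. ?f (x - t) \<partial>lborel) = 1"
    using one by (subst (asm) nn_integral_real_affine[where c="-1" and t=x]) simp_all
  have "(\<integral>\<^sup>+t. ennreal (exp (- \<bar>t - x\<bar> / 2)) \<partial>lborel) \<le> (\<integral>\<^sup>+t. 2 * ?f (t - x) + 2 * ?f (x - t) \<partial>lborel)"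
  proof (rule nn_integral_mono)
    fix t
    have "exp (- \<bar>t - x\<bar> / 2) \<le> 2 * exponential_density (1/2) (t - x) + 2 * exponential_density (1/2) (x - t)"
      by (auto simp: exponential_density_def abs_if field_simps)
    then have "ennreal (exp (- \<bar>t - x\<bar> / 2)) \<le> ennreal (2 * exponential_density (1/2) (t - x) + 2 * exponential_density (1/2) (x - t))"
      by (rule ennreal_leI)
    also have "\<dots> = 2 * ?f (t - x) + 2 * ?f (x - t)"
      by (simp add: ennreal_plus ennreal_mult' exponential_density_nonneg)
    finally show "ennreal (exp (- \<bar>t - x\<bar> / 2)) \<le> 2 * ?f (t - x) + 2 * ?f (x - t)" .
  qed
  also have "\<dots> = 2 * 1 + 2 * 1"
    by (simp add: nn_integral_add nn_integral_cmult l r)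
  finally show ?thesis by simp
qed

definition l1_dist :: "real^'d \<Rightarrow> real^'d \<Rightarrow> real" where
  "l1_dist x y = (\<Sum>j\<in>UNIV. \<bar>x $ j - y $ j\<bar>)"

lemma l1_dist_commute: "l1_dist x y = l1_dist y x"
  unfolding l1_dist_def by (intro sum.cong) auto

lemma measurable_l1_dist [measurable (raw)]:
  assumes [measurable]: "f \<in> borel_measurable M" "g \<in> borel_measurable M"
  shows "(\<lambda>x. l1_dist (f x :: real^'d) (g x)) \<in> borel_measurable M"
proof -
  have [measurable]: "(\<lambda>x. f x $ j) \<in> borel_measurable M" "(\<lambda>x. g x $ j) \<in> borel_measurable M" for j
    by (auto intro!: measurable_compose[OF _ borel_measurable_nth])
  show ?thesis unfolding l1_dist_def by measurable
qed

text \<open>The weight exp(\<open>coord_sum y\<close>) cancels the exponential density, leaving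
  Lebesgue measure on the orthant. The l1 distance makes the integrand a product of one-dimensional
  factors.\<close>

lemma nn_integral_exp_law_l1_le:
  fixes x :: "real^'d"
  shows "(\<integral>\<^sup>+y. ennreal (exp (- l1_dist x y / 2) * exp (coord_sum y)) \<partial>exp_law) \<le> 4 ^ CARD('d)"
proof -
  have "(\<integral>\<^sup>+y. ennreal (exp (- l1_dist x y / 2) * exp (coord_sum y)) \<partial>exp_law) =
      (\<integral>\<^sup>+y. (\<Prod>j\<in>UNIV. ennreal (exp (- \<bar>y $ j - x $ j\<bar> / 2) * exp (y $ j))) \<partial>exp_law)"
  proof (rule nn_integral_cong)
    fix y :: "real^'d"
    have "exp (- l1_dist x y / 2) * exp (coord_sum y) = (\<Prod>j\<in>UNIV. exp (- \<bar>y $ j - x $ j\<bar> / 2) * exp (y $ j))"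
      by (simp add: prod.distrib exp_sum[symmetric] coord_sum_def l1_dist_def sum_divide_distrib sum_negf abs_minus_commute)
    then show "ennreal (exp (- l1_dist x y / 2) * exp (coord_sum y)) =
        (\<Prod>j\<in>UNIV. ennreal (exp (- \<bar>y $ j - x $ j\<bar> / 2) * exp (y $ j)))"
      by (simp add: prod_ennreal)
  qed
  also have "\<dots> = (\<Prod>j\<in>UNIV. \<integral>\<^sup>+t. ennreal (exponential_density 1 t) * ennreal (exp (- \<bar>t - x $ j\<bar> / 2) * exp t) \<partial>lborel)"
    by (rule nn_integral_exp_law_prod) simp
  also have "\<dots> \<le> (\<Prod>j\<in>(UNIV::'d set). 4)"
  proof (rule prod_mono_ennreal)
    fix j
    have "(\<integral>\<^sup>+t. ennreal (exponential_density 1 t) * ennreal (exp (- \<bar>t - x $ j\<bar> / 2) * exp t) \<partial>lborel) \<le>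
        (\<integral>\<^sup>+t. ennreal (exp (- \<bar>t - x $ j\<bar> / 2)) \<partial>lborel)"
    proof (rule nn_integral_mono)
      fix t
      have "exponential_density 1 t * (exp (- \<bar>t - x $ j\<bar> / 2) * exp t) \<le> exp (- \<bar>t - x $ j\<bar> / 2)"
        by (auto simp: exponential_density_def exp_minus field_simps)
      then show "ennreal (exponential_density 1 t) * ennreal (exp (- \<bar>t - x $ j\<bar> / 2) * exp t) \<le> ennreal (exp (- \<bar>t - x $ j\<bar> / 2))"
        by (subst ennreal_mult[symmetric]) (auto simp: exponential_density_nonneg intro!: ennreal_leI)
    qed
    also have "\<dots> \<le> 4" by (rule nn_integral_exp_abs_le)
    finally show "(\<integral>\<^sup>+t. ennreal (exponential_density 1 t) * ennreal (exp (- \<bar>t - x $ j\<bar> / 2) * exp t) \<partial>lborel) \<le> 4" .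
  qed
  also have "\<dots> = 4 ^ CARD('d)" by simp
  finally show ?thesis .
qed

lemma has_real_derivative_power_div_fact:
  fixes s :: real
  shows "((\<lambda>s. s ^ Suc k / fact (Suc k)) has_real_derivative s ^ k / fact k) (at s)"
proof -
  have "((\<lambda>s. s ^ Suc k / fact (Suc k)) has_real_derivative (real (Suc k) * s ^ (Suc k - Suc 0)) / fact (Suc k)) (at s)"
    by (intro DERIV_cdivide DERIV_pow)
  also have "(real (Suc k) * s ^ (Suc k - Suc 0)) / fact (Suc k) = s ^ k / fact k"
    by (simp add: fact_Suc del: of_nat_Suc)
  finally show ?thesis .
qed

text \<open>Below L the weight cancels the exponential and s^k/k! integrates to the term of degree
  k+1. Above L it is the constant e^L times the Erlang tail, which is a Poisson partial sum and
  supplies the degrees 0 to k.\<close>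

lemma erlang_truncated_moment:
  fixes L :: real and k :: nat
  assumes L: "0 \<le> L"
  shows "(\<integral>\<^sup>+s. ennreal (erlang_density k 1 s) * ennreal (exp s * min 1 (exp (L - s))) \<partial>lborel) \<le>
    ennreal (\<Sum>i\<le>Suc k. L ^ i / fact i)"
proof -
  let ?e = "\<lambda>s. ennreal (erlang_density k 1 s)"
  have "(\<integral>\<^sup>+s. ?e s * ennreal (exp s * min 1 (exp (L - s))) \<partial>lborel) \<le>
      (\<integral>\<^sup>+s. ennreal (s ^ k / fact k) * indicator {0..L} s + ennreal (exp L) * (?e s * indicator {L<..} s) \<partial>lborel)"
  proof (rule nn_integral_mono)
    fix s
    show "?e s * ennreal (exp s * min 1 (exp (L - s))) \<le>
        ennreal (s ^ k / fact k) * indicator {0..L} s + ennreal (exp L) * (?e s * indicator {L<..} s)"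
    proof (cases "0 \<le> s \<and> s \<le> L")
      case True
      have "erlang_density k 1 s * (exp s * min 1 (exp (L - s))) = s ^ k / fact k"
        using True by (simp add: erlang_density_def exp_minus)
      then have "?e s * ennreal (exp s * min 1 (exp (L - s))) = ennreal (s ^ k / fact k)"
        by (subst ennreal_mult[symmetric]) auto
      then show ?thesis using True by simp
    next
      case False
      show ?thesis
      proof (cases "s < 0")
        case True
        then show ?thesis by (simp add: erlang_density_def)
      next
        case s: False
        then have "L < s" using False by auto
        then have "exp s * min 1 (exp (L - s)) = exp L"
          by (simp add: min_def exp_diff)
        then show ?thesis using \<open>L < s\<close> by (simp add: mult.commute)
      qed
    qed
  qed
  also have "\<dots> = (\<integral>\<^sup>+s. ennreal (s ^ k / fact k) * indicator {0..L} s \<partial>lborel) +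
      ennreal (exp L) * (\<integral>\<^sup>+s. ?e s * indicator {L<..} s \<partial>lborel)"
    by (subst nn_integral_add) (auto simp: nn_integral_cmult)
  also have "(\<integral>\<^sup>+s. ennreal (s ^ k / fact k) * indicator {0..L} s \<partial>lborel) =
      ennreal (L ^ Suc k / fact (Suc k) - 0 ^ Suc k / fact (Suc k))"
  proof (rule nn_integral_FTC_Icc[where F="\<lambda>s. s ^ Suc k / fact (Suc k)"])
    fix s :: real assume "s \<in> {0..L}"
    show "((\<lambda>s. s ^ Suc k / fact (Suc k)) has_real_derivative s ^ k / fact k) (at s)"
      by (rule has_real_derivative_power_div_fact)
    show "0 \<le> s ^ k / fact k" using \<open>s \<in> {0..L}\<close> by simp
  qed (use L in auto)
  also have "(\<integral>\<^sup>+s. ?e s * indicator {L<..} s \<partial>lborel) = ennreal (1 - erlang_CDF k 1 L)"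
  proof -
    interpret D: prob_space "density lborel ?e" by (rule prob_space_erlang_density) simp
    have "(\<integral>\<^sup>+s. ?e s * indicator {L<..} s \<partial>lborel) = emeasure (density lborel ?e) {L<..}"
      by (simp add: emeasure_density)
    also have "\<dots> = ennreal (D.prob (space (density lborel ?e) - {..L}))"
      by (simp add: D.emeasure_eq_measure Compl_eq_Diff_UNIV[symmetric])
    also have "D.prob (space (density lborel ?e) - {..L}) = 1 - D.prob {..L}"
      by (rule D.prob_compl) simp
    also have "D.prob {..L} = erlang_CDF k 1 L"
      using emeasure_erlang_density[of 1 k L] by (simp add: D.emeasure_eq_measure)
    finally show ?thesis .
  qed
  also have "ennreal (exp L) * ennreal (1 - erlang_CDF k 1 L) = ennreal (\<Sum>i\<le>k. L ^ i / fact i)"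
  proof -
    have "exp L * (1 - erlang_CDF k 1 L) = (\<Sum>i\<le>k. L ^ i / fact i)"
      using L by (simp add: erlang_CDF_def sum_distrib_left exp_minus field_simps)
    then show ?thesis
      by (subst ennreal_mult'[symmetric]) auto
  qed
  also have "ennreal (L ^ Suc k / fact (Suc k) - 0 ^ Suc k / fact (Suc k)) + ennreal (\<Sum>i\<le>k. L ^ i / fact i) =
      ennreal (\<Sum>i\<le>Suc k. L ^ i / fact i)"
    using L by (subst ennreal_plus[symmetric]) (auto intro!: sum_nonneg simp: add.commute)
  finally show ?thesis .
qed

text \<open>The correction e^(s - L) costs at most L^k/k! because it has integral at most 1 on
  [0, L]. The loss stands on the right as a summand, avoiding subtraction in
  \<open>ennreal\<close>.\<close>

lemma erlang_main_term_le:
  fixes L :: real and k :: nat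
  assumes L: "0 \<le> L" and h [measurable]: "h \<in> borel_measurable borel"
    and hb: "\<And>s. 0 \<le> h s" "\<And>s. 0 \<le> s \<Longrightarrow> s \<le> L \<Longrightarrow> exp s * (1 - exp (s - L)) \<le> h s"
  shows "ennreal (L ^ Suc k / fact (Suc k)) \<le>
    (\<integral>\<^sup>+s. ennreal (erlang_density k 1 s) * ennreal (h s) \<partial>lborel) + ennreal (L ^ k / fact k)"
proof -
  let ?e = "\<lambda>s. ennreal (erlang_density k 1 s)"
  have "ennreal (L ^ Suc k / fact (Suc k) - 0 ^ Suc k / fact (Suc k)) = (\<integral>\<^sup>+s. ennreal (s ^ k / fact k) * indicator {0..L} s \<partial>lborel)"
  proof (rule nn_integral_FTC_Icc[where F="\<lambda>s. s ^ Suc k / fact (Suc k)", symmetric])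
    fix s :: real assume "s \<in> {0..L}"
    show "((\<lambda>s. s ^ Suc k / fact (Suc k)) has_real_derivative s ^ k / fact k) (at s)"
      by (rule has_real_derivative_power_div_fact)
    show "0 \<le> s ^ k / fact k" using \<open>s \<in> {0..L}\<close> by simp
  qed (use L in auto)
  also have "\<dots> \<le> (\<integral>\<^sup>+s. ?e s * ennreal (h s) + ennreal (L ^ k / fact k * exp (s - L)) * indicator {0..L} s \<partial>lborel)"
  proof (rule nn_integral_mono)
    fix s
    show "ennreal (s ^ k / fact k) * indicator {0..L} s \<le>
        ?e s * ennreal (h s) + ennreal (L ^ k / fact k * exp (s - L)) * indicator {0..L} s"
    proof (cases "s \<in> {0..L}")
      case True
      then have s: "0 \<le> s" "s \<le> L" by auto
      have "s ^ k / fact k * (1 - exp (s - L)) = erlang_density k 1 s * (exp s * (1 - exp (s - L)))"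
        using s by (simp add: erlang_density_def exp_minus)
      also have "\<dots> \<le> erlang_density k 1 s * h s"
        using hb(2)[OF s] by (intro mult_left_mono) auto
      finally have "s ^ k / fact k - s ^ k / fact k * exp (s - L) \<le> erlang_density k 1 s * h s"
        by (simp only: right_diff_distrib mult_1_right)
      moreover have "s ^ k / fact k * exp (s - L) \<le> L ^ k / fact k * exp (s - L)"
        using s by (intro mult_right_mono divide_right_mono power_mono) auto
      ultimately have "s ^ k / fact k \<le> erlang_density k 1 s * h s + L ^ k / fact k * exp (s - L)"
        by linarith
      then have "ennreal (s ^ k / fact k) \<le> ennreal (erlang_density k 1 s * h s + L ^ k / fact k * exp (s - L))"
        by (rule ennreal_leI)
      also have "\<dots> = ennreal (erlang_density k 1 s * h s) + ennreal (L ^ k / fact k * exp (s - L))"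
        using hb L by (intro ennreal_plus) auto
      also have "ennreal (erlang_density k 1 s * h s) = ?e s * ennreal (h s)"
        using hb by (intro ennreal_mult) auto
      finally show ?thesis using True by simp
    qed simp
  qed
  also have "\<dots> = (\<integral>\<^sup>+s. ?e s * ennreal (h s) \<partial>lborel) +
      (\<integral>\<^sup>+s. ennreal (L ^ k / fact k * exp (s - L)) * indicator {0..L} s \<partial>lborel)"
    by (rule nn_integral_add) auto
  also have "(\<integral>\<^sup>+s. ennreal (L ^ k / fact k * exp (s - L)) * indicator {0..L} s \<partial>lborel) =
      ennreal (L ^ k / fact k * exp (L - L) - L ^ k / fact k * exp (0 - L))"
    by (rule nn_integral_FTC_Icc) (use L in \<open>auto intro!: derivative_eq_intros\<close>)
  also have "\<dots> \<le> ennreal (L ^ k / fact k)"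
    using L by (intro ennreal_leI) simp
  finally show ?thesis by simp
qed

section \<open>Mean and covariance estimates in powers of ln n\<close>

context exp_vectors
begin

text \<open>The exponential series cut off at degree d; its top term L^d/d! is the main term of the
  mean record count.\<close>

definition log_sum :: "real \<Rightarrow> real" where
  "log_sum L = (\<Sum>i\<le>CARD('d). L ^ i / fact i)"

text \<open>For n >= 1 this is min(1/a, n) with a = exp(-\<open>coord_sum x\<close>), the elementary
  bound for the geometric sum of (1 - a)^k over k < n.\<close>

definition trunc_weight :: "nat \<Rightarrow> real^'d \<Rightarrow> real" where
  "trunc_weight n x = exp (coord_sum x) * min 1 (exp (ln (real n) - coord_sum x))"

lemma measurable_trunc_weight [measurable]: "trunc_weight n \<in> borel_measurable borel"
  unfolding trunc_weight_def[abs_def] by measurable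

lemma trunc_weight_nonneg [simp]: "0 \<le> trunc_weight n x"
  by (simp add: trunc_weight_def)

lemma log_sum_nonneg: "0 \<le> L \<Longrightarrow> 0 \<le> log_sum L"
  unfolding log_sum_def by (intro sum_nonneg) simp

lemma nn_integral_trunc_weight:
  assumes "n \<ge> 1"
  shows "(\<integral>\<^sup>+x. ennreal (trunc_weight n x) \<partial>exp_law) \<le> ennreal (log_sum (ln (real n)))"
proof -
  have "(\<integral>\<^sup>+x. ennreal (trunc_weight n x) \<partial>exp_law) =
      (\<integral>\<^sup>+s. ennreal (erlang_density (CARD('d) - 1) 1 s) * ennreal (exp s * min 1 (exp (ln (real n) - s))) \<partial>lborel)"
    unfolding trunc_weight_def
    by (rule nn_integral_exp_law_coord_sum[where g="\<lambda>s. ennreal (exp s * min 1 (exp (ln (real n) - s)))"]) measurable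
  also have "\<dots> \<le> ennreal (\<Sum>i\<le>Suc (CARD('d) - 1). (ln (real n)) ^ i / fact i)"
    by (rule erlang_truncated_moment) (use assms in simp)
  also have "Suc (CARD('d) - 1) = CARD('d)"
    by (simp add: Suc_pred')
  finally show ?thesis by (simp only: log_sum_def)
qed

lemma dom_prob_eq: "x \<in> orthant \<Longrightarrow> dom_prob (x :: real^'d) = exp (- coord_sum x)"
  unfolding dom_prob_def by (rule measure_exp_law_sprec)

lemma positive_in_orthant: "0 \<prec>\<^sub>P x \<Longrightarrow> x \<in> orthant"
  by (auto simp: sprec_def orthant_def intro: less_imp_le)

lemma AE_exp_law_orthant: "AE x in exp_law. (x :: real^'d) \<in> orthant"
  using AE_exp_law_positive by eventually_elim (rule positive_in_orthant)

lemma expectation_num_records_eq: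
  "ennreal (expectation (\<lambda>\<omega>. real (num_records X n \<omega>))) = (\<integral>\<^sup>+x. ennreal (\<Sum>k<n. (1 - dom_prob (x :: real^'d)) ^ k) \<partial>exp_law)"
proof -
  interpret E: prob_space "exp_law :: (real^'d) measure" by (rule prob_space_exp_law)
  have int: "integrable exp_law (\<lambda>x. (1 - dom_prob (x :: real^'d)) ^ k)" for k
    by (intro E.integrable_const_bound[where B=1]) (auto simp: power_le_one intro!: AE_I2)
  have "expectation (\<lambda>\<omega>. real (num_records X n \<omega>)) = (\<Sum>k=1..n. \<integral>x. (1 - dom_prob (x :: real^'d)) ^ (k - 1) \<partial>exp_law)"
    unfolding expectation_num_records by (intro sum.cong refl prob_record) auto
  also have "\<dots> = (\<Sum>k<n. \<integral>x. (1 - dom_prob (x :: real^'d)) ^ k \<partial>exp_law)"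
    by (rule sum.reindex_bij_witness[where i=Suc and j="\<lambda>k. k - 1"]) auto
  also have "\<dots> = (\<integral>x. (\<Sum>k<n. (1 - dom_prob (x :: real^'d)) ^ k) \<partial>exp_law)"
    by (intro Bochner_Integration.integral_sum[symmetric] int)
  finally show ?thesis
    by (simp only:) (intro nn_integral_eq_integral[symmetric] Bochner_Integration.integrable_sum int AE_I2 sum_nonneg zero_le_power, simp)
qed

lemma expectation_num_records_upper:
  assumes "n \<ge> 1"
  shows "expectation (\<lambda>\<omega>. real (num_records X n \<omega>)) \<le> log_sum (ln (real n))"
proof -
  have "ennreal (expectation (\<lambda>\<omega>. real (num_records X n \<omega>))) \<le> (\<integral>\<^sup>+x. ennreal (trunc_weight n x) \<partial>exp_law)"
    unfolding expectation_num_records_eq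
  proof (rule nn_integral_mono_AE)
    show "AE x in exp_law. ennreal (\<Sum>k<n. (1 - dom_prob (x :: real^'d)) ^ k) \<le> ennreal (trunc_weight n x)"
      using AE_exp_law_orthant
    proof eventually_elim
      case (elim x)
      define a where "a = dom_prob x"
      have a: "a = exp (- coord_sum x)" "0 < a" "a \<le> 1"
        using dom_prob_eq[OF elim] dom_prob_bounds(2)[of x] by (auto simp: a_def)
      have "(\<Sum>k<n. (1 - a) ^ k) \<le> (\<Sum>k<n. 1)"
        using a by (intro sum_mono power_le_one) auto
      moreover have "(\<Sum>k<n. (1 - a) ^ k) \<le> 1 / (1 - (1 - a))"
        using a by (intro sum_power_le_inverse) auto
      moreover have "trunc_weight n x = min (1 / a) (real n)"
        unfolding trunc_weight_def using assms by (auto simp: a exp_diff exp_minus min_def field_simps)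
      ultimately show ?case by (intro ennreal_leI) (simp add: a_def)
    qed
  qed
  also have "\<dots> \<le> ennreal (log_sum (ln (real n)))"
    by (rule nn_integral_trunc_weight) fact
  finally show ?thesis
    using assms by (simp add: log_sum_nonneg)
qed

lemma expectation_num_records_lower:
  assumes "n \<ge> 1"
  shows "ln (real n) ^ CARD('d) / fact CARD('d) \<le>
    expectation (\<lambda>\<omega>. real (num_records X n \<omega>)) + ln (real n) ^ (CARD('d) - 1) / fact (CARD('d) - 1)"
proof -
  define L where "L = ln (real n)"
  have L: "0 \<le> L" using assms by (simp add: L_def)
  \<comment> \<open>\<open>erlang_main_term_le\<close> asks for h >= 0 everywhere, but 1 - e^(-s) is
    negative for s < 0. The Erlang density vanishes there, so the value 0 changes no
    integral.\<close>
  define h where "h s = (if s < 0 then 0 else \<Sum>k<n. (1 - exp (- s)) ^ k)" for s :: real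
  have [measurable]: "h \<in> borel_measurable borel" unfolding h_def[abs_def] by measurable
  have "ennreal (L ^ Suc (CARD('d) - 1) / fact (Suc (CARD('d) - 1))) \<le>
      (\<integral>\<^sup>+s. ennreal (erlang_density (CARD('d) - 1) 1 s) * ennreal (h s) \<partial>lborel) + ennreal (L ^ (CARD('d) - 1) / fact (CARD('d) - 1))"
  proof (rule erlang_main_term_le[OF L])
    fix s :: real
    show "0 \<le> h s" by (auto simp: h_def intro!: sum_nonneg)
    assume s: "0 \<le> s" "s \<le> L"
    have "(\<Sum>k<n. (1 - exp (- s)) ^ k) = exp s * (1 - (1 - exp (- s)) ^ n)"
      by (subst sum_gp_strict) (simp add: exp_minus field_simps)
    \<comment> \<open>With n = e^L the power is at most exp(-e^(L - s)), and e^u >= 1 + u at u = L -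
      s finishes the bound.\<close>
    moreover have "(1 - exp (- s)) ^ n \<le> exp (s - L)"
    proof -
      have "(1 - exp (- s)) ^ n \<le> exp (- exp (- s)) ^ n"
        using s exp_ge_add_one_self[of "- exp (- s)"] by (intro power_mono) auto
      also have "\<dots> = exp (- (real n * exp (- s)))"
        by (simp add: exp_of_nat_mult[symmetric])
      also have "\<dots> = exp (- exp (L - s))"
        using assms by (simp add: L_def exp_diff exp_minus field_simps)
      also have "\<dots> \<le> exp (s - L)"
        using exp_ge_add_one_self[of "L - s"] by (simp add: algebra_simps)
      finally show ?thesis .
    qed
    ultimately show "exp s * (1 - exp (s - L)) \<le> h s"
      using s by (auto simp: h_def)
  qed simp
  also have "(\<integral>\<^sup>+s. ennreal (erlang_density (CARD('d) - 1) 1 s) * ennreal (h s) \<partial>lborel) =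
      (\<integral>\<^sup>+x. ennreal (h (coord_sum (x :: real^'d))) \<partial>exp_law)"
    by (rule nn_integral_exp_law_coord_sum[symmetric]) measurable
  also have "\<dots> = ennreal (expectation (\<lambda>\<omega>. real (num_records X n \<omega>)))"
    unfolding expectation_num_records_eq
  proof (rule nn_integral_cong_AE)
    show "AE x in exp_law. ennreal (h (coord_sum (x :: real^'d))) = ennreal (\<Sum>k<n. (1 - dom_prob x) ^ k)"
      using AE_exp_law_orthant
    proof eventually_elim
      case (elim x)
      have "coord_sum x \<ge> 0" using elim by (auto simp: coord_sum_def orthant_def intro!: sum_nonneg)
      then show ?case by (simp add: h_def dom_prob_eq[OF elim])
    qed
  qed
  also have "ennreal (expectation (\<lambda>\<omega>. real (num_records X n \<omega>))) + ennreal (L ^ (CARD('d) - 1) / fact (CARD('d) - 1)) =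
      ennreal (expectation (\<lambda>\<omega>. real (num_records X n \<omega>)) + L ^ (CARD('d) - 1) / fact (CARD('d) - 1))"
    using L by (intro ennreal_plus[symmetric] integral_nonneg_AE AE_I2) auto
  finally have "L ^ Suc (CARD('d) - 1) / fact (Suc (CARD('d) - 1)) \<le>
      expectation (\<lambda>\<omega>. real (num_records X n \<omega>)) + L ^ (CARD('d) - 1) / fact (CARD('d) - 1)"
    using L by (subst (asm) ennreal_le_iff) (auto intro!: add_nonneg_nonneg integral_nonneg_AE)
  moreover have "Suc (CARD('d) - 1) = CARD('d)" by (simp add: Suc_pred')
  ultimately show ?thesis by (simp only: L_def)
qed

text \<open>Dominating both points is dominating their coordinatewise maximum, and max(s, t) = (s +
  t + |s - t|)/2.\<close>

lemma dom_prob2_eq: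
  assumes "x \<in> orthant" "y \<in> orthant"
  shows "dom_prob2 x (y :: real^'d) = exp (- (coord_sum x + coord_sum y) / 2) * exp (- l1_dist x y / 2)"
proof -
  define z where "z = (\<chi> j. max (x $ j) (y $ j))"
  have "z \<in> orthant" using assms by (auto simp: z_def orthant_def le_max_iff_disj)
  then have "dom_prob z = exp (- coord_sum z)" by (rule dom_prob_eq)
  moreover have "dom_prob2 x y = dom_prob z"
    unfolding dom_prob2_def dom_prob_def
    by (intro arg_cong[where f="measure exp_law"]) (auto simp: sprec_def z_def)
  moreover have "2 * coord_sum z = coord_sum x + coord_sum y + l1_dist x y"
    unfolding coord_sum_def l1_dist_def sum_distrib_left sum.distrib[symmetric]
    by (intro sum.cong) (auto simp: z_def max_def)
  then have "coord_sum z = (coord_sum x + coord_sum y) / 2 + l1_dist x y / 2" by argo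
  then have "- coord_sum z = - (coord_sum x + coord_sum y) / 2 + - l1_dist x y / 2" by argo
  ultimately show ?thesis by (simp only: exp_add[symmetric])
qed

text \<open>The probability of dominating both x and y is the geometric mean of the two individual
  probabilities, times exp of minus half the l1 distance. This factor decouples x and y.\<close>

lemma cov_kernel_le:
  assumes x: "x \<in> orthant" and y: "y \<in> orthant" and n: "n \<ge> 1"
  shows "cov_kernel n (x, y) \<le>
    exp (- l1_dist x y / 2) * exp (coord_sum y) * trunc_weight n x +
    exp (- l1_dist x y / 2) * exp (coord_sum x) * trunc_weight n y"
proof -
  define a b c u e where "a = exp (- coord_sum x)" and "b = exp (- coord_sum y)"
    and "c = dom_prob2 x y" and "u = max a b" and "e = exp (- l1_dist x y / 2)"
  have da: "dom_prob x = a" and db: "dom_prob y = b"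
    using dom_prob_eq x y by (auto simp: a_def b_def)
  have ab: "0 < a" "a \<le> 1" "0 < b" "b \<le> 1"
    using dom_prob_bounds(2)[of x] dom_prob_bounds(2)[of y] unfolding da db by (auto simp: a_def b_def)
  have c: "0 \<le> c" "c \<le> a" "c \<le> b" unfolding da[symmetric] db[symmetric] c_def by auto
  have A: "0 \<le> 1 - a - b + c" using pair_avoid_bounds(1)[of "(x, y)"] by (simp add: pair_avoid_def da db c_def)
  have K: "cov_kernel n (x, y) = (\<Sum>k=1..n. \<Sum>j\<in>{1..<k}. ((1 - a - b + c) ^ (j - 1) - ((1 - a) * (1 - b)) ^ (j - 1)) * (1 - b) ^ (k - 1 - j))"
    by (simp add: cov_kernel_def pair_avoid_def indep_avoid_def da db c_def)
  note bnd = covariance_kernel_bound[OF ab c A, of n, folded K]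
  have e: "0 < e" by (simp add: e_def)
  have u: "0 < u" "a \<le> u" "b \<le> u" using ab by (auto simp: u_def)
  \<comment> \<open>The geometric mean of a and b is at most their maximum u.\<close>
  have "exp (- (coord_sum x + coord_sum y) / 2) \<le> u"
  proof (cases "coord_sum x \<le> coord_sum y")
    case True
    then have "exp (- (coord_sum x + coord_sum y) / 2) \<le> a" by (simp add: a_def)
    then show ?thesis using u by linarith
  next
    case False
    then have "exp (- (coord_sum x + coord_sum y) / 2) \<le> b" by (simp add: b_def)
    then show ?thesis using u by linarith
  qed
  then have cu: "c \<le> u * e"
    unfolding c_def dom_prob2_eq[OF x y] e_def by (intro mult_right_mono) auto
  have wx: "trunc_weight n x = min 1 (real n * a) / a"
    using n ab unfolding trunc_weight_def by (simp add: a_def exp_diff exp_minus field_simps)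
  have wy: "trunc_weight n y = min 1 (real n * b) / b"
    using n ab unfolding trunc_weight_def by (simp add: b_def exp_diff exp_minus field_simps)
  have ey: "exp (coord_sum y) = 1 / b" and ex: "exp (coord_sum x) = 1 / a"
    by (auto simp: a_def b_def exp_minus field_simps)
  define W where "W = min 1 (real n * a) + min 1 (real n * b)"
  have rhs: "exp (- l1_dist x y / 2) * exp (coord_sum y) * trunc_weight n x +
    exp (- l1_dist x y / 2) * exp (coord_sum x) * trunc_weight n y = e * W / (a * b)"
    unfolding wx wy ex ey e_def[symmetric] W_def using ab by (simp add: field_simps)
  show ?thesis
    unfolding rhs
  \<comment> \<open>If n u >= 1, one truncation inside W equals 1 and the geometric series bound
    suffices. Otherwise both na and nb are at most 1, W is at least n u, and the bound n^3 c is the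
    smaller one.\<close>
  proof (cases "real n * u \<ge> 1")
    case True
    have W1: "1 \<le> W" using True ab unfolding W_def u_def by (auto simp: max_def min_def split: if_splits)
    have "cov_kernel n (x, y) \<le> c / (b * u\<^sup>2)" using bnd(2) by (simp add: u_def)
    also have "\<dots> \<le> (u * e) / (b * u\<^sup>2)" using cu ab u by (intro divide_right_mono) auto
    also have "\<dots> = e / (b * u)" using u ab by (simp add: power2_eq_square)
    also have "\<dots> \<le> e * W / (b * a)"
      using u ab e W1 by (intro frac_le mult_left_mono) auto
    finally show "cov_kernel n (x, y) \<le> e * W / (a * b)" by (simp add: mult.commute)
  next
    case False
    then have na: "real n * a \<le> 1" and nb: "real n * b \<le> 1"
      using u mult_left_mono[of a u "real n"] mult_left_mono[of b u "real n"] by auto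
    have "cov_kernel n (x, y) \<le> real n ^ 3 * (u * e)"
      using bnd(1) mult_left_mono[OF cu, of "real n ^ 3"] by simp
    also have "\<dots> = e * (real n * u) * ((real n * a) * (real n * b)) / (a * b)"
      using ab by (simp add: field_simps power3_eq_cube)
    also have "\<dots> \<le> e * W * 1 / (a * b)"
    proof (intro divide_right_mono mult_mono)
      show "real n * u \<le> W" using na nb ab unfolding W_def u_def by (auto simp: max_def min_def)
      show "real n * a * (real n * b) \<le> 1" by (rule mult_le_one) (use na nb ab in auto)
    qed (use ab e u W_def in auto)
    finally show "cov_kernel n (x, y) \<le> e * W / (a * b)" by simp
  qed
qed

text \<open>The two terms of \<open>cov_kernel_le\<close> are mirror images. In each, the
  untruncated point is integrated out first at cost 4^d, leaving the integral of
  \<open>trunc_weight\<close> that also bounds the mean.\<close>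

lemma integral_cov_kernel_le:
  assumes n: "n \<ge> 1"
  shows "(\<integral>p. cov_kernel n p \<partial>pair_law) \<le> 2 * 4 ^ CARD('d) * log_sum (ln (real n))"
proof -
  interpret E1: prob_space "exp_law :: (real^'d) measure" by (rule prob_space_exp_law)
  interpret E: pair_prob_space "exp_law :: (real^'d) measure" "exp_law :: (real^'d) measure"
    by (rule pair_prob_space_exp_law)
  define K where "K x y = exp (- l1_dist x y / 2) * exp (coord_sum y) * trunc_weight n x" for x y :: "real^'d"
  have [measurable]: "(\<lambda>p. K (fst p) (snd p)) \<in> borel_measurable pair_law"
    "(\<lambda>p. K (snd p) (fst p)) \<in> borel_measurable pair_law"
    unfolding K_def by measurable
  have K0: "0 \<le> K x y" for x y by (simp add: K_def)
  have half: "(\<integral>\<^sup>+x. \<integral>\<^sup>+y. ennreal (K x y) \<partial>exp_law \<partial>exp_law) \<le> 4 ^ CARD('d) * ennreal (log_sum (ln (real n)))"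
  proof -
    have "(\<integral>\<^sup>+x. \<integral>\<^sup>+y. ennreal (K x y) \<partial>exp_law \<partial>exp_law) \<le>
        (\<integral>\<^sup>+x. 4 ^ CARD('d) * ennreal (trunc_weight n x) \<partial>exp_law)"
    proof (rule nn_integral_mono)
      fix x :: "real^'d"
      have "(\<integral>\<^sup>+y. ennreal (K x y) \<partial>exp_law) =
          (\<integral>\<^sup>+y. ennreal (exp (- l1_dist x y / 2) * exp (coord_sum y)) * ennreal (trunc_weight n x) \<partial>exp_law)"
        by (simp add: K_def ennreal_mult')
      also have "\<dots> = (\<integral>\<^sup>+y. ennreal (exp (- l1_dist x y / 2) * exp (coord_sum y)) \<partial>exp_law) * ennreal (trunc_weight n x)"
        by (rule nn_integral_multc) measurable
      also have "\<dots> \<le> 4 ^ CARD('d) * ennreal (trunc_weight n x)"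
        by (intro mult_right_mono nn_integral_exp_law_l1_le) simp
      finally show "(\<integral>\<^sup>+y. ennreal (K x y) \<partial>exp_law) \<le> 4 ^ CARD('d) * ennreal (trunc_weight n x)" .
    qed
    also have "\<dots> = 4 ^ CARD('d) * (\<integral>\<^sup>+x. ennreal (trunc_weight n x) \<partial>exp_law)"
      by (rule nn_integral_cmult) measurable
    also have "\<dots> \<le> 4 ^ CARD('d) * ennreal (log_sum (ln (real n)))"
      by (intro mult_left_mono nn_integral_trunc_weight n) simp
    finally show ?thesis .
  qed
  have "(\<integral>\<^sup>+p. ennreal (cov_kernel n p) \<partial>pair_law) = (\<integral>\<^sup>+x. \<integral>\<^sup>+y. ennreal (cov_kernel n (x, y)) \<partial>exp_law \<partial>exp_law)"
    by (rule E1.nn_integral_fst[symmetric]) measurable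
  also have "\<dots> \<le> (\<integral>\<^sup>+x. \<integral>\<^sup>+y. ennreal (K x y) + ennreal (K y x) \<partial>exp_law \<partial>exp_law)"
  proof (rule nn_integral_mono_AE)
    show "AE x in exp_law. (\<integral>\<^sup>+y. ennreal (cov_kernel n (x, y)) \<partial>exp_law) \<le> (\<integral>\<^sup>+y. ennreal (K x y) + ennreal (K y x) \<partial>exp_law)"
      using AE_exp_law_orthant
    proof eventually_elim
      case x: (elim x)
      show ?case
      proof (rule nn_integral_mono_AE)
        show "AE y in exp_law. ennreal (cov_kernel n (x, y)) \<le> ennreal (K x y) + ennreal (K y x)"
          using AE_exp_law_orthant
        proof eventually_elim
          case (elim y)
          have "cov_kernel n (x, y) \<le> K x y + K y x"
            using cov_kernel_le[OF x elim n] by (simp add: K_def l1_dist_commute[of y x])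
          then show ?case using K0 by (simp add: ennreal_plus[symmetric] ennreal_leI del: ennreal_plus)
        qed
      qed
    qed
  qed
  also have "\<dots> = (\<integral>\<^sup>+p. ennreal (K (fst p) (snd p)) + ennreal (K (snd p) (fst p)) \<partial>pair_law)"
    using E1.nn_integral_fst[of "\<lambda>p. ennreal (K (fst p) (snd p)) + ennreal (K (snd p) (fst p))" exp_law] by simp
  also have "\<dots> = (\<integral>\<^sup>+p. ennreal (K (fst p) (snd p)) \<partial>pair_law) + (\<integral>\<^sup>+p. ennreal (K (snd p) (fst p)) \<partial>pair_law)"
    by (rule nn_integral_add) measurable
  also have "(\<integral>\<^sup>+p. ennreal (K (fst p) (snd p)) \<partial>pair_law) = (\<integral>\<^sup>+x. \<integral>\<^sup>+y. ennreal (K x y) \<partial>exp_law \<partial>exp_law)"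
    using E1.nn_integral_fst[of "\<lambda>p. ennreal (K (fst p) (snd p))" exp_law] by simp
  also have "(\<integral>\<^sup>+p. ennreal (K (snd p) (fst p)) \<partial>pair_law) = (\<integral>\<^sup>+x. \<integral>\<^sup>+y. ennreal (K x y) \<partial>exp_law \<partial>exp_law)"
  proof -
    have "(\<lambda>p. ennreal (K (snd p) (fst p))) \<in> borel_measurable pair_law" by measurable
    from E.nn_integral_snd[OF this] show ?thesis by simp
  qed
  also have "(\<integral>\<^sup>+x. \<integral>\<^sup>+y. ennreal (K x y) \<partial>exp_law \<partial>exp_law) + (\<integral>\<^sup>+x. \<integral>\<^sup>+y. ennreal (K x y) \<partial>exp_law \<partial>exp_law) \<le>
      4 ^ CARD('d) * ennreal (log_sum (ln (real n))) + 4 ^ CARD('d) * ennreal (log_sum (ln (real n)))"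
    by (intro add_mono half)
  also have "\<dots> = ennreal (2 * 4 ^ CARD('d) * log_sum (ln (real n)))"
    using n by (simp add: log_sum_nonneg ennreal_mult' ennreal_power[symmetric] mult_2[symmetric] mult.assoc)
  \<comment> \<open>\<open>ennreal\<close> replaces negative kernel values by 0, which is harmless
    for an upper bound on the signed integral.\<close>
  finally show ?thesis
    using n by (intro integral_real_bounded) (simp add: log_sum_nonneg)
qed

lemma num_records_moments:
  obtains C where "C \<ge> 1"
    "\<And>n. ln (real n) \<ge> 1 \<Longrightarrow> n \<ge> 1 \<Longrightarrow>
      \<bar>expectation (\<lambda>\<omega>. real (num_records X n \<omega>)) - ln (real n) ^ CARD('d) / fact CARD('d)\<bar> \<le> C * ln (real n) ^ (CARD('d) - 1)"
    "\<And>n. ln (real n) \<ge> 1 \<Longrightarrow> n \<ge> 1 \<Longrightarrow>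
      variance (\<lambda>\<omega>. real (num_records X n \<omega>)) \<le> C * ln (real n) ^ CARD('d)"
proof
  define d where "d = CARD('d)"
  have d: "d \<ge> 1" by (simp add: d_def Suc_leI)
  \<comment> \<open>The factor 1 + 4 * 4^d combines the mean with twice the covariance integral; d +
    1 counts the powers of L, each at most L^d because L >= 1.\<close>
  let ?C = "(1 + 4 * 4 ^ d) * (real d + 1)"
  have C1: "real d + 1 \<le> ?C" by (simp add: mult_le_cancel_right1)
  then show "1 \<le> ?C" by linarith
  fix n :: nat assume L: "ln (real n) \<ge> 1" and n: "n \<ge> 1"
  define L where "L = ln (real n)"
  have L: "1 \<le> L" using L by (simp add: L_def)
  let ?E = "expectation (\<lambda>\<omega>. real (num_records X n \<omega>))"
  have ls: "log_sum L \<le> L ^ d / fact d + real d * L ^ (d - 1)"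
  proof -
    obtain k where k: "d = Suc k" using d by (cases d) auto
    have "(\<Sum>i\<le>k. L ^ i / fact i) \<le> (\<Sum>i\<le>k. L ^ k)"
    proof (rule sum_mono)
      fix i assume "i \<in> {..k}"
      have "L ^ i / fact i \<le> L ^ i / 1" using L by (intro divide_left_mono) (auto simp: fact_ge_1)
      also have "\<dots> \<le> L ^ k" using \<open>i \<in> {..k}\<close> L by (simp add: power_increasing)
      finally show "L ^ i / fact i \<le> L ^ k" .
    qed
    then show ?thesis unfolding log_sum_def d_def[symmetric] k by simp
  qed
  have L1: "L ^ (d - 1) \<ge> 0" using L by simp
  have "?E \<le> L ^ d / fact d + real d * L ^ (d - 1)"
    using expectation_num_records_upper[OF n] ls by (simp add: L_def)
  moreover have "L ^ d / fact d \<le> ?E + L ^ (d - 1)"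
  proof -
    have "L ^ (d - 1) / fact (d - 1) \<le> L ^ (d - 1) / 1" using L1 by (intro divide_left_mono) (auto simp: fact_ge_1)
    then show ?thesis using expectation_num_records_lower[OF n] by (simp add: L_def d_def)
  qed
  moreover have "real d * L ^ (d - 1) \<le> ?C * L ^ (d - 1)" "1 * L ^ (d - 1) \<le> ?C * L ^ (d - 1)"
    using L1 C1 by (intro mult_right_mono; linarith)+
  ultimately have "\<bar>?E - L ^ d / fact d\<bar> \<le> ?C * L ^ (d - 1)" by linarith
  then show "\<bar>?E - ln (real n) ^ CARD('d) / fact CARD('d)\<bar> \<le> ?C * ln (real n) ^ (CARD('d) - 1)"
    by (simp add: L_def d_def)
  have "variance (\<lambda>\<omega>. real (num_records X n \<omega>)) \<le> log_sum L + 2 * (2 * 4 ^ d * log_sum L)"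
    using variance_num_records_le[of n] expectation_num_records_upper[OF n] integral_cov_kernel_le[OF n]
    by (simp add: L_def d_def)
  also have "\<dots> = (1 + 4 * 4 ^ d) * log_sum L" by (simp add: algebra_simps)
  also have "\<dots> \<le> (1 + 4 * 4 ^ d) * ((real d + 1) * L ^ d)"
  proof (intro mult_left_mono)
    have "L ^ d / fact d \<le> L ^ d / 1" using L by (intro divide_left_mono) (auto simp: fact_ge_1)
    moreover have "real d * L ^ (d - 1) \<le> real d * L ^ d" using L by (intro mult_left_mono power_increasing) auto
    ultimately show "log_sum L \<le> (real d + 1) * L ^ d" using ls by (simp add: algebra_simps)
  qed simp
  finally show "variance (\<lambda>\<omega>. real (num_records X n \<omega>)) \<le> ?C * ln (real n) ^ CARD('d)"
    by (simp add: L_def d_def mult.assoc)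
qed

end

section \<open>Tail bounds at deterministic times\<close>

text \<open>Here s is the logarithmic time at which the main term reaches m. A distance delta from
  ln n to s separates m from the mean by at least L^(d-1) (delta/D - C); for large delta half of
  delta/D absorbs C, and Chebyshev applies.\<close>

lemma (in exp_vectors) num_records_tail:
  obtains C where "C \<ge> 1"
    "\<And>n m s \<delta>. ln (real n) \<ge> 1 \<Longrightarrow> \<delta> \<ge> C \<Longrightarrow> ln (real n) + \<delta> \<le> s \<Longrightarrow> s ^ CARD('d) / fact CARD('d) \<le> real m \<Longrightarrow>
      prob {\<omega>\<in>space M. m \<le> num_records X n \<omega>} \<le>
        C * (ln (real n) ^ CARD('d) / (ln (real n) ^ (CARD('d) - 1))\<^sup>2) / \<delta>\<^sup>2"
    "\<And>n m s \<delta>. ln (real n) \<ge> 1 \<Longrightarrow> \<delta> \<ge> C \<Longrightarrow> s + \<delta> \<le> ln (real n) \<Longrightarrow> 0 \<le> s \<Longrightarrow> real m \<le> s ^ CARD('d) / fact CARD('d) \<Longrightarrow>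
      prob {\<omega>\<in>space M. num_records X n \<omega> < m} \<le>
        C * (ln (real n) ^ CARD('d) / (ln (real n) ^ (CARD('d) - 1))\<^sup>2) / \<delta>\<^sup>2"
proof -
  define d where "d = CARD('d)"
  obtain k where k: "d = Suc k" unfolding d_def by (metis not0_implies_Suc zero_less_card_finite less_irrefl)
  obtain C where C: "C \<ge> 1"
    and EC: "\<And>n. ln (real n) \<ge> 1 \<Longrightarrow> n \<ge> 1 \<Longrightarrow>
      \<bar>expectation (\<lambda>\<omega>. real (num_records X n \<omega>)) - ln (real n) ^ CARD('d) / fact CARD('d)\<bar> \<le> C * ln (real n) ^ (CARD('d) - 1)"
    and VC: "\<And>n. ln (real n) \<ge> 1 \<Longrightarrow> n \<ge> 1 \<Longrightarrow>
      variance (\<lambda>\<omega>. real (num_records X n \<omega>)) \<le> C * ln (real n) ^ CARD('d)"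
    by (rule num_records_moments) (rule that)
  define D where "D = (fact d :: real)"
  have D: "D \<ge> 1" by (simp add: D_def fact_ge_1)
  \<comment> \<open>The threshold t = L^(d-1) delta/(2D) produces the factor 4 D^2 in the Chebyshev
    bound; the same constant makes C <= delta/(2D) whenever delta >= C'.\<close>
  define C' where "C' = 4 * C * D\<^sup>2"
  have "2 * C * D \<le> 4 * C * D * D" using C D mult_mono[of 1 D 1 D] by (simp add: mult_mono)
  then have C'2: "2 * C * D \<le> C'" by (simp add: C'_def power2_eq_square)
  have "1 * 1 \<le> C * D" using C D by (intro mult_mono) auto
  then have C'1: "1 \<le> C'" using C'2 by linarith
  have cheb: "prob A \<le> C' * (L ^ d / (L ^ (d - 1))\<^sup>2) / \<delta>\<^sup>2"
    if n: "ln (real n) \<ge> 1" and \<delta>: "\<delta> \<ge> C'" and L: "L = ln (real n)"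
      and A: "A \<subseteq> {\<omega>\<in>space M. L ^ (d - 1) * (\<delta> / D - C) \<le>
         \<bar>real (num_records X n \<omega>) - expectation (\<lambda>\<omega>. real (num_records X n \<omega>))\<bar>}"
    for n \<delta> L A
  proof -
    have n1: "n \<ge> 1" using n by (cases n) auto
    define t where "t = L ^ (d - 1) * (\<delta> / (2 * D))"
    have l1: "L \<ge> 1" using n L by simp
    have "C \<le> \<delta> / (2 * D)" using D \<delta> C'2 by (simp add: pos_le_divide_eq mult_ac)
    then have "t \<le> L ^ (d - 1) * (\<delta> / D - C)"
      unfolding t_def using l1 D by (intro mult_left_mono) (simp_all add: field_simps)
    moreover have \<delta>0: "\<delta> > 0" using \<delta> C'1 by linarith
    then have t0: "t > 0" using l1 D by (simp add: t_def)
    ultimately have "A \<subseteq> {\<omega>\<in>space M. t \<le> \<bar>real (num_records X n \<omega>) - expectation (\<lambda>\<omega>. real (num_records X n \<omega>))\<bar>}"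
      using A by (auto intro: order_trans)
    then have "prob A \<le> prob {\<omega>\<in>space M. t \<le> \<bar>real (num_records X n \<omega>) - expectation (\<lambda>\<omega>. real (num_records X n \<omega>))\<bar>}"
      by (rule finite_measure_mono) measurable
    also have "\<dots> \<le> variance (\<lambda>\<omega>. real (num_records X n \<omega>)) / t\<^sup>2"
      by (rule Chebyshev_inequality) (use integrable_num_records t0 in auto)
    also have "\<dots> \<le> (C * L ^ d) / t\<^sup>2"
      using VC[OF n n1] by (intro divide_right_mono) (simp_all add: L d_def)
    also have "\<dots> = C' * (L ^ d / (L ^ (d - 1))\<^sup>2) / \<delta>\<^sup>2"
      using D by (simp add: t_def C'_def power_mult_distrib power_divide)
    finally show ?thesis .
  qed
  \<comment> \<open>The estimate must feature L^(d-1), and L is the smaller endpoint in the first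
    tail and the larger one in the second; hence the two versions.\<close>
  have pow: "v ^ (d - 1) * (u - v) \<le> u ^ d - v ^ d" if "0 \<le> v" "v \<le> u" for u v :: real
  proof -
    have "v ^ (d - 1) * u \<le> u ^ (d - 1) * u"
      using that by (intro mult_right_mono power_mono) auto
    then show ?thesis by (simp add: k algebra_simps)
  qed
  have pow2: "u ^ (d - 1) * (u - v) \<le> u ^ d - v ^ d" if "0 \<le> v" "v \<le> u" for u v :: real
  proof -
    have "v ^ (d - 1) * v \<le> u ^ (d - 1) * v"
      using that by (intro mult_right_mono power_mono) auto
    then show ?thesis by (simp add: k algebra_simps)
  qed
  show thesis
  proof (rule that[of C'])
    show "1 \<le> C'" by fact
    fix n m :: nat and s \<delta> :: real
    assume n: "ln (real n) \<ge> 1" and \<delta>: "\<delta> \<ge> C'"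
    define L where "L = ln (real n)"
    have l1: "L \<ge> 1" using n by (simp add: L_def)
    have n1: "n \<ge> 1" using n by (cases n) auto
    define E where "E = expectation (\<lambda>\<omega>. real (num_records X n \<omega>))"
    have E: "\<bar>E - L ^ d / D\<bar> \<le> C * L ^ (d - 1)"
      using EC[OF n n1] by (simp add: E_def L_def d_def D_def)
    have \<delta>0: "\<delta> > 0" using \<delta> C'1 by linarith
    {
      assume s: "ln (real n) + \<delta> \<le> s" and m: "s ^ CARD('d) / fact CARD('d) \<le> real m"
      have "L ^ (d - 1) * \<delta> \<le> L ^ (d - 1) * (s - L)"
        using s l1 by (intro mult_left_mono) (auto simp: L_def)
      also have "\<dots> \<le> s ^ d - L ^ d"
        using l1 s \<delta>0 by (intro pow) (auto simp: L_def)
      finally have "L ^ (d - 1) * \<delta> / D \<le> (s ^ d - L ^ d) / D"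
        using D by (intro divide_right_mono) auto
      moreover have "s ^ d / D \<le> real m" using m by (simp add: d_def D_def)
      moreover have "L ^ (d - 1) * (\<delta> / D - C) = L ^ (d - 1) * \<delta> / D - C * L ^ (d - 1)"
        by (simp add: right_diff_distrib)
      ultimately have gap: "L ^ (d - 1) * (\<delta> / D - C) \<le> real m - E"
        using E unfolding diff_divide_distrib by linarith
      have "prob {\<omega>\<in>space M. m \<le> num_records X n \<omega>} \<le> C' * (L ^ d / (L ^ (d - 1))\<^sup>2) / \<delta>\<^sup>2"
        by (rule cheb[OF n \<delta> L_def]) (use gap in \<open>auto simp: E_def[symmetric]\<close>)
      then show "prob {\<omega>\<in>space M. m \<le> num_records X n \<omega>} \<le>
        C' * (ln (real n) ^ CARD('d) / (ln (real n) ^ (CARD('d) - 1))\<^sup>2) / \<delta>\<^sup>2"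
        by (simp add: L_def d_def)
    }
    {
      assume s: "s + \<delta> \<le> ln (real n)" "0 \<le> s" and m: "real m \<le> s ^ CARD('d) / fact CARD('d)"
      have "L ^ (d - 1) * \<delta> \<le> L ^ (d - 1) * (L - s)"
        using s l1 by (intro mult_left_mono) (auto simp: L_def)
      also have "\<dots> \<le> L ^ d - s ^ d"
        using l1 s \<delta>0 by (intro pow2) (auto simp: L_def)
      finally have "L ^ (d - 1) * \<delta> / D \<le> (L ^ d - s ^ d) / D"
        using D by (intro divide_right_mono) auto
      moreover have "real m \<le> s ^ d / D" using m by (simp add: d_def D_def)
      moreover have "L ^ (d - 1) * (\<delta> / D - C) = L ^ (d - 1) * \<delta> / D - C * L ^ (d - 1)"
        by (simp add: right_diff_distrib)
      ultimately have gap: "L ^ (d - 1) * (\<delta> / D - C) \<le> E - real m"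
        using E unfolding diff_divide_distrib by linarith
      have "prob {\<omega>\<in>space M. num_records X n \<omega> < m} \<le> C' * (L ^ d / (L ^ (d - 1))\<^sup>2) / \<delta>\<^sup>2"
        by (rule cheb[OF n \<delta> L_def]) (use gap in \<open>auto simp: E_def[symmetric]\<close>)
      then show "prob {\<omega>\<in>space M. num_records X n \<omega> < m} \<le>
        C' * (ln (real n) ^ CARD('d) / (ln (real n) ^ (CARD('d) - 1))\<^sup>2) / \<delta>\<^sup>2"
        by (simp add: L_def d_def)
    }
  qed
qed

lemma power_ratio_le_1:
  fixes L :: real
  assumes "1 \<le> L" "2 \<le> d"
  shows "L ^ d / (L ^ (d - 1))\<^sup>2 \<le> 1"
proof -
  have "L ^ d \<le> L ^ (2 * (d - 1))" using assms by (intro power_increasing) auto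
  then show ?thesis using assms by (simp add: power_mult[symmetric] mult.commute)
qed

text \<open>The Chebyshev ratio is L^(2-d), an inverse square or better for d >= 4. At the k-th
  checkpoint L is of order k, so these errors are summable.\<close>

lemma power_ratio_le_inverse_square:
  fixes L :: real
  assumes "1 \<le> L" "4 \<le> d"
  shows "L ^ d / (L ^ (d - 1))\<^sup>2 \<le> 1 / L\<^sup>2"
proof -
  have "L ^ (d + 2) \<le> L ^ (2 * (d - 1))" using assms by (intro power_increasing) auto
  then have "L ^ d * L\<^sup>2 \<le> (L ^ (d - 1))\<^sup>2"
    by (simp only: power_add power_mult[symmetric] mult.commute)
  then show ?thesis using assms by (simp add: divide_le_eq pos_le_divide_eq)
qed

context exp_vectors
begin

lemma prob_mem_RS:
  assumes "y \<in> orthant"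
  shows "prob {\<omega>\<in>space M. y \<in> RS X n \<omega>} = (1 - exp (- coord_sum y)) ^ n"
proof -
  have "{\<omega>\<in>space M. y \<in> RS X n \<omega>} = {\<omega>\<in>space M. \<forall>i\<in>{1..n}. X i \<omega> \<in> {z. \<not> y \<prec>\<^sub>P z}}"
    using assms by (auto simp: RS_def)
  moreover have "prob {\<omega>\<in>space M. \<forall>i\<in>{1..n}. X i \<omega> \<in> {z. \<not> y \<prec>\<^sub>P z}} = (\<Prod>i\<in>{1..n}. measure exp_law {z. \<not> y \<prec>\<^sub>P z})"
    by (rule prob_all_in) auto
  ultimately show ?thesis
    by (simp add: measure_not_dom dom_prob_eq[OF assms])
qed

lemma events_mem_RS [measurable]: "{\<omega>\<in>space M. y \<in> RS X n \<omega>} \<in> events"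
  using pred_mem_RS[of X M y n] X_measurable by (simp add: pred_def)

lemma random_variable_Fminus [measurable]: "Fminus X n \<in> borel_measurable M"
  by (rule measurable_Fminus) (rule X_measurable)

lemma random_variable_Ftilde [measurable]: "Ftilde X m \<in> borel_measurable M"
  by (rule measurable_Ftilde) (rule X_measurable)

lemma events_num_records [measurable]:
  "{\<omega>\<in>space M. m \<le> num_records X n \<omega>} \<in> events" "{\<omega>\<in>space M. num_records X n \<omega> < m} \<in> events"
proof -
  have "{\<omega>\<in>space M. real m \<le> real (num_records X n \<omega>)} \<in> events"
    "{\<omega>\<in>space M. real (num_records X n \<omega>) < real m} \<in> events" by measurable
  then show "{\<omega>\<in>space M. m \<le> num_records X n \<omega>} \<in> events" "{\<omega>\<in>space M. num_records X n \<omega> < m} \<in> events"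
    by simp_all
qed

text \<open>Rounding coordinates up keeps a point in \<open>RS\<close> and adds at most d to its
  sum. The uncountable union thus becomes at most (b + 2)^d grid events, at the price of a constant
  in the exponent.\<close>

lemma prob_Fminus_less:
  assumes n: "n \<ge> 1" and b: "b \<ge> 0"
  shows "prob {\<omega>\<in>space M. Fminus X n \<omega> < b} \<le> (b + 2) ^ CARD('d) * exp (- (real n * exp (- (b + real CARD('d)))))"
proof -
  define N where "N = nat \<lceil>b\<rceil>"
  define y where "y f = (\<chi> j. real (f j))" for f :: "'d \<Rightarrow> nat"
  define P where "P = {f \<in> PiE UNIV (\<lambda>_. {..N}). coord_sum (y f) \<le> b + real CARD('d)}"
  have finP: "finite (PiE (UNIV :: 'd set) (\<lambda>_. {..N}))" by (intro finite_PiE) auto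
  then have fin: "finite P" unfolding P_def by simp
  have "prob {\<omega>\<in>space M. Fminus X n \<omega> < b} \<le> prob (\<Union>f\<in>P. {\<omega>\<in>space M. y f \<in> RS X n \<omega>})"
  proof (rule finite_measure_mono_AE)
    show "AE \<omega> in M. \<omega> \<in> {\<omega>\<in>space M. Fminus X n \<omega> < b} \<longrightarrow> \<omega> \<in> (\<Union>f\<in>P. {\<omega>\<in>space M. y f \<in> RS X n \<omega>})"
      using AE_positive AE_space
    proof eventually_elim
      case (elim \<omega>)
      show ?case
      proof
        assume "\<omega> \<in> {\<omega>\<in>space M. Fminus X n \<omega> < b}"
        then obtain x where x: "x \<in> RS X n \<omega>" "coord_sum x < b"
          using Fminus_less_iff[of 1 n X \<omega> b] elim n by auto
        have x0: "0 \<le> x $ j" for j using x by (auto simp: RS_def orthant_def)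
        define f where "f j = nat \<lceil>x $ j\<rceil>" for j
        have f1: "x $ j \<le> real (f j)" for j
          unfolding f_def by (rule real_nat_ceiling_ge)
        have f2: "real (f j) \<le> x $ j + 1" for j
          using x0[of j] unfolding f_def by linarith
        have "x $ j \<le> coord_sum x" for j
          unfolding coord_sum_def by (rule member_le_sum) (use x0 in auto)
        then have "x $ j \<le> b" for j using x(2) by (meson le_less_trans less_imp_le)
        then have fN: "f j \<le> N" for j
          unfolding f_def N_def by (intro nat_mono ceiling_mono)
        have "coord_sum (y f) \<le> (\<Sum>j\<in>UNIV. x $ j + 1)"
          unfolding coord_sum_def y_def using f2 by (intro sum_mono) auto
        also have "\<dots> = coord_sum x + real CARD('d)"
          by (simp add: coord_sum_def sum.distrib)
        finally have "f \<in> P" using fN x(2) unfolding P_def by auto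
        moreover have "y f \<in> RS X n \<omega>"
          by (rule RS_upclosed[OF x(1)]) (simp add: y_def f1)
        ultimately show "\<omega> \<in> (\<Union>f\<in>P. {\<omega>\<in>space M. y f \<in> RS X n \<omega>})"
          using elim by auto
      qed
    qed
  qed (use fin in \<open>auto intro!: sets.finite_UN\<close>)
  also have "\<dots> \<le> (\<Sum>f\<in>P. prob {\<omega>\<in>space M. y f \<in> RS X n \<omega>})"
    by (rule finite_measure_subadditive_finite[OF fin]) auto
  also have "\<dots> \<le> (\<Sum>f\<in>P. exp (- (real n * exp (- (b + real CARD('d))))))"
  proof (rule sum_mono)
    fix f assume f: "f \<in> P"
    have yo: "y f \<in> orthant" by (simp add: y_def orthant_def)
    have y0: "0 \<le> coord_sum (y f)" by (auto simp: y_def coord_sum_def intro: sum_nonneg)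
    have "prob {\<omega>\<in>space M. y f \<in> RS X n \<omega>} = (1 - exp (- coord_sum (y f))) ^ n"
      by (rule prob_mem_RS[OF yo])
    also have "\<dots> \<le> exp (- exp (- coord_sum (y f))) ^ n"
      using y0 exp_ge_add_one_self[of "- exp (- coord_sum (y f))"] by (intro power_mono) auto
    also have "\<dots> = exp (- (real n * exp (- coord_sum (y f))))"
      by (simp add: exp_of_nat_mult[symmetric])
    also have "\<dots> \<le> exp (- (real n * exp (- (b + real CARD('d)))))"
      using f by (auto simp: P_def intro!: mult_left_mono)
    finally show "prob {\<omega>\<in>space M. y f \<in> RS X n \<omega>} \<le> exp (- (real n * exp (- (b + real CARD('d)))))" .
  qed
  also have "\<dots> = real (card P) * exp (- (real n * exp (- (b + real CARD('d)))))" by simp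
  also have "\<dots> \<le> (b + 2) ^ CARD('d) * exp (- (real n * exp (- (b + real CARD('d)))))"
  proof (rule mult_right_mono)
    have "card P \<le> card (PiE (UNIV :: 'd set) (\<lambda>_. {..N}))"
      unfolding P_def by (intro card_mono finP) auto
    also have "\<dots> = (N + 1) ^ CARD('d)" by (simp add: card_PiE)
    finally have "real (card P) \<le> real (N + 1) ^ CARD('d)"
      by (metis of_nat_le_iff of_nat_power)
    also have "\<dots> \<le> (b + 2) ^ CARD('d)"
    proof (rule power_mono)
      show "real (N + 1) \<le> b + 2" using b unfolding N_def by linarith
    qed simp
    finally show "real (card P) \<le> (b + 2) ^ CARD('d)" .
  qed simp
  finally show ?thesis .
qed

text \<open>Either distinct observations dominate the points, which gives the first term, or a single
  observation dominates two points at l1 distance at least 2 eta, which gives the second.\<close>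

lemma prob_all_dominated:
  fixes x :: "nat \<Rightarrow> real^'d"
  assumes x: "\<And>i. i < N \<Longrightarrow> x i \<in> orthant" "\<And>i. i < N \<Longrightarrow> coord_sum (x i) = b"
    and sep: "\<And>i k. i < N \<Longrightarrow> k < N \<Longrightarrow> i \<noteq> k \<Longrightarrow> 2 * \<eta> \<le> l1_dist (x i) (x k)"
  shows "prob {\<omega>\<in>space M. \<forall>i<N. \<exists>q\<in>{1..n}. x i \<prec>\<^sub>P X q \<omega>} \<le>
    (real n * exp (- b)) ^ N + (real N)\<^sup>2 * real n * exp (- (b + \<eta>))"
proof -
  have meas [measurable]: "{\<omega>\<in>space M. z \<prec>\<^sub>P X q \<omega>} \<in> events" if "q \<ge> 1" for z q
    using pred_sprec[of "\<lambda>_. z" M "X q"] X_measurable[OF that] by (simp add: pred_def)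
  \<comment> \<open>\<open>G\<close> assigns distinct dominating observations to the points;
    \<open>H\<close> records two different points with one common dominating observation.\<close>
  define G where "G = {f \<in> PiE {..<N} (\<lambda>_. {1..n}). inj_on f {..<N}}"
  define H where "H = {(i, k, q). i < N \<and> k < N \<and> i \<noteq> k \<and> q \<in> {1..n}}"
  define AG where "AG f = {\<omega>\<in>space M. \<forall>i<N. x i \<prec>\<^sub>P X (f i) \<omega>}" for f
  define AH where "AH h = (case h of (i, k, q) \<Rightarrow> {\<omega>\<in>space M. x i \<prec>\<^sub>P X q \<omega>} \<inter> {\<omega>\<in>space M. x k \<prec>\<^sub>P X q \<omega>})" for h
  have finPi: "finite (PiE {..<N} (\<lambda>_. {1..n}))" by (intro finite_PiE) auto
  then have finG: "finite G" by (simp add: G_def)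
  have subH: "H \<subseteq> {..<N} \<times> {..<N} \<times> {1..n}" by (auto simp: H_def)
  then have finH: "finite H" by (rule finite_subset) auto
  have AGm: "AG f \<in> events" if "f \<in> G" for f
  proof -
    have "AG f = space M \<inter> (\<Inter>i\<in>{..<N}. {\<omega>\<in>space M. x i \<prec>\<^sub>P X (f i) \<omega>})"
      by (auto simp: AG_def)
    moreover have "{\<omega>\<in>space M. x i \<prec>\<^sub>P X (f i) \<omega>} \<in> events" if "i < N" for i
      using \<open>f \<in> G\<close> that by (intro meas) (auto simp: G_def PiE_iff)
    then have "space M \<inter> (\<Inter>i\<in>{..<N}. {\<omega>\<in>space M. x i \<prec>\<^sub>P X (f i) \<omega>}) \<in> events"
      by (cases "N = 0") (auto intro!: sets.Int sets.finite_INT)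
    ultimately show ?thesis by simp
  qed
  have AHm: "AH h \<in> events" if "h \<in> H" for h
    using that by (auto simp: AH_def H_def split: prod.splits intro!: sets.Int meas)
  have sub: "{\<omega>\<in>space M. \<forall>i<N. \<exists>q\<in>{1..n}. x i \<prec>\<^sub>P X q \<omega>} \<subseteq> (\<Union>f\<in>G. AG f) \<union> (\<Union>h\<in>H. AH h)"
  proof
    fix \<omega> assume \<omega>: "\<omega> \<in> {\<omega>\<in>space M. \<forall>i<N. \<exists>q\<in>{1..n}. x i \<prec>\<^sub>P X q \<omega>}"
    then have "\<forall>i\<in>{..<N}. \<exists>q. q \<in> {1..n} \<and> x i \<prec>\<^sub>P X q \<omega>" by blast
    from bchoice[OF this] obtain g where g: "\<And>i. i < N \<Longrightarrow> g i \<in> {1..n} \<and> x i \<prec>\<^sub>P X (g i) \<omega>"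
      by auto
    show "\<omega> \<in> (\<Union>f\<in>G. AG f) \<union> (\<Union>h\<in>H. AH h)"
    proof (cases "inj_on g {..<N}")
      case True
      then have "restrict g {..<N} \<in> G" using g by (auto simp: G_def)
      moreover have "\<omega> \<in> AG (restrict g {..<N})" using g \<omega> by (auto simp: AG_def)
      ultimately show ?thesis by blast
    next
      case False
      then obtain i k where ik: "i < N" "k < N" "i \<noteq> k" "g i = g k" by (auto simp: inj_on_def)
      then have "(i, k, g i) \<in> H" using g by (auto simp: H_def)
      moreover have "x k \<prec>\<^sub>P X (g i) \<omega>" using g[OF ik(2)] ik(4) by simp
      then have "\<omega> \<in> AH (i, k, g i)" using g[OF ik(1)] \<omega> by (simp add: AH_def)
      ultimately show ?thesis by blast
    qed
  qed
  have pG: "prob (AG f) = exp (- b) ^ N" if f: "f \<in> G" for f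
  proof -
    have inj: "inj_on f {..<N}" using f by (simp add: G_def)
    have f1: "f i \<in> {1..n}" if "i < N" for i
      using f that unfolding G_def by (intro PiE_mem[of f "{..<N}" "\<lambda>_. {1..n}"]) simp_all
    \<comment> \<open>Inverting the assignment indexes the event by observations instead of points,
      the form to which independence applies.\<close>
    define h where "h = the_inv_into {..<N} f"
    have h: "h (f i) = i" if "i < N" for i
      unfolding h_def using that by (intro the_inv_into_f_f[OF inj]) auto
    have "AG f = {\<omega>\<in>space M. \<forall>q\<in>f ` {..<N}. X q \<omega> \<in> {z. x (h q) \<prec>\<^sub>P z}}"
      using h by (auto simp: AG_def)
    also have "prob \<dots> = (\<Prod>q\<in>f ` {..<N}. measure exp_law {z. x (h q) \<prec>\<^sub>P z})"
      using f1 by (intro prob_all_in) auto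
    also have "\<dots> = (\<Prod>i<N. measure exp_law {z. x i \<prec>\<^sub>P z})"
      by (subst prod.reindex[OF inj]) (auto simp: h intro!: prod.cong)
    also have "\<dots> = (\<Prod>i<N. exp (- b))"
      by (intro prod.cong refl) (simp add: measure_exp_law_sprec x)
    finally show ?thesis by simp
  qed
  have pH: "prob (AH h) \<le> exp (- (b + \<eta>))" if hH: "h \<in> H" for h
  proof -
    obtain i k q where h: "h = (i, k, q)" "i < N" "k < N" "i \<noteq> k" "q \<ge> 1" using hH by (auto simp: H_def)
    have "AH h = {\<omega>\<in>space M. X q \<omega> \<in> {z. x i \<prec>\<^sub>P z \<and> x k \<prec>\<^sub>P z}}" using h by (auto simp: AH_def)
    then have "prob (AH h) = dom_prob2 (x i) (x k)"
      unfolding dom_prob2_def using h(5) by (simp add: measure_exp_law[of q])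
    also have "\<dots> = exp (- (b + b) / 2) * exp (- l1_dist (x i) (x k) / 2)"
      using x h by (simp add: dom_prob2_eq)
    also have "\<dots> \<le> exp (- (b + b) / 2) * exp (- \<eta>)"
      using sep[OF h(2-4)] by simp
    also have "\<dots> = exp (- (b + \<eta>))" by (simp add: exp_add[symmetric])
    finally show ?thesis .
  qed
  have "prob {\<omega>\<in>space M. \<forall>i<N. \<exists>q\<in>{1..n}. x i \<prec>\<^sub>P X q \<omega>} \<le> prob ((\<Union>f\<in>G. AG f) \<union> (\<Union>h\<in>H. AH h))"
    using sub by (rule finite_measure_mono) (use finG finH AGm AHm in \<open>auto intro!: sets.finite_UN\<close>)
  also have "\<dots> \<le> prob (\<Union>f\<in>G. AG f) + prob (\<Union>h\<in>H. AH h)"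
    by (rule measure_Un_le) (use finG finH AGm AHm in \<open>auto intro!: sets.finite_UN\<close>)
  also have "\<dots> \<le> (\<Sum>f\<in>G. prob (AG f)) + (\<Sum>h\<in>H. prob (AH h))"
    by (intro add_mono finite_measure_subadditive_finite finG finH) (use AGm AHm in auto)
  also have "\<dots> \<le> (\<Sum>f\<in>G. exp (- b) ^ N) + (\<Sum>h\<in>H. exp (- (b + \<eta>)))"
    using pG pH by (intro add_mono sum_mono) auto
  also have "\<dots> = real (card G) * exp (- b) ^ N + real (card H) * exp (- (b + \<eta>))" by simp
  also have "\<dots> \<le> real n ^ N * exp (- b) ^ N + ((real N)\<^sup>2 * real n) * exp (- (b + \<eta>))"
  proof (intro add_mono mult_right_mono)
    have "card G \<le> card (PiE {..<N} (\<lambda>_. {1..n}))"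
      unfolding G_def by (intro card_mono finPi) auto
    also have "\<dots> = n ^ N" by (simp add: card_PiE)
    finally show "real (card G) \<le> real n ^ N" by (metis of_nat_le_iff of_nat_power)
    have "card H \<le> card ({..<N} \<times> {..<N} \<times> {1..n})" by (intro card_mono subH) auto
    also have "\<dots> = N * N * n" by (simp add: card_cartesian_product)
    finally show "real (card H) \<le> (real N)\<^sup>2 * real n"
      by (simp only: power2_eq_square of_nat_mult[symmetric] of_nat_le_iff)
  qed auto
  finally show ?thesis by (simp add: power_mult_distrib)
qed

text \<open>If the minimum is at least b, every point of sum b' < b is dominated. The gap between b'
  and b is due to the strict inequality in \<open>Fminus_less_iff\<close>.\<close>

lemma prob_Fminus_ge:
  assumes d2: "CARD('d) \<ge> 2" and n: "n \<ge> 1" and b: "0 \<le> b'" "b' < b" and K: "K \<ge> 1"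
  shows "prob {\<omega>\<in>space M. Fminus X n \<omega> \<ge> b} \<le>
    (real n * exp (- b')) ^ (K + 1) + (real (K + 1))\<^sup>2 * real n * exp (- (b' + b' / real K))"
proof -
  obtain j0 j1 :: 'd where j: "j0 \<noteq> j1"
    using d2 by (metis card_2_iff' card_le_Suc0_iff_eq finite_class.finite_UNIV iso_tuple_UNIV_I not_less_eq_eq numeral_2_eq_2)
  \<comment> \<open>K+1 equally spaced points on a segment joining two coordinate axes at height b'.
    Neighbours differ by b'/K in two coordinates, hence by 2b'/K in l1 distance; this is where d >=
    2 enters.\<close>
  define x :: "nat \<Rightarrow> real^'d" where
    "x i = (\<chi> j. (if j = j0 then real i * b' / real K else 0) + (if j = j1 then (real K - real i) * b' / real K else 0))" for i
  have xo: "x i \<in> orthant" if "i < K + 1" for i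
    using that b by (auto simp: x_def orthant_def)
  have xs: "coord_sum (x i) = b'" for i
  proof -
    have "coord_sum (x i) = real i * b' / real K + (real K - real i) * b' / real K"
      by (simp add: coord_sum_def x_def sum.distrib)
    also have "\<dots> = b'" using K by (simp add: field_simps)
    finally show ?thesis .
  qed
  have sep: "2 * (b' / real K) \<le> l1_dist (x i) (x k)" if "i \<noteq> k" for i k
  proof -
    have "l1_dist (x i) (x k) = (\<Sum>j\<in>UNIV. (if j = j0 then \<bar>real i - real k\<bar> * (b' / real K) else 0) + (if j = j1 then \<bar>real i - real k\<bar> * (b' / real K) else 0))"
      unfolding l1_dist_def
    proof (intro sum.cong refl)
      fix j
      have e1: "real i * b' / real K - real k * b' / real K = (real i - real k) * (b' / real K)"
        by (simp add: left_diff_distrib diff_divide_distrib)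
      have e2: "(real K - real i) * b' / real K - (real K - real k) * b' / real K = - ((real i - real k) * (b' / real K))"
        by (simp add: diff_divide_distrib left_diff_distrib)
      have e3: "\<bar>(real i - real k) * (b' / real K)\<bar> = \<bar>real i - real k\<bar> * (b' / real K)"
        using b by (simp add: abs_mult)
      show "\<bar>x i $ j - x k $ j\<bar> = (if j = j0 then \<bar>real i - real k\<bar> * (b' / real K) else 0) + (if j = j1 then \<bar>real i - real k\<bar> * (b' / real K) else 0)"
        unfolding x_def using j e1 e2 e3 by (simp del: times_divide_eq_right times_divide_eq_left)
    qed
    also have "\<dots> = 2 * (\<bar>real i - real k\<bar> * (b' / real K))"
      by (simp add: sum.distrib)
    finally have "l1_dist (x i) (x k) = 2 * (\<bar>real i - real k\<bar> * (b' / real K))" .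
    moreover have "1 * (b' / real K) \<le> \<bar>real i - real k\<bar> * (b' / real K)"
      using that b by (intro mult_right_mono) auto
    ultimately show ?thesis by simp
  qed
  have meas: "{\<omega>\<in>space M. \<forall>i<K + 1. \<exists>q\<in>{1..n}. x i \<prec>\<^sub>P X q \<omega>} \<in> events"
  proof -
    have "{\<omega>\<in>space M. \<forall>i<K + 1. \<exists>q\<in>{1..n}. x i \<prec>\<^sub>P X q \<omega>} =
        (\<Inter>i\<in>{..<K+1}. \<Union>q\<in>{1..n}. {\<omega>\<in>space M. x i \<prec>\<^sub>P X q \<omega>})"
      by auto
    moreover have "{\<omega>\<in>space M. x i \<prec>\<^sub>P X q \<omega>} \<in> events" if "q \<in> {1..n}" for i q
      using pred_sprec[of "\<lambda>_. x i" M "X q"] X_measurable[of q] that by (simp add: pred_def)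
    ultimately show ?thesis
      by (auto intro!: sets.finite_INT sets.finite_UN)
  qed
  have "prob {\<omega>\<in>space M. Fminus X n \<omega> \<ge> b} \<le> prob {\<omega>\<in>space M. \<forall>i<K + 1. \<exists>q\<in>{1..n}. x i \<prec>\<^sub>P X q \<omega>}"
  proof (rule finite_measure_mono_AE[OF _ meas])
    show "AE \<omega> in M. \<omega> \<in> {\<omega>\<in>space M. Fminus X n \<omega> \<ge> b} \<longrightarrow> \<omega> \<in> {\<omega>\<in>space M. \<forall>i<K + 1. \<exists>q\<in>{1..n}. x i \<prec>\<^sub>P X q \<omega>}"
      using AE_positive
    proof eventually_elim
      case (elim \<omega>)
      show ?case
      proof
        assume F: "\<omega> \<in> {\<omega>\<in>space M. Fminus X n \<omega> \<ge> b}"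
        then have "x i \<notin> RS X n \<omega>" for i
          using Fminus_less_iff[of 1 n X \<omega> b] elim n xs[of i] b by auto
        then show "\<omega> \<in> {\<omega>\<in>space M. \<forall>i<K + 1. \<exists>q\<in>{1..n}. x i \<prec>\<^sub>P X q \<omega>}"
          using F xo by (auto simp: RS_def)
      qed
    qed
  qed
  also have "\<dots> \<le> (real n * exp (- b')) ^ (K + 1) + (real (K + 1))\<^sup>2 * real n * exp (- (b' + b' / real K))"
    by (rule prob_all_dominated[where b=b' and \<eta>="b' / real K"]) (use xo xs sep in auto)
  finally show ?thesis .
qed

end

section \<open>Tail bounds at record times\<close>

context exp_vectors
begin

text \<open>The inverse of s to s^d/d!, hence the predicted logarithm of the m-th record
  time.\<close>

definition record_scale :: "nat \<Rightarrow> real" where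
  "record_scale m = (fact CARD('d) * real m) powr (1 / real CARD('d))"

lemma record_scale_nonneg [simp]: "0 \<le> record_scale m"
  by (simp add: record_scale_def)

lemma record_scale_power: "record_scale m ^ CARD('d) = fact CARD('d) * real m"
proof (cases "m = 0")
  case False
  then have "record_scale m ^ CARD('d) = record_scale m powr real CARD('d)"
    by (intro powr_realpow[symmetric]) (simp add: record_scale_def)
  then show ?thesis using False by (simp add: record_scale_def powr_powr)
qed (simp add: record_scale_def)

lemma record_scale_ge_1: "m \<ge> 1 \<Longrightarrow> 1 \<le> record_scale m"
proof -
  assume "m \<ge> 1"
  then have "1 * 1 \<le> fact CARD('d) * real m" by (intro mult_mono) (auto simp: fact_ge_1)
  then show ?thesis unfolding record_scale_def by (intro ge_one_powr_ge_zero) auto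
qed

text \<open>Needed so that record times are almost surely genuine. Having fewer than m records
  forever forces the lower tail event at every n, and its probability tends to 0 as n grows.\<close>

lemma AE_num_records_unbounded:
  assumes d2: "CARD('d) \<ge> 2"
  shows "AE \<omega> in M. \<forall>m. \<exists>n. m \<le> num_records X n \<omega>"
proof -
  obtain C where C: "C \<ge> 1"
    "\<And>n m s \<delta>. ln (real n) \<ge> 1 \<Longrightarrow> \<delta> \<ge> C \<Longrightarrow> s + \<delta> \<le> ln (real n) \<Longrightarrow> 0 \<le> s \<Longrightarrow> real m \<le> s ^ CARD('d) / fact CARD('d) \<Longrightarrow>
      prob {\<omega>\<in>space M. num_records X n \<omega> < m} \<le>
        C * (ln (real n) ^ CARD('d) / (ln (real n) ^ (CARD('d) - 1))\<^sup>2) / \<delta>\<^sup>2"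
    by (rule num_records_tail) (rule that)
  have "AE \<omega> in M. \<exists>n. m \<le> num_records X n \<omega>" for m
  proof -
    define A where "A = (\<Inter>n. {\<omega>\<in>space M. num_records X n \<omega> < m})"
    have A: "A \<in> events" unfolding A_def by (intro sets.countable_INT) auto
    have "prob A \<le> 0 + e" if e: "e > 0" for e
    proof -
      \<comment> \<open>The summand C meets the threshold of the tail bound, and C/e makes C/delta
        at most e.\<close>
      define \<delta> where "\<delta> = C + C / e"
      define n where "n = nat \<lceil>exp (record_scale m + \<delta>)\<rceil>"
      have \<delta>: "\<delta> \<ge> C" "\<delta> \<ge> C / e" using C(1) e by (auto simp: \<delta>_def)
      have n: "exp (record_scale m + \<delta>) \<le> real n" unfolding n_def by (rule real_nat_ceiling_ge)
      moreover from n have "0 < real n" by (rule less_le_trans[OF exp_gt_zero])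
      ultimately have "ln (exp (record_scale m + \<delta>)) \<le> ln (real n)"
        by (subst ln_le_cancel_iff) auto
      then have ln: "record_scale m + \<delta> \<le> ln (real n)" by simp
      have l1: "1 \<le> ln (real n)" using ln \<delta> C(1) record_scale_nonneg[of m] by linarith
      have "prob A \<le> prob {\<omega>\<in>space M. num_records X n \<omega> < m}"
        by (intro finite_measure_mono) (auto simp: A_def)
      also have "\<dots> \<le> C * (ln (real n) ^ CARD('d) / (ln (real n) ^ (CARD('d) - 1))\<^sup>2) / \<delta>\<^sup>2"
        by (rule C(2)[OF l1 \<delta>(1) ln]) (simp_all add: record_scale_power)
      also have "\<dots> \<le> C * 1 / \<delta>\<^sup>2"
        using C(1) by (intro divide_right_mono mult_left_mono power_ratio_le_1 l1 d2) auto
      also have "\<dots> \<le> C / \<delta>"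
      proof -
        have "\<delta> \<ge> 1" using \<delta> C by linarith
        then have "\<delta> * 1 \<le> \<delta>\<^sup>2" unfolding power2_eq_square by (intro mult_left_mono) auto
        then show ?thesis using C \<open>\<delta> \<ge> 1\<close> by (auto intro!: divide_left_mono)
      qed
      also have "\<dots> \<le> C / (C / e)" using \<delta> C(1) e by (intro divide_left_mono mult_pos_pos divide_pos_pos) linarith+
      also have "\<dots> = e" using C e by simp
      finally show ?thesis by simp
    qed
    then have "prob A \<le> 0" by (rule field_le_epsilon)
    then have "prob A = 0" by (simp add: measure_le_0_iff)
    then have "AE \<omega> in M. \<omega> \<notin> A"
      using A by (simp add: AE_iff_measurable[OF A] prob_eq_0 emeasure_eq_measure)
    then show ?thesis
      using AE_space by eventually_elim (auto simp: A_def not_less)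
  qed
  then show ?thesis by (simp add: AE_all_countable)
qed

text \<open>With fewer than m records by time n, the m-th record comes later and the frontier
  minimum can only have grown. That it comes at all holds almost surely.\<close>

lemma prob_Ftilde_less:
  assumes d2: "CARD('d) \<ge> 2" and m: "m \<ge> 1" and n: "n \<ge> 1"
  shows "prob {\<omega>\<in>space M. Ftilde X m \<omega> < b} \<le>
    prob {\<omega>\<in>space M. m \<le> num_records X n \<omega>} + prob {\<omega>\<in>space M. Fminus X n \<omega> < b}"
proof -
  have "prob {\<omega>\<in>space M. Ftilde X m \<omega> < b} \<le>
      prob ({\<omega>\<in>space M. m \<le> num_records X n \<omega>} \<union> {\<omega>\<in>space M. Fminus X n \<omega> < b})"
  proof (rule finite_measure_mono_AE)
    show "AE \<omega> in M. \<omega> \<in> {\<omega>\<in>space M. Ftilde X m \<omega> < b} \<longrightarrow>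
        \<omega> \<in> {\<omega>\<in>space M. m \<le> num_records X n \<omega>} \<union> {\<omega>\<in>space M. Fminus X n \<omega> < b}"
      using AE_positive AE_num_records_unbounded[OF d2]
    proof eventually_elim
      case (elim \<omega>)
      obtain n' where n': "m \<le> num_records X n' \<omega>" using elim by blast
      show ?case
      proof (cases "m \<le> num_records X n \<omega>")
        case False
        then have "n < record_time X m \<omega>" using n' m by (intro record_time_greater[of m X n \<omega> n']) auto
        then have "Fminus X n \<omega> \<le> Ftilde X m \<omega>"
          unfolding Ftilde_def using elim n by (intro Fminus_mono) auto
        then show ?thesis by auto
      qed auto
    qed
  qed measurable
  also have "\<dots> \<le> prob {\<omega>\<in>space M. m \<le> num_records X n \<omega>} + prob {\<omega>\<in>space M. Fminus X n \<omega> < b}"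
    by (rule measure_Un_le) measurable
  finally show ?thesis .
qed

text \<open>With at least m records by time n, the m-th one has already occurred, and the frontier
  minimum at n is at least its value then.\<close>

lemma prob_Ftilde_ge:
  assumes m: "m \<ge> 1"
  shows "prob {\<omega>\<in>space M. Ftilde X m \<omega> \<ge> b} \<le>
    prob {\<omega>\<in>space M. num_records X n \<omega> < m} + prob {\<omega>\<in>space M. Fminus X n \<omega> \<ge> b}"
proof -
  have "prob {\<omega>\<in>space M. Ftilde X m \<omega> \<ge> b} \<le>
      prob ({\<omega>\<in>space M. num_records X n \<omega> < m} \<union> {\<omega>\<in>space M. Fminus X n \<omega> \<ge> b})"
  proof (rule finite_measure_mono_AE)
    show "AE \<omega> in M. \<omega> \<in> {\<omega>\<in>space M. Ftilde X m \<omega> \<ge> b} \<longrightarrow>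
        \<omega> \<in> {\<omega>\<in>space M. num_records X n \<omega> < m} \<union> {\<omega>\<in>space M. Fminus X n \<omega> \<ge> b}"
      using AE_positive
    proof eventually_elim
      case (elim \<omega>)
      show ?case
      proof (cases "m \<le> num_records X n \<omega>")
        case True
        then have "Ftilde X m \<omega> \<le> Fminus X n \<omega>"
          unfolding Ftilde_def using elim m record_time_works[OF m True] by (intro Fminus_mono) auto
        then show ?thesis by auto
      qed auto
    qed
  qed measurable
  also have "\<dots> \<le> prob {\<omega>\<in>space M. num_records X n \<omega> < m} + prob {\<omega>\<in>space M. Fminus X n \<omega> \<ge> b}"
    by (rule measure_Un_le) measurable
  finally show ?thesis .
qed

text \<open>For d >= 4 the decay in s alone suffices and the gain from delta is dropped; in low
  dimensions only the decay in delta is kept. The factor 4 comes from L >= s/2.\<close>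

lemma tail_ratio_bound:
  fixes C L s \<delta> :: real
  assumes d2: "CARD('d) \<ge> 2" and C: "1 \<le> C"
    and L: "1 \<le> L" "s / 2 \<le> L" and s: "0 < s" and \<delta>: "1 \<le> \<delta>"
  shows "C * (L ^ CARD('d) / (L ^ (CARD('d) - 1))\<^sup>2) / \<delta>\<^sup>2 \<le>
      (if CARD('d) \<ge> 4 then (4 * C) / s\<^sup>2 else (4 * C) / \<delta>\<^sup>2)"
proof (cases "CARD('d) \<ge> 4")
  case True
  have "L ^ CARD('d) / (L ^ (CARD('d) - 1))\<^sup>2 \<le> 1 / L\<^sup>2"
    by (rule power_ratio_le_inverse_square[OF L(1) True])
  also have "\<dots> \<le> 1 / (s / 2)\<^sup>2"
    using L s by (intro divide_left_mono power_mono) auto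
  finally have le: "L ^ CARD('d) / (L ^ (CARD('d) - 1))\<^sup>2 \<le> 1 / (s / 2)\<^sup>2" .
  have "C * (L ^ CARD('d) / (L ^ (CARD('d) - 1))\<^sup>2) / \<delta>\<^sup>2 \<le> C * (1 / (s / 2)\<^sup>2) / 1"
  proof (rule frac_le)
    show "C * (L ^ CARD('d) / (L ^ (CARD('d) - 1))\<^sup>2) \<le> C * (1 / (s / 2)\<^sup>2)"
      using C by (intro mult_left_mono le) auto
    show "1 \<le> \<delta>\<^sup>2" using \<delta> by (simp add: one_le_power)
  qed (use C in auto)
  then show ?thesis using True by (simp add: power_divide mult.commute)
next
  case False
  have "C * (L ^ CARD('d) / (L ^ (CARD('d) - 1))\<^sup>2) / \<delta>\<^sup>2 \<le> (4 * C) / \<delta>\<^sup>2"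
    using mult_left_mono[OF power_ratio_le_1[OF L(1) d2], of C] C by (intro divide_right_mono) auto
  then show ?thesis using False by simp
qed

text \<open>The error is split: delta pays for the fluctuation of the record time, eta for the depth
  below ln n. The frontier part is doubly exponentially small in eta, against only polynomially many
  grid points.\<close>

lemma Ftilde_lower_tail:
  assumes d2: "CARD('d) \<ge> 2"
  obtains C where "C \<ge> 1"
    "\<And>m \<delta> \<eta> s. m \<ge> 1 \<Longrightarrow> s = record_scale m \<Longrightarrow> \<delta> \<ge> C \<Longrightarrow> 2 * \<delta> + 4 \<le> s \<Longrightarrow> \<delta> + \<eta> \<le> s \<Longrightarrow> 0 \<le> \<eta> \<Longrightarrow>
       prob {\<omega>\<in>space M. Ftilde X m \<omega> < s - \<delta> - \<eta>} \<le>
       (if CARD('d) \<ge> 4 then C / s\<^sup>2 else C / \<delta>\<^sup>2) + (s + 2) ^ CARD('d) * exp (- (exp (\<eta> - real CARD('d)) / 2))"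
proof -
  obtain C where C: "C \<ge> 1"
    and C1: "\<And>n m s \<delta>. ln (real n) \<ge> 1 \<Longrightarrow> \<delta> \<ge> C \<Longrightarrow> ln (real n) + \<delta> \<le> s \<Longrightarrow> s ^ CARD('d) / fact CARD('d) \<le> real m \<Longrightarrow>
      prob {\<omega>\<in>space M. m \<le> num_records X n \<omega>} \<le>
        C * (ln (real n) ^ CARD('d) / (ln (real n) ^ (CARD('d) - 1))\<^sup>2) / \<delta>\<^sup>2"
    by (rule num_records_tail) (rule that)
  show thesis
  proof (rule that[of "4 * C"])
    show "1 \<le> 4 * C" using C by simp
    fix m :: nat and \<delta> \<eta> s :: real
    assume m: "m \<ge> 1" and s: "s = record_scale m" and \<delta>': "\<delta> \<ge> 4 * C"
    assume c: "2 * \<delta> + 4 \<le> s" "\<delta> + \<eta> \<le> s" "0 \<le> \<eta>"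
    have \<delta>: "\<delta> \<ge> C" "\<delta> \<ge> 1" using \<delta>' C by linarith+
    have s1: "s \<ge> 1" using record_scale_ge_1[OF m] s by simp
    have sm: "s ^ CARD('d) / fact CARD('d) = real m" by (simp add: s record_scale_power)
    \<comment> \<open>A time slightly too early for m records; 2 delta + 4 <= s keeps its logarithm
      above 1 and above s/2.\<close>
    define n where "n = nat \<lfloor>exp (s - \<delta>)\<rfloor>"
    have e2: "exp (s - \<delta>) \<ge> 2" using exp_ge_add_one_self[of "s - \<delta>"] c \<delta> by linarith
    have nu: "real n \<le> exp (s - \<delta>)" unfolding n_def by (simp add: of_nat_floor)
    have "exp (s - \<delta>) - 1 \<le> real n" using e2 unfolding n_def by linarith
    then have nl: "exp (s - \<delta>) / 2 \<le> real n" using e2 by linarith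
    have n1: "n \<ge> 1" using nl e2 by linarith
    have "ln (real n) \<le> ln (exp (s - \<delta>))" using nu n1 by (subst ln_le_cancel_iff) auto
    then have lu: "ln (real n) + \<delta> \<le> s" by simp
    \<comment> \<open>Rounding down loses at most a factor 2, and 2 <= e costs at most 1 in the
      logarithm.\<close>
    have "exp (s - \<delta> - 1) \<le> exp (s - \<delta>) / 2"
      using exp_ge_add_one_self[of 1] by (simp add: exp_diff divide_left_mono)
    then have "ln (exp (s - \<delta> - 1)) \<le> ln (real n)"
      using nl n1 by (subst ln_le_cancel_iff) auto
    then have ll: "s - \<delta> - 1 \<le> ln (real n)" by simp
    then have l1: "1 \<le> ln (real n)" and l2: "s / 2 \<le> ln (real n)" using c \<delta> by linarith+
    have "prob {\<omega>\<in>space M. m \<le> num_records X n \<omega>} \<le>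
        C * (ln (real n) ^ CARD('d) / (ln (real n) ^ (CARD('d) - 1))\<^sup>2) / \<delta>\<^sup>2"
      by (rule C1[OF l1 \<delta>(1) lu]) (simp add: sm)
    also have "\<dots> \<le> (if CARD('d) \<ge> 4 then (4 * C) / s\<^sup>2 else (4 * C) / \<delta>\<^sup>2)"
      using s1 \<delta> by (intro tail_ratio_bound d2 C l1 l2) auto
    finally have p1: "prob {\<omega>\<in>space M. m \<le> num_records X n \<omega>} \<le> (if CARD('d) \<ge> 4 then (4 * C) / s\<^sup>2 else (4 * C) / \<delta>\<^sup>2)" .
    have "prob {\<omega>\<in>space M. Fminus X n \<omega> < s - \<delta> - \<eta>} \<le>
        (s - \<delta> - \<eta> + 2) ^ CARD('d) * exp (- (real n * exp (- (s - \<delta> - \<eta> + real CARD('d)))))"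
      using c by (intro prob_Fminus_less n1) auto
    also have "\<dots> \<le> (s + 2) ^ CARD('d) * exp (- (exp (\<eta> - real CARD('d)) / 2))"
    proof (intro mult_mono power_mono)
      have "exp (\<eta> - real CARD('d)) / 2 = exp (s - \<delta>) / 2 * exp (- (s - \<delta> - \<eta> + real CARD('d)))"
        by (simp add: exp_add[symmetric])
      also have "\<dots> \<le> real n * exp (- (s - \<delta> - \<eta> + real CARD('d)))"
        using nl by (intro mult_right_mono) auto
      finally show "exp (- (real n * exp (- (s - \<delta> - \<eta> + real CARD('d))))) \<le> exp (- (exp (\<eta> - real CARD('d)) / 2))"
        by simp
    qed (use c \<delta> s1 in auto)
    finally have p2: "prob {\<omega>\<in>space M. Fminus X n \<omega> < s - \<delta> - \<eta>} \<le> (s + 2) ^ CARD('d) * exp (- (exp (\<eta> - real CARD('d)) / 2))" .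
    show "prob {\<omega>\<in>space M. Ftilde X m \<omega> < s - \<delta> - \<eta>} \<le>
       (if CARD('d) \<ge> 4 then (4 * C) / s\<^sup>2 else (4 * C) / \<delta>\<^sup>2) + (s + 2) ^ CARD('d) * exp (- (exp (\<eta> - real CARD('d)) / 2))"
      using prob_Ftilde_less[OF d2 m n1, of "s - \<delta> - \<eta>"] p1 p2 by linarith
  qed
qed

text \<open>Of the three deltas, one delays the deterministic time, one lifts b' above its logarithm
  so that n e^(-b') <= 2 e^(-delta), and one gives the strict gap b' < b.\<close>

lemma Ftilde_upper_tail:
  assumes d2: "CARD('d) \<ge> 2"
  obtains C where "C \<ge> 1"
    "\<And>m \<delta> K s. m \<ge> 1 \<Longrightarrow> s = record_scale m \<Longrightarrow> \<delta> \<ge> C \<Longrightarrow> K \<ge> 1 \<Longrightarrow>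
       prob {\<omega>\<in>space M. Ftilde X m \<omega> \<ge> s + 3 * \<delta>} \<le>
       (if CARD('d) \<ge> 4 then C / s\<^sup>2 else C / \<delta>\<^sup>2) + (2 * exp (- \<delta>)) ^ (K + 1)
         + 2 * (real (K + 1))\<^sup>2 * exp (- \<delta> - s / real K)"
proof -
  obtain C where C: "C \<ge> 1"
    and C2: "\<And>n m s \<delta>. ln (real n) \<ge> 1 \<Longrightarrow> \<delta> \<ge> C \<Longrightarrow> s + \<delta> \<le> ln (real n) \<Longrightarrow> 0 \<le> s \<Longrightarrow> real m \<le> s ^ CARD('d) / fact CARD('d) \<Longrightarrow>
      prob {\<omega>\<in>space M. num_records X n \<omega> < m} \<le>
        C * (ln (real n) ^ CARD('d) / (ln (real n) ^ (CARD('d) - 1))\<^sup>2) / \<delta>\<^sup>2"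
    by (rule num_records_tail) (rule that)
  show thesis
  proof (rule that[of "4 * C"])
    show "1 \<le> 4 * C" using C by simp
    fix m :: nat and \<delta> s :: real and K :: nat
    assume m: "m \<ge> 1" and s: "s = record_scale m" and \<delta>': "\<delta> \<ge> 4 * C" and K: "K \<ge> 1"
    have \<delta>: "\<delta> \<ge> C" "\<delta> \<ge> 1" using \<delta>' C by linarith+
    have s1: "s \<ge> 1" using record_scale_ge_1[OF m] s by simp
    have sm: "s ^ CARD('d) / fact CARD('d) = real m" by (simp add: s record_scale_power)
    define n where "n = nat \<lceil>exp (s + \<delta>)\<rceil>"
    have nl: "exp (s + \<delta>) \<le> real n" unfolding n_def by (rule real_nat_ceiling_ge)
    have e1: "1 \<le> exp (s + \<delta>)" using s1 \<delta> by simp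
    have "real n \<le> exp (s + \<delta>) + 1" using e1 unfolding n_def by linarith
    then have nu: "real n \<le> 2 * exp (s + \<delta>)" using e1 by linarith
    have n1: "n \<ge> 1" using nl e1 by linarith
    have "ln (exp (s + \<delta>)) \<le> ln (real n)" using nl n1 by (subst ln_le_cancel_iff) auto
    then have ll: "s + \<delta> \<le> ln (real n)" by simp
    then have l1: "1 \<le> ln (real n)" and l2: "s / 2 \<le> ln (real n)" using s1 \<delta> by linarith+
    have "prob {\<omega>\<in>space M. num_records X n \<omega> < m} \<le>
        C * (ln (real n) ^ CARD('d) / (ln (real n) ^ (CARD('d) - 1))\<^sup>2) / \<delta>\<^sup>2"
      by (rule C2[OF l1 \<delta>(1) ll]) (use s1 sm in auto)
    also have "\<dots> \<le> (if CARD('d) \<ge> 4 then (4 * C) / s\<^sup>2 else (4 * C) / \<delta>\<^sup>2)"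
      using s1 \<delta> by (intro tail_ratio_bound d2 C l1 l2) auto
    finally have p1: "prob {\<omega>\<in>space M. num_records X n \<omega> < m} \<le> (if CARD('d) \<ge> 4 then (4 * C) / s\<^sup>2 else (4 * C) / \<delta>\<^sup>2)" .
    define b' where "b' = s + 2 * \<delta>"
    have ne: "real n * exp (- b') \<le> 2 * exp (- \<delta>)"
    proof -
      have "real n * exp (- b') \<le> 2 * exp (s + \<delta>) * exp (- b')" using nu by (intro mult_right_mono) auto
      also have "\<dots> = 2 * exp (- \<delta>)" by (simp add: b'_def exp_add[symmetric] mult.assoc)
      finally show ?thesis .
    qed
    have "prob {\<omega>\<in>space M. Fminus X n \<omega> \<ge> s + 3 * \<delta>} \<le>
        (real n * exp (- b')) ^ (K + 1) + (real (K + 1))\<^sup>2 * real n * exp (- (b' + b' / real K))"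
      using s1 \<delta> by (intro prob_Fminus_ge d2 n1 K) (auto simp: b'_def)
    also have "(real n * exp (- b')) ^ (K + 1) \<le> (2 * exp (- \<delta>)) ^ (K + 1)"
      using ne by (intro power_mono) auto
    also have "(real (K + 1))\<^sup>2 * real n * exp (- (b' + b' / real K)) =
        (real (K + 1))\<^sup>2 * ((real n * exp (- b')) * exp (- (b' / real K)))"
      by (simp add: exp_diff exp_minus field_simps)
    also have "\<dots> \<le> (real (K + 1))\<^sup>2 * ((2 * exp (- \<delta>)) * exp (- (s / real K)))"
      using \<delta> s1 K by (intro mult_left_mono mult_mono ne) (auto simp: b'_def intro!: divide_right_mono)
    also have "\<dots> = 2 * (real (K + 1))\<^sup>2 * exp (- \<delta> - s / real K)"
      by (simp add: exp_diff exp_minus field_simps)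
    finally have p2: "prob {\<omega>\<in>space M. Fminus X n \<omega> \<ge> s + 3 * \<delta>} \<le>
        (2 * exp (- \<delta>)) ^ (K + 1) + 2 * (real (K + 1))\<^sup>2 * exp (- \<delta> - s / real K)" by simp
    show "prob {\<omega>\<in>space M. Ftilde X m \<omega> \<ge> s + 3 * \<delta>} \<le>
       (if CARD('d) \<ge> 4 then (4 * C) / s\<^sup>2 else (4 * C) / \<delta>\<^sup>2) + (2 * exp (- \<delta>)) ^ (K + 1)
         + 2 * (real (K + 1))\<^sup>2 * exp (- \<delta> - s / real K)"
      using prob_Ftilde_ge[OF m, of "s + 3 * \<delta>" n] p1 p2 by linarith
  qed
qed

end

section \<open>Asymptotics\<close>

lemma summable_inverse_square_const: "summable (\<lambda>k. A / (real k)\<^sup>2)"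
proof -
  have "summable (\<lambda>k. inverse ((real k)\<^sup>2))" by (rule inverse_power_summable) simp
  then have "summable (\<lambda>k. A * inverse ((real k)\<^sup>2))" by (rule summable_mult)
  then show ?thesis by (simp add: divide_inverse)
qed

locale exp_vectors_multidim = exp_vectors M X for M :: "'a measure" and X :: "nat \<Rightarrow> 'a \<Rightarrow> real^'d" +
  assumes dim: "CARD('d) \<ge> 2"
begin

lemma inverse_dim: "0 < 1 / real CARD('d)" "1 / real CARD('d) < 1"
  using dim by auto

lemma filterlim_record_scale: "filterlim record_scale at_top sequentially"
proof -
  \<comment> \<open>Stated for arbitrary positive c and p, then specialised to d! and 1/d.\<close>
  have "filterlim (\<lambda>m. (c * real m) powr p) at_top sequentially" if "c > 0" "p > 0" for c p :: real
    using that by real_asymp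
  from this[of "fact CARD('d)", OF _ inverse_dim(1)] show ?thesis
    by (simp add: record_scale_def[abs_def])
qed

lemma eventually_loglog_le_record_scale: "eventually (\<lambda>m. 3 * ln (ln (real m)) + 4 \<le> record_scale m) sequentially"
proof -
  have "eventually (\<lambda>m. 3 * ln (ln (real m)) + 4 \<le> (c * real m) powr p) sequentially" if "c > 0" "p > 0" for c p :: real
    using that by real_asymp
  from this[of "fact CARD('d)", OF _ inverse_dim(1)] show ?thesis
    by (simp add: record_scale_def[abs_def])
qed

lemma eventually_record_scale_le: "eventually (\<lambda>m. record_scale m + 1 \<le> real m) sequentially"
proof -
  have "eventually (\<lambda>m. (c * real m) powr p + 1 \<le> real m) sequentially" if "c > 0" "p > 0" "p < 1" for c p :: real
    using that by real_asymp
  from this[of "fact CARD('d)", OF _ inverse_dim] show ?thesis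
    by (simp add: record_scale_def[abs_def])
qed

lemma inverse_record_scale_square_tendsto: "(\<lambda>m. C / (record_scale m)\<^sup>2) \<longlonglongrightarrow> 0"
proof -
  have "((\<lambda>s::real. C / s\<^sup>2) \<longlongrightarrow> 0) at_top" by real_asymp
  from filterlim_compose[OF this filterlim_record_scale] show ?thesis .
qed

text \<open>With delta = ln ln m and eta = (3/2) ln ln m, e^eta is (ln m)^(3/2), which outgrows the
  logarithm of the polynomial factor of order m.\<close>

lemma prob_Ftilde_lower_tendsto:
  "(\<lambda>m. prob {\<omega>\<in>space M. Ftilde X m \<omega> \<le> record_scale m - 3 * ln (ln (real m))}) \<longlonglongrightarrow> 0"
proof -
  obtain C where C: "C \<ge> 1" and tail:
    "\<And>m \<delta> \<eta> s. m \<ge> 1 \<Longrightarrow> s = record_scale m \<Longrightarrow> \<delta> \<ge> C \<Longrightarrow> 2 * \<delta> + 4 \<le> s \<Longrightarrow> \<delta> + \<eta> \<le> s \<Longrightarrow> 0 \<le> \<eta> \<Longrightarrow>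
       prob {\<omega>\<in>space M. Ftilde X m \<omega> < s - \<delta> - \<eta>} \<le>
       (if CARD('d) \<ge> 4 then C / s\<^sup>2 else C / \<delta>\<^sup>2) + (s + 2) ^ CARD('d) * exp (- (exp (\<eta> - real CARD('d)) / 2))"
    by (rule Ftilde_lower_tail[OF dim]) (rule that)
  \<comment> \<open>For s >= 1, (s + 2)^d <= (3s)^d = 3^d d! m.\<close>
  define A :: real where "A = 3 ^ CARD('d) * fact CARD('d)"
  define U where "U m = C / (record_scale m)\<^sup>2 + (C / (ln (ln (real m)))\<^sup>2 +
    A * real m * exp (- (exp (3 / 2 * ln (ln (real m)) - real CARD('d)) / 2)))" for m
  have "(\<lambda>m. C / (ln (ln (real m)))\<^sup>2 + A * real m * exp (- (exp (3 / 2 * ln (ln (real m)) - a) / 2))) \<longlonglongrightarrow> 0" for a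
    by real_asymp
  then have "U \<longlonglongrightarrow> 0 + 0"
    unfolding U_def by (intro tendsto_add inverse_record_scale_square_tendsto)
  then have U: "U \<longlonglongrightarrow> 0" by simp
  have "eventually (\<lambda>m. C \<le> ln (ln (real m))) sequentially" by real_asymp
  with eventually_loglog_le_record_scale eventually_ge_at_top[of 1]
  have "eventually (\<lambda>m. prob {\<omega>\<in>space M. Ftilde X m \<omega> \<le> record_scale m - 3 * ln (ln (real m))} \<le> U m) sequentially"
  proof eventually_elim
    case (elim m)
    define s \<delta> where "s = record_scale m" and "\<delta> = ln (ln (real m))"
    have \<delta>: "C \<le> \<delta>" "3 * \<delta> + 4 \<le> s" "\<delta> > 0" using elim C by (auto simp: s_def \<delta>_def)
    have s1: "1 \<le> s" using record_scale_ge_1 elim by (simp add: s_def)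
    \<comment> \<open>Delta and eta use up 5/2 of the three multiples of ln ln m; the rest turns the
      non-strict inequality into a strict one.\<close>
    have "prob {\<omega>\<in>space M. Ftilde X m \<omega> \<le> s - 3 * \<delta>} \<le> prob {\<omega>\<in>space M. Ftilde X m \<omega> < s - \<delta> - 3 / 2 * \<delta>}"
      using \<delta> by (intro finite_measure_mono) auto
    also have "\<dots> \<le> (if CARD('d) \<ge> 4 then C / s\<^sup>2 else C / \<delta>\<^sup>2) +
        (s + 2) ^ CARD('d) * exp (- (exp (3 / 2 * \<delta> - real CARD('d)) / 2))"
      using elim \<delta> by (intro tail s_def) auto
    also have "(s + 2) ^ CARD('d) \<le> (3 * s) ^ CARD('d)" using s1 by (intro power_mono) auto
    also have "(3 * s) ^ CARD('d) = A * real m" by (simp add: power_mult_distrib s_def record_scale_power A_def)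
    also have "(if CARD('d) \<ge> 4 then C / s\<^sup>2 else C / \<delta>\<^sup>2) \<le> C / s\<^sup>2 + C / \<delta>\<^sup>2" using C by auto
    finally show ?case by (simp add: U_def s_def \<delta>_def)
  qed
  with U show ?thesis
    by (intro tendsto_sandwich[OF _ _ tendsto_const U]) auto
qed

text \<open>Taking delta = c m / 3, every error term vanishes as soon as delta and s tend to
  infinity, so c may grow arbitrarily slowly.\<close>

lemma prob_Ftilde_upper_tendsto:
  assumes c: "filterlim c at_top sequentially"
  shows "(\<lambda>m. prob {\<omega>\<in>space M. Ftilde X m \<omega> \<ge> record_scale m + c m}) \<longlonglongrightarrow> 0"
proof -
  obtain C where C: "C \<ge> 1" and tail:
    "\<And>m \<delta> K s. m \<ge> 1 \<Longrightarrow> s = record_scale m \<Longrightarrow> \<delta> \<ge> C \<Longrightarrow> K \<ge> 1 \<Longrightarrow>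
       prob {\<omega>\<in>space M. Ftilde X m \<omega> \<ge> s + 3 * \<delta>} \<le>
       (if CARD('d) \<ge> 4 then C / s\<^sup>2 else C / \<delta>\<^sup>2) + (2 * exp (- \<delta>)) ^ (K + 1)
         + 2 * (real (K + 1))\<^sup>2 * exp (- \<delta> - s / real K)"
    by (rule Ftilde_upper_tail[OF dim]) (rule that)
  define V where "V \<delta> = C / \<delta>\<^sup>2 + (2 * exp (- \<delta>))\<^sup>2 + 8 * exp (- \<delta>)" for \<delta> :: real
  have c3: "filterlim (\<lambda>m. c m / 3) at_top sequentially"
    unfolding filterlim_at_top
  proof
    fix Z
    have "eventually (\<lambda>m. 3 * Z \<le> c m) sequentially" using c by (simp add: filterlim_at_top)
    then show "eventually (\<lambda>m. Z \<le> c m / 3) sequentially" by eventually_elim simp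
  qed
  have "(V \<longlongrightarrow> 0) at_top" unfolding V_def by real_asymp
  from filterlim_compose[OF this c3] have "(\<lambda>m. C / (record_scale m)\<^sup>2 + V (c m / 3)) \<longlonglongrightarrow> 0 + 0"
    by (intro tendsto_add inverse_record_scale_square_tendsto)
  then have U: "(\<lambda>m. C / (record_scale m)\<^sup>2 + V (c m / 3)) \<longlonglongrightarrow> 0" by simp
  have "eventually (\<lambda>m. C \<le> c m / 3) sequentially" using c3 by (auto simp: filterlim_at_top)
  with eventually_ge_at_top[of 1]
  have "eventually (\<lambda>m. prob {\<omega>\<in>space M. Ftilde X m \<omega> \<ge> record_scale m + c m} \<le> C / (record_scale m)\<^sup>2 + V (c m / 3)) sequentially"
  proof eventually_elim
    case (elim m)
    define s \<delta> where "s = record_scale m" and "\<delta> = c m / 3"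
    have s1: "1 \<le> s" using record_scale_ge_1 elim by (simp add: s_def)
    have "prob {\<omega>\<in>space M. Ftilde X m \<omega> \<ge> s + 3 * \<delta>} \<le>
        (if CARD('d) \<ge> 4 then C / s\<^sup>2 else C / \<delta>\<^sup>2) + (2 * exp (- \<delta>)) ^ (1 + 1) + 2 * (real (1 + 1))\<^sup>2 * exp (- \<delta> - s / real 1)"
      using elim by (intro tail s_def) (auto simp: \<delta>_def)
    also have "\<dots> \<le> (C / s\<^sup>2 + C / \<delta>\<^sup>2) + (2 * exp (- \<delta>)) ^ (1 + 1) + 2 * (real (1 + 1))\<^sup>2 * exp (- \<delta>)"
      using C s1 by (intro add_mono mult_left_mono) auto
    finally show ?case by (simp add: V_def s_def \<delta>_def power2_eq_square)
  qed
  then show ?thesis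
    by (intro tendsto_sandwich[OF _ _ tendsto_const U]) auto
qed

text \<open>Both one-sided deviations are eventually within eps ln m, since 3 ln ln m = o(ln m) and
  eps ln m is an admissible sequence c.\<close>

lemma Ftilde_in_probability:
  assumes \<epsilon>: "\<epsilon> > 0"
  shows "(\<lambda>m. prob {\<omega>\<in>space M. \<bar>(Ftilde X m \<omega> - record_scale m) / ln (real m)\<bar> > \<epsilon>}) \<longlonglongrightarrow> 0"
proof -
  have "filterlim (\<lambda>m. \<epsilon> * ln (real m)) at_top sequentially" using \<epsilon> by real_asymp
  from tendsto_add[OF prob_Ftilde_lower_tendsto prob_Ftilde_upper_tendsto[OF this]]
  have U: "(\<lambda>m. prob {\<omega>\<in>space M. Ftilde X m \<omega> \<le> record_scale m - 3 * ln (ln (real m))} +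
      prob {\<omega>\<in>space M. Ftilde X m \<omega> \<ge> record_scale m + \<epsilon> * ln (real m)}) \<longlonglongrightarrow> 0" by simp
  have "eventually (\<lambda>m. 3 * ln (ln (real m)) \<le> \<epsilon> * ln (real m)) sequentially" using \<epsilon> by real_asymp
  moreover have "eventually (\<lambda>m. ln (real m) > 0) sequentially" by real_asymp
  ultimately have "eventually (\<lambda>m. prob {\<omega>\<in>space M. \<bar>(Ftilde X m \<omega> - record_scale m) / ln (real m)\<bar> > \<epsilon>} \<le>
      prob {\<omega>\<in>space M. Ftilde X m \<omega> \<le> record_scale m - 3 * ln (ln (real m))} +
      prob {\<omega>\<in>space M. Ftilde X m \<omega> \<ge> record_scale m + \<epsilon> * ln (real m)}) sequentially"
  proof eventually_elim
    case (elim m)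
    have "{\<omega>\<in>space M. \<bar>(Ftilde X m \<omega> - record_scale m) / ln (real m)\<bar> > \<epsilon>} \<subseteq>
        {\<omega>\<in>space M. Ftilde X m \<omega> \<le> record_scale m - 3 * ln (ln (real m))} \<union>
        {\<omega>\<in>space M. Ftilde X m \<omega> \<ge> record_scale m + \<epsilon> * ln (real m)}"
    proof
      fix \<omega> assume \<omega>: "\<omega> \<in> {\<omega>\<in>space M. \<bar>(Ftilde X m \<omega> - record_scale m) / ln (real m)\<bar> > \<epsilon>}"
      then have "\<epsilon> * ln (real m) < \<bar>Ftilde X m \<omega> - record_scale m\<bar>"
        using elim by (simp add: abs_divide pos_less_divide_eq)
      then show "\<omega> \<in> {\<omega>\<in>space M. Ftilde X m \<omega> \<le> record_scale m - 3 * ln (ln (real m))} \<union>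
          {\<omega>\<in>space M. Ftilde X m \<omega> \<ge> record_scale m + \<epsilon> * ln (real m)}"
        using elim \<omega> by (auto simp: abs_if split: if_splits)
    qed
    then have "prob {\<omega>\<in>space M. \<bar>(Ftilde X m \<omega> - record_scale m) / ln (real m)\<bar> > \<epsilon>} \<le>
      prob ({\<omega>\<in>space M. Ftilde X m \<omega> \<le> record_scale m - 3 * ln (ln (real m))} \<union>
        {\<omega>\<in>space M. Ftilde X m \<omega> \<ge> record_scale m + \<epsilon> * ln (real m)})"
      by (rule finite_measure_mono) measurable
    also have "\<dots> \<le> prob {\<omega>\<in>space M. Ftilde X m \<omega> \<le> record_scale m - 3 * ln (ln (real m))} +
        prob {\<omega>\<in>space M. Ftilde X m \<omega> \<ge> record_scale m + \<epsilon> * ln (real m)}"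
      by (rule measure_Un_le) measurable
    finally show ?case .
  qed
  then show ?thesis
    by (intro tendsto_sandwich[OF _ _ tendsto_const U]) auto
qed

section \<open>Checkpoints and the almost sure limit\<close>

definition checkpoint :: "nat \<Rightarrow> nat" where
  "checkpoint k = nat \<lceil>real k ^ CARD('d) / fact CARD('d)\<rceil>"

lemma record_scale_le_iff:
  assumes "0 \<le> x"
  shows "record_scale m \<le> x \<longleftrightarrow> fact CARD('d) * real m \<le> x ^ CARD('d)"
    "x \<le> record_scale m \<longleftrightarrow> x ^ CARD('d) \<le> fact CARD('d) * real m"
  using power_mono_iff[of "record_scale m" x "CARD('d)"] power_mono_iff[of x "record_scale m" "CARD('d)"] assms
  by (simp_all add: record_scale_power)

text \<open>A Galois connection: the k-th checkpoint is the first m whose scale reaches k. Hence the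
  floor of the scale of m tells between which checkpoints m lies.\<close>

lemma checkpoint_le_iff: "checkpoint k \<le> m \<longleftrightarrow> real k \<le> record_scale m"
proof -
  have "checkpoint k \<le> m \<longleftrightarrow> real k ^ CARD('d) / fact CARD('d) \<le> real m"
    unfolding checkpoint_def by (simp add: ceiling_le_iff nat_le_iff)
  also have "\<dots> \<longleftrightarrow> real k \<le> record_scale m"
    by (simp add: record_scale_le_iff divide_le_eq mult.commute)
  finally show ?thesis .
qed

lemma checkpoint_ge_1: "k \<ge> 1 \<Longrightarrow> checkpoint k \<ge> 1"
  using checkpoint_le_iff[of k 0] by (simp add: record_scale_def not_le Suc_le_eq)

lemma record_scale_checkpoint:
  assumes "k \<ge> 1"
  shows "real k \<le> record_scale (checkpoint k)" "record_scale (checkpoint k) \<le> real k + fact CARD('d)"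
proof -
  show "real k \<le> record_scale (checkpoint k)" using checkpoint_le_iff[of k "checkpoint k"] by simp
  define D :: real where "D = fact CARD('d)"
  have D: "D \<ge> 1" by (simp add: D_def fact_ge_1)
  obtain e where e: "CARD('d) = Suc e" by (metis not0_implies_Suc zero_less_card_finite less_irrefl)
  have "real (nat \<lceil>x\<rceil>) \<le> x + 1" if "0 \<le> x" for x :: real using that by linarith
  from this[of "real k ^ CARD('d) / D"] have "real (checkpoint k) \<le> real k ^ CARD('d) / D + 1"
    using D by (simp add: checkpoint_def D_def)
  then have "D * real (checkpoint k) \<le> real k ^ CARD('d) + D"
    using D by (simp add: field_simps)
  \<comment> \<open>The ceiling adds at most 1 to m, hence D to the d-th power; since k >= 1,
    raising the base from k to k + D already adds at least D.\<close>
  also have "\<dots> \<le> (real k + D) ^ CARD('d)"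
  proof -
    have "real k ^ e * (real k + D) \<le> (real k + D) ^ e * (real k + D)"
      using D by (intro mult_right_mono power_mono) auto
    moreover have "1 * D \<le> real k ^ e * D" using assms D by (intro mult_right_mono) auto
    ultimately show ?thesis by (simp add: e algebra_simps)
  qed
  finally show "record_scale (checkpoint k) \<le> real k + fact CARD('d)"
    using D by (simp add: record_scale_le_iff D_def)
qed

text \<open>Borel-Cantelli with delta = eta = eps ln k: the record-time error is O(k^(-2)), and the
  frontier error is a polynomial times exp(-c k^eps).\<close>

lemma AE_eventually_checkpoint_lower:
  assumes d4: "CARD('d) \<ge> 4" and \<epsilon>: "\<epsilon> > 0"
  shows "AE \<omega> in M. eventually (\<lambda>k. record_scale (checkpoint k) - 2 * \<epsilon> * ln (real k) \<le> Ftilde X (checkpoint k) \<omega>) sequentially"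
proof -
  obtain C where C: "C \<ge> 1" and tail:
    "\<And>m \<delta> \<eta> s. m \<ge> 1 \<Longrightarrow> s = record_scale m \<Longrightarrow> \<delta> \<ge> C \<Longrightarrow> 2 * \<delta> + 4 \<le> s \<Longrightarrow> \<delta> + \<eta> \<le> s \<Longrightarrow> 0 \<le> \<eta> \<Longrightarrow>
       prob {\<omega>\<in>space M. Ftilde X m \<omega> < s - \<delta> - \<eta>} \<le>
       (if CARD('d) \<ge> 4 then C / s\<^sup>2 else C / \<delta>\<^sup>2) + (s + 2) ^ CARD('d) * exp (- (exp (\<eta> - real CARD('d)) / 2))"
    by (rule Ftilde_lower_tail[OF dim]) (rule that)
  define B where "B k = {\<omega>\<in>space M. Ftilde X (checkpoint k) \<omega> < record_scale (checkpoint k) - \<epsilon> * ln (real k) - \<epsilon> * ln (real k)}" for k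
  have B: "B k \<in> events" for k unfolding B_def by measurable
  define D :: real where "D = fact CARD('d)"
  \<comment> \<open>The logarithm of the claim that the grid term is at most k^(-2): the right side
    grows like k^eps, the left like ln k.\<close>
  have asymp: "eventually (\<lambda>k. a * ln (real k + b + 2) + 2 * ln (real k) \<le> exp (\<epsilon> * ln (real k) - a) / 2) sequentially"
    if "a > 0" for a b :: real
    using that \<epsilon> by real_asymp
  have "eventually (\<lambda>k. C \<le> \<epsilon> * ln (real k)) sequentially" using \<epsilon> by real_asymp
  moreover have "eventually (\<lambda>k. 2 * (\<epsilon> * ln (real k)) + 4 \<le> real k) sequentially" using \<epsilon> by real_asymp
  moreover have "0 < real CARD('d)" by simp
  note asymp[OF this, of D] eventually_ge_at_top[of 1]
  ultimately have "eventually (\<lambda>k. norm (prob (B k)) \<le> (C + 1) / (real k)\<^sup>2) sequentially"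
  proof eventually_elim
    case (elim k)
    have asy: "real CARD('d) * ln (real k + D + 2) + 2 * ln (real k) \<le> exp (\<epsilon> * ln (real k) - real CARD('d)) / 2"
      by fact
    define s where "s = record_scale (checkpoint k)"
    have s: "real k \<le> s" "s \<le> real k + D" using record_scale_checkpoint elim by (auto simp: s_def D_def)
    have k: "real k \<ge> 1" using elim by simp
    have D1: "D \<ge> 1" by (simp add: D_def fact_ge_1)
    have "prob (B k) \<le> (if CARD('d) \<ge> 4 then C / s\<^sup>2 else C / (\<epsilon> * ln (real k))\<^sup>2) +
        (s + 2) ^ CARD('d) * exp (- (exp (\<epsilon> * ln (real k) - real CARD('d)) / 2))"
      unfolding B_def s_def[symmetric]
      using elim s C by (intro tail checkpoint_ge_1) (auto simp: s_def)
    also have "\<dots> \<le> C / (real k)\<^sup>2 + 1 / (real k)\<^sup>2"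
    proof (rule add_mono)
      show "(if CARD('d) \<ge> 4 then C / s\<^sup>2 else C / (\<epsilon> * ln (real k))\<^sup>2) \<le> C / (real k)\<^sup>2"
        using d4 C s k by (auto intro!: divide_left_mono power_mono)
      have "(s + 2) ^ CARD('d) \<le> (real k + D + 2) ^ CARD('d)" using s k by (intro power_mono) auto
      also have "\<dots> = exp (real CARD('d) * ln (real k + D + 2))"
        using k D1 by (simp add: exp_of_nat_mult)
      finally have "(s + 2) ^ CARD('d) * exp (- (exp (\<epsilon> * ln (real k) - real CARD('d)) / 2)) \<le>
          exp (real CARD('d) * ln (real k + D + 2)) * exp (- (exp (\<epsilon> * ln (real k) - real CARD('d)) / 2))"
        by (intro mult_right_mono) auto
      also have "\<dots> = exp (real CARD('d) * ln (real k + D + 2) - exp (\<epsilon> * ln (real k) - real CARD('d)) / 2)"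
        by (simp only: diff_conv_add_uminus exp_add)
      also have "\<dots> \<le> exp (- (2 * ln (real k)))" using asy by simp
      also have "\<dots> = 1 / (real k)\<^sup>2"
        using k by (simp add: exp_minus exp_of_nat_mult[of 2, simplified] inverse_eq_divide)
      finally show "(s + 2) ^ CARD('d) * exp (- (exp (\<epsilon> * ln (real k) - real CARD('d)) / 2)) \<le> 1 / (real k)\<^sup>2" .
    qed
    finally show ?case by (simp add: add_divide_distrib)
  qed
  then have "summable (\<lambda>k. prob (B k))"
    by (rule summable_comparison_test_ev) (rule summable_inverse_square_const)
  then have "AE \<omega> in M. eventually (\<lambda>k. \<omega> \<in> space M - B k) sequentially"
    using B by (intro borel_cantelli_AE1) (auto simp: emeasure_eq_measure)
  then show ?thesis
    by eventually_elim (auto simp: B_def not_less elim!: eventually_mono)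
qed

text \<open>Borel-Cantelli with delta = eps ln k: K depends on eps alone, so one term is
  O(k^(-eps(K+1))) and the shared-observation term is of order e^(-k/K) at most.\<close>

lemma AE_eventually_checkpoint_upper:
  assumes d4: "CARD('d) \<ge> 4" and \<epsilon>: "\<epsilon> > 0"
  shows "AE \<omega> in M. eventually (\<lambda>k. Ftilde X (checkpoint k) \<omega> \<le> record_scale (checkpoint k) + 3 * (\<epsilon> * ln (real k))) sequentially"
proof -
  obtain C where C: "C \<ge> 1" and tail:
    "\<And>m \<delta> K s. m \<ge> 1 \<Longrightarrow> s = record_scale m \<Longrightarrow> \<delta> \<ge> C \<Longrightarrow> K \<ge> 1 \<Longrightarrow>
       prob {\<omega>\<in>space M. Ftilde X m \<omega> \<ge> s + 3 * \<delta>} \<le>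
       (if CARD('d) \<ge> 4 then C / s\<^sup>2 else C / \<delta>\<^sup>2) + (2 * exp (- \<delta>)) ^ (K + 1)
         + 2 * (real (K + 1))\<^sup>2 * exp (- \<delta> - s / real K)"
    by (rule Ftilde_upper_tail[OF dim]) (rule that)
  \<comment> \<open>Chosen so that eps (K+1) >= 2, which makes the distinct-observation term
    O(k^(-2)).\<close>
  define K where "K = nat \<lceil>2 / \<epsilon>\<rceil> + 1"
  have K1: "K \<ge> 1" by (simp add: K_def)
  have "2 / \<epsilon> \<le> real K" using real_nat_ceiling_ge[of "2 / \<epsilon>"] by (simp add: K_def)
  then have K: "2 \<le> \<epsilon> * real (K + 1)" using \<epsilon> by (simp add: divide_le_eq algebra_simps)
  define B where "B k = {\<omega>\<in>space M. Ftilde X (checkpoint k) \<omega> \<ge> record_scale (checkpoint k) + 3 * (\<epsilon> * ln (real k))}" for k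
  have B: "B k \<in> events" for k unfolding B_def by measurable
  define A where "A = C + 2 ^ (K + 1) + 2 * (real (K + 1))\<^sup>2"
  have asymp: "eventually (\<lambda>k. 2 * ln (real k) \<le> real k / a) sequentially" if "a > 0" for a :: real
    using that by real_asymp
  have "eventually (\<lambda>k. C \<le> \<epsilon> * ln (real k)) sequentially" using \<epsilon> by real_asymp
  moreover have "0 < real K" using K1 by simp
  note asymp[OF this] eventually_ge_at_top[of 1]
  ultimately have "eventually (\<lambda>k. norm (prob (B k)) \<le> A / (real k)\<^sup>2) sequentially"
  proof eventually_elim
    case (elim k)
    have asy: "2 * ln (real k) \<le> real k / real K" by fact
    define s where "s = record_scale (checkpoint k)"
    have s: "real k \<le> s" using record_scale_checkpoint elim by (auto simp: s_def)
    have k: "real k \<ge> 1" using elim by simp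
    have ek: "exp (- (2 * ln (real k))) = 1 / (real k)\<^sup>2"
      using k by (simp add: exp_minus exp_of_nat_mult[of 2, simplified] inverse_eq_divide)
    have "prob (B k) \<le> (if CARD('d) \<ge> 4 then C / s\<^sup>2 else C / (\<epsilon> * ln (real k))\<^sup>2) +
        (2 * exp (- (\<epsilon> * ln (real k)))) ^ (K + 1) + 2 * (real (K + 1))\<^sup>2 * exp (- (\<epsilon> * ln (real k)) - s / real K)"
      unfolding B_def s_def[symmetric]
      using elim K1 by (intro tail checkpoint_ge_1) (auto simp: s_def)
    also have "\<dots> \<le> C / (real k)\<^sup>2 + 2 ^ (K + 1) * (1 / (real k)\<^sup>2) + 2 * (real (K + 1))\<^sup>2 * (1 / (real k)\<^sup>2)"
    proof (intro add_mono mult_left_mono)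
      show "(if CARD('d) \<ge> 4 then C / s\<^sup>2 else C / (\<epsilon> * ln (real k))\<^sup>2) \<le> C / (real k)\<^sup>2"
        using d4 C s k by (auto intro!: divide_left_mono power_mono)
      have "(2 * exp (- (\<epsilon> * ln (real k)))) ^ (K + 1) = 2 ^ (K + 1) * exp (- (\<epsilon> * real (K + 1) * ln (real k)))"
        by (simp only: power_mult_distrib exp_of_nat_mult[symmetric]) (simp add: algebra_simps)
      also have "\<dots> \<le> 2 ^ (K + 1) * exp (- (2 * ln (real k)))"
        using mult_right_mono[OF K, of "ln (real k)"] k by (intro mult_left_mono) auto
      finally show "(2 * exp (- (\<epsilon> * ln (real k)))) ^ (K + 1) \<le> 2 ^ (K + 1) * (1 / (real k)\<^sup>2)"
        unfolding ek .
      have "real k / real K \<le> s / real K" using s by (intro divide_right_mono) auto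
      then have "- (\<epsilon> * ln (real k)) - s / real K \<le> - (2 * ln (real k))"
        using asy elim C by linarith
      then have "exp (- (\<epsilon> * ln (real k)) - s / real K) \<le> exp (- (2 * ln (real k)))" by simp
      then show "exp (- (\<epsilon> * ln (real k)) - s / real K) \<le> 1 / (real k)\<^sup>2" unfolding ek .
    qed auto
    finally show ?case by (simp add: add_divide_distrib A_def)
  qed
  then have "summable (\<lambda>k. prob (B k))"
    by (rule summable_comparison_test_ev) (rule summable_inverse_square_const)
  then have "AE \<omega> in M. eventually (\<lambda>k. \<omega> \<in> space M - B k) sequentially"
    using B by (intro borel_cantelli_AE1) (auto simp: emeasure_eq_measure)
  then show ?thesis
    by eventually_elim (auto simp: B_def not_le intro: less_imp_le elim!: eventually_mono)
qed

text \<open>Purely deterministic, for one sample path. The accuracies range over the countable set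
  of 1/(j+1), so the exceptional null sets can be united afterwards.\<close>

lemma interpolate_checkpoints:
  fixes F :: "nat \<Rightarrow> real"
  assumes mono: "\<And>m m'. 1 \<le> m \<Longrightarrow> m \<le> m' \<Longrightarrow> F m \<le> F m'"
    and lower: "\<And>\<epsilon>. \<epsilon> \<in> range (\<lambda>j. 1 / real (Suc j)) \<Longrightarrow>
      eventually (\<lambda>k. record_scale (checkpoint k) - 2 * \<epsilon> * ln (real k) \<le> F (checkpoint k)) sequentially"
    and upper: "\<And>\<epsilon>. \<epsilon> \<in> range (\<lambda>j. 1 / real (Suc j)) \<Longrightarrow>
      eventually (\<lambda>k. F (checkpoint k) \<le> record_scale (checkpoint k) + 3 * (\<epsilon> * ln (real k))) sequentially"
  shows "(\<lambda>m. (F m - record_scale m) / ln (real m)) \<longlonglongrightarrow> 0"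
proof (rule tendstoI)
  fix e :: real assume e: "e > 0"
  obtain j where j: "1 / real (Suc j) < e / 6" using e by (metis nat_approx_posE zero_less_divide_iff zero_less_numeral)
  define \<epsilon> where "\<epsilon> = 1 / real (Suc j)"
  have \<epsilon>: "\<epsilon> > 0" "\<epsilon> < e / 6" "\<epsilon> \<in> range (\<lambda>j. 1 / real (Suc j))" using j by (auto simp: \<epsilon>_def)
  define D :: real where "D = fact CARD('d)"
  have D: "D \<ge> 1" by (simp add: D_def fact_ge_1)
  \<comment> \<open>The checkpoints of k m and of its successor enclose m, so monotonicity transfers
    both bounds to m.\<close>
  define k where "k m = nat \<lfloor>record_scale m\<rfloor>" for m
  have klim: "filterlim k at_top sequentially"
    unfolding filterlim_at_top
  proof
    fix Z :: nat
    have "eventually (\<lambda>m. real Z \<le> record_scale m) sequentially"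
      using filterlim_record_scale by (auto simp: filterlim_at_top)
    then show "eventually (\<lambda>m. Z \<le> k m) sequentially"
      by eventually_elim (simp add: k_def le_nat_floor)
  qed
  have k1lim: "filterlim (\<lambda>m. Suc (k m)) at_top sequentially"
    using klim by (rule filterlim_compose[OF filterlim_Suc])
  \<comment> \<open>The interpolation costs at most 1 + D, absorbed by one half of e ln m; the other
    half covers 3 eps ln m because eps < e/6.\<close>
  have "eventually (\<lambda>m. D + 2 < e / 2 * ln (real m)) sequentially" using e by real_asymp
  moreover note eventually_compose_filterlim[OF lower[OF \<epsilon>(3)] klim]
    eventually_compose_filterlim[OF upper[OF \<epsilon>(3)] k1lim]
    eventually_record_scale_le
    eventually_compose_filterlim[OF eventually_ge_at_top[of 1] klim]
    eventually_ge_at_top[of 1]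
  ultimately show "eventually (\<lambda>m. dist ((F m - record_scale m) / ln (real m)) 0 < e) sequentially"
  proof eventually_elim
    case (elim m)
    define s where "s = record_scale m"
    have ks: "real (k m) \<le> s" "s < real (Suc (k m))"
      unfolding k_def s_def by (simp_all add: of_nat_floor) linarith
    have k1: "1 \<le> k m" using elim by simp
    have lnk: "0 \<le> ln (real (k m))" "ln (real (k m)) \<le> ln (real m)" "ln (real (Suc (k m))) \<le> ln (real m)"
      using k1 ks elim by (auto simp: s_def)
    have "D + 2 < e / 2 * ln (real m)" by fact
    with D have "0 < e / 2 * ln (real m)" by linarith
    then have lnm: "0 < ln (real m)" using e by (simp add: zero_less_mult_iff)
    have \<epsilon>m: "3 * (\<epsilon> * ln (real m)) \<le> e / 2 * ln (real m)"
      using mult_right_mono[of "3 * \<epsilon>" "e / 2" "ln (real m)"] \<epsilon> lnm by simp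
    have \<epsilon>k: "\<epsilon> * ln (real (k m)) \<le> \<epsilon> * ln (real m)" "\<epsilon> * ln (real (Suc (k m))) \<le> \<epsilon> * ln (real m)" "0 \<le> \<epsilon> * ln (real m)"
      using lnk lnm \<epsilon> by (auto intro!: mult_left_mono)
    have "checkpoint (k m) \<le> m" using ks by (simp add: checkpoint_le_iff s_def)
    then have "F (checkpoint (k m)) \<le> F m" by (intro mono checkpoint_ge_1 k1)
    moreover have "real (k m) \<le> record_scale (checkpoint (k m))" by (rule record_scale_checkpoint(1)[OF k1])
    moreover have "record_scale (checkpoint (k m)) - 2 * \<epsilon> * ln (real (k m)) \<le> F (checkpoint (k m))" using elim by simp
    ultimately have low: "s - 1 - 2 * (\<epsilon> * ln (real m)) \<le> F m"
      using ks \<epsilon>k by (simp add: mult.assoc)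
    have "\<not> checkpoint (Suc (k m)) \<le> m" using ks by (simp add: checkpoint_le_iff s_def del: of_nat_Suc)
    then have "F m \<le> F (checkpoint (Suc (k m)))" using elim by (intro mono) auto
    moreover have "record_scale (checkpoint (Suc (k m))) \<le> real (Suc (k m)) + D"
      unfolding D_def by (rule record_scale_checkpoint(2)) simp
    moreover have "F (checkpoint (Suc (k m))) \<le> record_scale (checkpoint (Suc (k m))) + 3 * (\<epsilon> * ln (real (Suc (k m))))"
      using elim by simp
    ultimately have up: "F m \<le> s + 1 + D + 3 * (\<epsilon> * ln (real m))"
      using ks \<epsilon>k by simp
    have "\<bar>F m - s\<bar> < e * ln (real m)"
      using low up \<epsilon>m \<epsilon>k D elim by (simp add: abs_less_iff)
    then show ?case
      using lnm by (simp add: s_def dist_real_def abs_divide pos_divide_less_eq)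
  qed
qed

text \<open>Monotonicity of \<open>Ftilde\<close> in m along a path needs positive observations and
  infinitely many records, so both almost sure facts join the checkpoint bounds.\<close>

lemma Ftilde_almost_surely:
  assumes "CARD('d) \<ge> 4"
  shows "AE \<omega> in M. (\<lambda>m. (Ftilde X m \<omega> - record_scale m) / ln (real m)) \<longlonglongrightarrow> 0"
proof -
  have "AE \<omega> in M. \<forall>j. eventually (\<lambda>k. record_scale (checkpoint k) - 2 * (1 / real (Suc j)) * ln (real k) \<le> Ftilde X (checkpoint k) \<omega>) sequentially"
    unfolding AE_all_countable by (intro allI AE_eventually_checkpoint_lower assms) simp
  moreover have "AE \<omega> in M. \<forall>j. eventually (\<lambda>k. Ftilde X (checkpoint k) \<omega> \<le> record_scale (checkpoint k) + 3 * (1 / real (Suc j) * ln (real k))) sequentially"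
    unfolding AE_all_countable by (intro allI AE_eventually_checkpoint_upper assms) simp
  ultimately show ?thesis
    using AE_positive AE_num_records_unbounded[OF dim]
  proof eventually_elim
    case (elim \<omega>)
    show ?case
    proof (rule interpolate_checkpoints)
      fix m m' :: nat assume m: "1 \<le> m" "m \<le> m'"
      obtain n where "m' \<le> num_records X n \<omega>" using elim by blast
      then show "Ftilde X m \<omega> \<le> Ftilde X m' \<omega>" using elim m by (intro Ftilde_mono[of X \<omega> m m' n]) auto
    qed (use elim in blast)+
  qed
qed

end

text \<open>Measurability comes first in the conclusion because \<open>measure\<close> assigns 0 to
  non-measurable sets: it certifies that the limits concern genuine events.\<close>

theorem theorem5p5:
  fixes M :: "'a measure" and X :: "nat \<Rightarrow> 'a \<Rightarrow> real^'d"
  assumes "prob_space M"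
    and "CARD('d) \<ge> 2"
    and "prob_space.indep_vars M (\<lambda>_. borel) (\<lambda>(i, j) \<omega>. X i \<omega> $ j) ({1..} \<times> UNIV)"
    and "\<And>i j. i \<ge> 1 \<Longrightarrow> distributed M lborel (\<lambda>\<omega>. X i \<omega> $ j) (exponential_density 1)"
  shows "(\<forall>m. Ftilde X m \<in> borel_measurable M)
    \<and> ((\<lambda>m. measure M {\<omega> \<in> space M.
          Ftilde X m \<omega> \<le> (fact CARD('d) * real m) powr (1 / real CARD('d)) - 3 * ln (ln (real m))})
        \<longlonglongrightarrow> 0)
    \<and> (\<forall>c :: nat \<Rightarrow> real. filterlim c at_top sequentially \<longrightarrow>
        (\<lambda>m. measure M {\<omega> \<in> space M.
          Ftilde X m \<omega> \<ge> (fact CARD('d) * real m) powr (1 / real CARD('d)) + c m})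
        \<longlonglongrightarrow> 0)
    \<and> (\<forall>\<epsilon>>0. (\<lambda>m. measure M {\<omega> \<in> space M.
          \<bar>(Ftilde X m \<omega> - (fact CARD('d) * real m) powr (1 / real CARD('d))) / ln (real m)\<bar> > \<epsilon>})
        \<longlonglongrightarrow> 0)
    \<and> (CARD('d) \<ge> 5 \<longrightarrow>
        (AE \<omega> in M. (\<lambda>m. (Ftilde X m \<omega> - (fact CARD('d) * real m) powr (1 / real CARD('d))) / ln (real m))
            \<longlonglongrightarrow> 0))"
proof -
  interpret prob_space M by fact
  interpret exp_vectors_multidim M X
    by unfold_locales (use assms in auto)
  show ?thesis
    unfolding record_scale_def[symmetric]
    using random_variable_Ftilde prob_Ftilde_lower_tendsto prob_Ftilde_upper_tendsto
      Ftilde_in_probability Ftilde_almost_surely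
    by auto
qed

end
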